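(* Let $n\ge 2$, let $W^1,\dots,W^{n-1}$ be independent standard Wiener processes, $W^0_t=t$, and let $I_\alpha$, $J_\alpha$ denote the Itô and Stratonovich iterated integrals for words $\alpha$ with letters in $\{0,\dots,n-1\}$. Suppose that $$J_\alpha=\sum_\beta c_\beta I_\beta+p_\alpha I_{(0,\dots,0)},$$ where the sum is finite, each word $\beta$ contains at least one nonzero letter, $c_\beta,p_\alpha\in\mathbb{R}$, and $(0,\dots,0)$ is the word consisting of $q_\alpha$ zeros. If $p_\alpha\neq 0$, then $$p_\alpha=\frac{1}{2^{\#\{i:\alpha_i\neq 0\}/2}},\qquad q_\alpha=\frac{\#\{i:\alpha_i\neq0\}}{2}+\#\{i:\alpha_i=0\}.$$
   Context: Time is treated as the zeroth driver, $dW^0_t=dt$. For a word $\alpha=(\alpha_1,\dots,\alpha_\ell)$, $I_\alpha(t)=\int\cdots\int_{0<u_1<\cdots<u_\ell<t} dW^{\alpha_1}_{u_1}\cdots dW^{\alpha_\ell}_{u_\ell}$ (Itô) and $J_\alpha(t)=\int\cdots\int_{0<u_1<\cdots<u_\ell<t}\circ dW^{\alpha_1}_{u_1}\cdots\circ dW^{\alpha_\ell}_{u_\ell}$ (Stratonovich). *)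

theory Defs
  imports "HOL-Probability.Probability"
begin

definition wiener_setup :: "'a measure \<Rightarrow> nat \<Rightarrow> (nat \<Rightarrow> real \<Rightarrow> 'a \<Rightarrow> real) \<Rightarrow> bool" where
  "wiener_setup M n W \<longleftrightarrow>
     prob_space M \<and>
     (\<forall>t \<omega>. W 0 t \<omega> = t) \<and>
     (\<forall>j\<in>{1..<n}. \<forall>t. W j t \<in> borel_measurable M) \<and>
     (\<forall>j\<in>{1..<n}. \<forall>\<omega>\<in>space M. W j 0 \<omega> = 0 \<and> continuous_on {0..} (\<lambda>t. W j t \<omega>)) \<and>
     (\<forall>(s::nat \<Rightarrow> real) m. 0 \<le> s 0 \<and> (\<forall>k<m. s k < s (Suc k)) \<longrightarrow>
        prob_space.indep_vars M (\<lambda>_. borel) (\<lambda>(j,k) \<omega>. W j (s (Suc k)) \<omega> - W j (s k) \<omega>)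
          ({1..<n} \<times> {..<m}) \<and>
        (\<forall>j\<in>{1..<n}. \<forall>k<m. distributed M lborel (\<lambda>\<omega>. W j (s (Suc k)) \<omega> - W j (s k) \<omega>)
             (normal_density 0 (sqrt (s (Suc k) - s k)))))"

definition conv_in_prob :: "'a measure \<Rightarrow> (nat \<Rightarrow> 'a \<Rightarrow> real) \<Rightarrow> ('a \<Rightarrow> real) \<Rightarrow> bool" where
  "conv_in_prob M X Y \<longleftrightarrow>
     (\<forall>e>0. (\<lambda>N. measure M {\<omega>\<in>space M. e < \<bar>X N \<omega> - Y \<omega>\<bar>}) \<longlonglongrightarrow> 0)"

definition grid :: "real \<Rightarrow> nat \<Rightarrow> nat \<Rightarrow> real" where
  "grid t N k = real k * t / real (Suc N)"

text \<open>Iterated integrals, indexed by the REVERSED word: the head of the list is the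
outermost (last) letter. Ito: left-point Riemann sums; Stratonovich: trapezoidal sums;
the integral is the limit in probability of these sums along uniform partitions.\<close>
primrec ito_rev :: "'a measure \<Rightarrow> (nat \<Rightarrow> real \<Rightarrow> 'a \<Rightarrow> real) \<Rightarrow> nat list \<Rightarrow> real \<Rightarrow> 'a \<Rightarrow> real" where
  "ito_rev M W [] = (\<lambda>t \<omega>. 1)"
| "ito_rev M W (j # \<beta>) = (\<lambda>t. SOME X. X \<in> borel_measurable M \<and>
     conv_in_prob M (\<lambda>N \<omega>. \<Sum>k<Suc N. ito_rev M W \<beta> (grid t N k) \<omega> *
        (W j (grid t N (Suc k)) \<omega> - W j (grid t N k) \<omega>)) X)"

primrec strat_rev :: "'a measure \<Rightarrow> (nat \<Rightarrow> real \<Rightarrow> 'a \<Rightarrow> real) \<Rightarrow> nat list \<Rightarrow> real \<Rightarrow> 'a \<Rightarrow> real" where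
  "strat_rev M W [] = (\<lambda>t \<omega>. 1)"
| "strat_rev M W (j # \<beta>) = (\<lambda>t. SOME X. X \<in> borel_measurable M \<and>
     conv_in_prob M (\<lambda>N \<omega>. \<Sum>k<Suc N.
        (strat_rev M W \<beta> (grid t N k) \<omega> + strat_rev M W \<beta> (grid t N (Suc k)) \<omega>) / 2 *
        (W j (grid t N (Suc k)) \<omega> - W j (grid t N k) \<omega>)) X)"

text \<open>I_alpha(t) and J_alpha(t) for a word alpha = [alpha_1, ..., alpha_l]
(alpha_1 innermost, u_1 < ... < u_l).\<close>
definition ito_int :: "'a measure \<Rightarrow> (nat \<Rightarrow> real \<Rightarrow> 'a \<Rightarrow> real) \<Rightarrow> nat list \<Rightarrow> real \<Rightarrow> 'a \<Rightarrow> real" where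
  "ito_int M W \<alpha> = ito_rev M W (rev \<alpha>)"

definition strat_int :: "'a measure \<Rightarrow> (nat \<Rightarrow> real \<Rightarrow> 'a \<Rightarrow> real) \<Rightarrow> nat list \<Rightarrow> real \<Rightarrow> 'a \<Rightarrow> real" where
  "strat_int M W \<alpha> = strat_rev M W (rev \<alpha>)"

end

theory Submission
  imports Defs
begin

text \<open>Take expectations. An iterated Ito integral has mean \<open>0\<close> as soon as its word has a nonzero
  letter, and \<open>I\<^bsub>(0,...,0)\<^esub>(t) = t\<^sup>q / q!\<close>, so the hypothesis gives \<open>E J\<^sub>\<alpha>(t) = p t\<^sup>q / q!\<close>.
  On the other hand \<open>J\<^bsub>\<beta>j\<^esub> = \<integral> J\<^sub>\<beta> dW\<^sup>j + [J\<^sub>\<beta>, W\<^sup>j] / 2\<close>, where the covariation vanishes unless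
  \<open>\<beta> = \<gamma>j\<close> with \<open>j \<noteq> 0\<close>, in which case it is \<open>\<integral> J\<^sub>\<gamma> dt\<close>. Hence the mean of \<open>J\<^sub>\<alpha>\<close> is nonzero only if
  \<open>\<alpha>\<close> is a concatenation of zeros and of pairs \<open>jj\<close>; each zero contributes a time integration and each
  pair a time integration and a factor \<open>1/2\<close>. Comparing at \<open>t = 1\<close> and \<open>t = 2\<close> yields \<open>p\<close> and \<open>q\<close>.

  All integrals are handled in \<open>L\<^sup>2\<close>, within the class of adapted processes with
  \<open>E (X\<^sub>b - X\<^sub>a)\<^sup>2 \<le> L (b - a)\<close> on bounded intervals, which is stable under integration.\<close>

section \<open>Square-integrable random variables and convergence in probability\<close>

text \<open>The obstacle is that each iterated integral is chosen by \<open>SOME\<close>, separately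
  at every time, as a limit in probability. Such a limit fixes the value only up to a null set that
  varies with the time, and it says nothing about means. The induction over words therefore runs not
  on the chosen integrals but on regular processes that agree with them almost surely at each fixed
  time; this suffices because a Riemann sum looks at finitely many times. Means pass to the limit
  because left-point sums of such processes converge in mean square. Trapezoidal sums are not
  adapted, so they admit no isometry of their own. The correction that separates them from
  left-point sums depends on how the integrand moves, and this cannot be read off its mean: the
  Stratonovich induction has to carry, along with \<open>X\<close>, the coefficient \<open>Y\<close>
  of its noise part. The error in the covariation is a product of two square-integrable factors and
  is controlled in L1 only, which is still enough for convergence in probability.\<close>

definition sqint :: "'a measure \<Rightarrow> ('a \<Rightarrow> real) \<Rightarrow> bool" where
  "sqint M X \<longleftrightarrow> X \<in> borel_measurable M \<and> integrable M (\<lambda>\<omega>. (X \<omega>)\<^sup>2)"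

definition msq :: "'a measure \<Rightarrow> ('a \<Rightarrow> real) \<Rightarrow> real" where
  "msq M X = (\<integral>\<omega>. (X \<omega>)\<^sup>2 \<partial>M)"

lemma msq_nonneg: "0 \<le> msq M X"
  by (simp add: msq_def)

lemma sqint_measurable: "sqint M X \<Longrightarrow> X \<in> borel_measurable M"
  by (simp add: sqint_def)

lemma sqint_integrable_mult:
  assumes "sqint M X" "sqint M Y"
  shows "integrable M (\<lambda>\<omega>. X \<omega> * Y \<omega>)"
proof (rule Bochner_Integration.integrable_bound)
  show "integrable M (\<lambda>\<omega>. (X \<omega>)\<^sup>2 + (Y \<omega>)\<^sup>2)"
    using assms by (simp add: sqint_def)
  show "(\<lambda>\<omega>. X \<omega> * Y \<omega>) \<in> borel_measurable M"
    using assms by (auto simp: sqint_def)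
  have "\<bar>x * y\<bar> \<le> x\<^sup>2 + y\<^sup>2" for x y :: real
  proof -
    have "2 * \<bar>x\<bar> * \<bar>y\<bar> \<le> \<bar>x\<bar>\<^sup>2 + \<bar>y\<bar>\<^sup>2" by (rule sum_squares_bound)
    moreover have "0 \<le> \<bar>x\<bar> * \<bar>y\<bar>" by simp
    ultimately show ?thesis unfolding abs_mult power2_abs mult.assoc by linarith
  qed
  then show "AE \<omega> in M. norm (X \<omega> * Y \<omega>) \<le> norm ((X \<omega>)\<^sup>2 + (Y \<omega>)\<^sup>2)"
    by (auto intro!: AE_I2)
qed

lemma sqint_add:
  assumes "sqint M X" "sqint M Y"
  shows "sqint M (\<lambda>\<omega>. X \<omega> + Y \<omega>)"
  using assms sqint_integrable_mult[OF assms]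
  by (auto simp: sqint_def power2_sum mult.assoc)

lemma sqint_cmult: "sqint M X \<Longrightarrow> sqint M (\<lambda>\<omega>. c * X \<omega>)"
  by (auto simp: sqint_def power_mult_distrib)

lemma sqint_diff:
  assumes "sqint M X" "sqint M Y"
  shows "sqint M (\<lambda>\<omega>. X \<omega> - Y \<omega>)"
  using sqint_add[OF assms(1) sqint_cmult[OF assms(2), of "-1"]] by simp

lemma sqint_sum:
  assumes "\<And>i. i \<in> I \<Longrightarrow> sqint M (X i)"
  shows "sqint M (\<lambda>\<omega>. \<Sum>i\<in>I. X i \<omega>)"
  using assms
proof (induction I rule: infinite_finite_induct)
  case (insert i I)
  then show ?case by (simp add: sqint_add)
qed (auto simp: sqint_def)

lemma msq_cmult: "msq M (\<lambda>\<omega>. c * X \<omega>) = c\<^sup>2 * msq M X"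
  by (simp add: msq_def power_mult_distrib)

lemma msq_add_le:
  assumes "sqint M X" "sqint M Y"
  shows "msq M (\<lambda>\<omega>. X \<omega> + Y \<omega>) \<le> 2 * msq M X + 2 * msq M Y"
proof -
  have "msq M (\<lambda>\<omega>. X \<omega> + Y \<omega>) \<le> (\<integral>\<omega>. 2 * (X \<omega>)\<^sup>2 + 2 * (Y \<omega>)\<^sup>2 \<partial>M)"
    unfolding msq_def
  proof (rule integral_mono)
    show "integrable M (\<lambda>\<omega>. (X \<omega> + Y \<omega>)\<^sup>2)" using sqint_add[OF assms] by (simp add: sqint_def)
    show "(X \<omega> + Y \<omega>)\<^sup>2 \<le> 2 * (X \<omega>)\<^sup>2 + 2 * (Y \<omega>)\<^sup>2" for \<omega>
      using sum_squares_bound[of "X \<omega>" "Y \<omega>"] by (simp add: power2_sum)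
  qed (use assms in \<open>auto simp: sqint_def\<close>)
  also have "\<dots> = 2 * msq M X + 2 * msq M Y"
    using assms by (simp add: sqint_def msq_def)
  finally show ?thesis .
qed

lemma msq_diff_le:
  assumes "sqint M X" "sqint M Y"
  shows "msq M (\<lambda>\<omega>. X \<omega> - Y \<omega>) \<le> 2 * msq M X + 2 * msq M Y"
  using msq_add_le[OF assms(1) sqint_cmult[OF assms(2), of "-1"]] msq_cmult[of M "-1" Y] by simp

text \<open>Cauchy-Schwarz for the measure with weights \<open>w\<close>: the constant is the total
  mass, not the number of terms, so the bound survives refinement of a partition.\<close>

lemma msq_weighted_sum_le:
  assumes fin: "finite I" and w: "\<And>i. i \<in> I \<Longrightarrow> 0 \<le> w i" and X: "\<And>i. i \<in> I \<Longrightarrow> sqint M (X i)"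
  shows "msq M (\<lambda>\<omega>. \<Sum>i\<in>I. w i * X i \<omega>) \<le> (\<Sum>i\<in>I. w i) * (\<Sum>i\<in>I. w i * msq M (X i))"
proof -
  have pw: "(\<Sum>i\<in>I. w i * X i \<omega>)\<^sup>2 \<le> (\<Sum>i\<in>I. w i) * (\<Sum>i\<in>I. w i * (X i \<omega>)\<^sup>2)" for \<omega>
  proof -
    have "(\<Sum>i\<in>I. w i * X i \<omega>)\<^sup>2 = (\<Sum>i\<in>I. sqrt (w i) * (sqrt (w i) * X i \<omega>))\<^sup>2"
      using w by (intro arg_cong[where f="\<lambda>x. x\<^sup>2"] sum.cong) (auto simp flip: mult.assoc)
    also have "\<dots> \<le> (\<Sum>i\<in>I. (sqrt (w i))\<^sup>2) * (\<Sum>i\<in>I. (sqrt (w i) * X i \<omega>)\<^sup>2)"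
      by (rule Cauchy_Schwarz_ineq_sum)
    also have "\<dots> = (\<Sum>i\<in>I. w i) * (\<Sum>i\<in>I. w i * (X i \<omega>)\<^sup>2)"
      using w by (simp add: power_mult_distrib)
    finally show ?thesis .
  qed
  have "msq M (\<lambda>\<omega>. \<Sum>i\<in>I. w i * X i \<omega>) \<le> (\<integral>\<omega>. (\<Sum>i\<in>I. w i) * (\<Sum>i\<in>I. w i * (X i \<omega>)\<^sup>2) \<partial>M)"
    unfolding msq_def
  proof (rule integral_mono)
    show "integrable M (\<lambda>\<omega>. (\<Sum>i\<in>I. w i * X i \<omega>)\<^sup>2)"
      using sqint_sum[of I M "\<lambda>i \<omega>. w i * X i \<omega>"] X by (simp add: sqint_cmult) (simp add: sqint_def)
  qed (use X pw in \<open>auto simp: sqint_def\<close>)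
  also have "\<dots> = (\<Sum>i\<in>I. w i) * (\<Sum>i\<in>I. w i * msq M (X i))"
    using X by (simp add: msq_def sqint_def)
  finally show ?thesis .
qed

section \<open>Completeness of the space of square-integrable variables, and limits in
  probability\<close>

context prob_space
begin

lemma sqint_const [simp]: "sqint M (\<lambda>_. c)"
  by (simp add: sqint_def)

lemma sqint_integrable: "sqint M X \<Longrightarrow> integrable M X"
  using sqint_integrable_mult[of M X "\<lambda>_. 1"] by simp

lemma expectation_sq_le_msq:
  assumes "sqint M X" shows "(expectation X)\<^sup>2 \<le> msq M X"
proof -
  have "0 \<le> variance X" by simp
  also have "variance X = msq M X - (expectation X)\<^sup>2"
    using assms sqint_integrable[OF assms] by (subst variance_eq) (auto simp: sqint_def msq_def)
  finally show ?thesis by simp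
qed

text \<open>Completeness of \<open>L\<^sup>2\<close>, with a limit measurable for the same sub-\<open>\<sigma>\<close>-algebra: the geometric rate
  makes the increments absolutely summable almost everywhere, and Fatou's lemma gives the rate of
  the limit.\<close>

lemma sqint_geometric_Cauchy_limit:
  assumes sub: "subalgebra M G"
    and XG: "\<And>n. X n \<in> borel_measurable G"
    and XL: "\<And>n. sqint M (X n)"
    and C: "\<And>m n. n \<le> m \<Longrightarrow> msq M (\<lambda>\<omega>. X m \<omega> - X n \<omega>) \<le> C / 4 ^ n"
  shows "\<exists>Z. Z \<in> borel_measurable G \<and> sqint M Z \<and> (\<forall>n. msq M (\<lambda>\<omega>. Z \<omega> - X n \<omega>) \<le> C / 4 ^ n)"
proof -
  \<comment> \<open>\<open>lim\<close> is total, with an arbitrary value where the sequence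
    diverges. This keeps measurability for \<open>G\<close> without adding null sets to
    \<open>G\<close>, and only almost every point matters for the estimates.\<close>
  define Z where "Z \<omega> = lim (\<lambda>n. X n \<omega>)" for \<omega>
  have [measurable]: "X n \<in> borel_measurable M" for n using XL by (simp add: sqint_def)
  have C0: "0 \<le> C" using order_trans[OF msq_nonneg C[of 0 0]] by simp
  have ZG: "Z \<in> borel_measurable G"
    unfolding Z_def using XG by (rule borel_measurable_lim_metric)
  then have [measurable]: "Z \<in> borel_measurable M" using sub by (rule measurable_from_subalg[rotated])
  have D: "(\<integral>\<^sup>+\<omega>. ennreal \<bar>X (Suc n) \<omega> - X n \<omega>\<bar> \<partial>M) \<le> ennreal ((C + 1) / 2 ^ n)" for n
  proof -
    let ?D = "\<lambda>\<omega>. X (Suc n) \<omega> - X n \<omega>"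
    have L: "sqint M ?D" by (intro sqint_diff XL)
    \<comment> \<open>Young's inequality with weight \<open>2 ^ n\<close>: as the mean square of the
      increment is at most \<open>C / 4 ^ n\<close>, both terms are of order
      \<open>1 / 2 ^ n\<close>.\<close>
    have "\<bar>?D \<omega>\<bar> \<le> 2 ^ n * (?D \<omega>)\<^sup>2 + 1 / 2 ^ n" for \<omega>
    proof -
      let ?d = "\<bar>?D \<omega>\<bar>"
      have "0 \<le> (2 ^ n * ?d - 1)\<^sup>2" by simp
      then have "2 * (2 ^ n * ?d) \<le> 2 ^ n * (2 ^ n * ?d\<^sup>2) + 1"
        by (simp add: power2_diff power_mult_distrib power2_eq_square algebra_simps)
      moreover have "0 \<le> (2::real) ^ n * ?d" by simp
      ultimately have "2 ^ n * ?d \<le> 2 ^ n * (2 ^ n * ?d\<^sup>2) + 1" by linarith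
      also have "\<dots> = 2 ^ n * (2 ^ n * ?d\<^sup>2 + 1 / 2 ^ n)" by (simp add: distrib_left)
      finally show ?thesis by (simp del: power_abs)
    qed
    then have "expectation (\<lambda>\<omega>. \<bar>?D \<omega>\<bar>) \<le> expectation (\<lambda>\<omega>. 2 ^ n * (?D \<omega>)\<^sup>2 + 1 / 2 ^ n)"
      using L sqint_integrable[OF L] by (intro integral_mono) (auto simp: sqint_def)
    also have "\<dots> = 2 ^ n * msq M ?D + 1 / 2 ^ n"
      using L by (simp add: sqint_def msq_def prob_space)
    also have "\<dots> \<le> 2 ^ n * (C / 4 ^ n) + 1 / 2 ^ n"
      using C[of n "Suc n"] by (intro add_right_mono mult_left_mono) auto
    also have "\<dots> = (C + 1) / 2 ^ n"
    proof -
      have "(4::real) ^ n = 2 ^ n * 2 ^ n" by (simp flip: power_mult_distrib)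
      then show ?thesis by (simp add: add_divide_distrib)
    qed
    finally show ?thesis
      using sqint_integrable[OF L] by (subst nn_integral_eq_integral) (auto simp: ennreal_leI)
  qed
  have "(\<integral>\<^sup>+\<omega>. (\<Sum>n. ennreal \<bar>X (Suc n) \<omega> - X n \<omega>\<bar>) \<partial>M) = (\<Sum>n. \<integral>\<^sup>+\<omega>. ennreal \<bar>X (Suc n) \<omega> - X n \<omega>\<bar> \<partial>M)"
    by (rule nn_integral_suminf) measurable
  also have "\<dots> \<le> (\<Sum>n. ennreal ((C + 1) / 2 ^ n))"
    by (intro suminf_le D) auto
  also have "\<dots> = ennreal (\<Sum>n. (C + 1) / 2 ^ n)"
  proof (rule suminf_ennreal2)
    show "summable (\<lambda>n. (C + 1) / 2 ^ n)"
      using summable_mult[OF summable_geometric[of "1/2::real"], of "C + 1"]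
      by (simp add: power_divide)
  qed (use C0 in auto)
  finally have fin: "(\<integral>\<^sup>+\<omega>. (\<Sum>n. ennreal \<bar>X (Suc n) \<omega> - X n \<omega>\<bar>) \<partial>M) \<noteq> \<infinity>"
    by (auto simp: top_unique)
  have "AE \<omega> in M. (\<Sum>n. ennreal \<bar>X (Suc n) \<omega> - X n \<omega>\<bar>) \<noteq> \<infinity>"
    using fin by (intro nn_integral_PInf_AE) auto
  then have lim: "AE \<omega> in M. (\<lambda>n. X n \<omega>) \<longlonglongrightarrow> Z \<omega>"
  proof eventually_elim
    case (elim \<omega>)
    then have "summable (\<lambda>n. \<bar>X (Suc n) \<omega> - X n \<omega>\<bar>)"
      by (intro summable_suminf_not_top) auto
    then have "summable (\<lambda>n. X (Suc n) \<omega> - X n \<omega>)"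
      by (rule summable_rabs_cancel)
    then have "convergent (\<lambda>n. X n \<omega>)"
      unfolding summable_iff_convergent sum_lessThan_telescope[of "\<lambda>n. X n \<omega>"] convergent_diff_const_right_iff .
    then show ?case by (simp add: Z_def convergent_LIMSEQ_iff)
  qed
  have F: "(\<integral>\<^sup>+\<omega>. ennreal ((Z \<omega> - X n \<omega>)\<^sup>2) \<partial>M) \<le> ennreal (C / 4 ^ n)" for n
  proof -
    have "(\<integral>\<^sup>+\<omega>. ennreal ((Z \<omega> - X n \<omega>)\<^sup>2) \<partial>M)
        = (\<integral>\<^sup>+\<omega>. liminf (\<lambda>m. ennreal ((X m \<omega> - X n \<omega>)\<^sup>2)) \<partial>M)"
    proof (rule nn_integral_cong_AE, use lim in eventually_elim)
      case (elim \<omega>)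
      then have "(\<lambda>m. ennreal ((X m \<omega> - X n \<omega>)\<^sup>2)) \<longlonglongrightarrow> ennreal ((Z \<omega> - X n \<omega>)\<^sup>2)"
        by (intro tendsto_intros) auto
      then have "liminf (\<lambda>m. ennreal ((X m \<omega> - X n \<omega>)\<^sup>2)) = ennreal ((Z \<omega> - X n \<omega>)\<^sup>2)"
        by (rule lim_imp_Liminf[OF sequentially_bot])
      then show ?case by (rule sym)
    qed
    also have "\<dots> \<le> liminf (\<lambda>m. \<integral>\<^sup>+\<omega>. ennreal ((X m \<omega> - X n \<omega>)\<^sup>2) \<partial>M)"
      by (rule nn_integral_liminf) measurable
    also have "\<dots> \<le> ennreal (C / 4 ^ n)"
    proof (rule Liminf_le[OF sequentially_bot])
      show "\<forall>\<^sub>F m in sequentially. (\<integral>\<^sup>+\<omega>. ennreal ((X m \<omega> - X n \<omega>)\<^sup>2) \<partial>M) \<le> ennreal (C / 4 ^ n)"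
        using eventually_ge_at_top[of n]
      proof eventually_elim
        case (elim m)
        then show ?case
          using C[OF elim] sqint_diff[OF XL[of m] XL[of n]]
          by (subst nn_integral_eq_integral) (auto simp: sqint_def msq_def ennreal_leI)
      qed
    qed
    finally show ?thesis .
  qed
  have ZX: "sqint M (\<lambda>\<omega>. Z \<omega> - X n \<omega>)" for n
    unfolding sqint_def using F[of n]
    by (auto intro!: integrableI_nonneg simp: less_top[symmetric] top_unique)
  have ZL: "sqint M Z" using sqint_add[OF ZX[of 0] XL[of 0]] by simp
  have "msq M (\<lambda>\<omega>. Z \<omega> - X n \<omega>) \<le> C / 4 ^ n" for n
    using F[of n] ZX[of n] C0
    by (subst (asm) nn_integral_eq_integral) (auto simp: sqint_def msq_def ennreal_le_iff)
  then show ?thesis using ZG ZL by blast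
qed

text \<open>Young's inequality with a free parameter, to be tuned when the two factors have
  different orders: mean squares of order \<open>h\<^sup>2\<close> and \<open>h\<close> are balanced
  by taking the square root of \<open>h\<close> for \<open>e\<close>.\<close>

lemma expectation_abs_mult_le:
  assumes A: "sqint M A" and B: "sqint M B" and e: "0 < e"
  shows "expectation (\<lambda>\<omega>. \<bar>A \<omega> * B \<omega>\<bar>) \<le> msq M A / e + e * msq M B"
proof -
  have pw: "\<bar>x * y\<bar> \<le> x\<^sup>2 / e + e * y\<^sup>2" for x y
  proof -
    have "0 \<le> (\<bar>x\<bar> - e * \<bar>y\<bar>)\<^sup>2" by simp
    then have "2 * (e * \<bar>x * y\<bar>) \<le> x\<^sup>2 + e\<^sup>2 * y\<^sup>2"
      by (simp add: power2_diff power_mult_distrib abs_mult algebra_simps)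
    moreover have "0 \<le> e * \<bar>x * y\<bar>" using e by simp
    ultimately have "e * \<bar>x * y\<bar> \<le> x\<^sup>2 + e\<^sup>2 * y\<^sup>2" by linarith
    also have "\<dots> = e * (x\<^sup>2 / e + e * y\<^sup>2)" using e by (simp add: power2_eq_square algebra_simps)
    finally show ?thesis using e by simp
  qed
  have "expectation (\<lambda>\<omega>. \<bar>A \<omega> * B \<omega>\<bar>) \<le> expectation (\<lambda>\<omega>. (A \<omega>)\<^sup>2 / e + e * (B \<omega>)\<^sup>2)"
    using A B pw sqint_integrable_mult[OF A B] by (intro integral_mono) (auto simp: sqint_def)
  also have "\<dots> = msq M A / e + e * msq M B" using A B by (simp add: sqint_def msq_def)
  finally show ?thesis .
qed

lemma conv_in_prob_L1:
  assumes i: "\<And>N. integrable M (\<lambda>\<omega>. X N \<omega> - Y \<omega>)"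
    and l: "(\<lambda>N. expectation (\<lambda>\<omega>. \<bar>X N \<omega> - Y \<omega>\<bar>)) \<longlonglongrightarrow> 0"
  shows "conv_in_prob M X Y"
  unfolding conv_in_prob_def
proof (intro allI impI)
  fix e :: real assume e: "0 < e"
  show "(\<lambda>N. prob {\<omega> \<in> space M. e < \<bar>X N \<omega> - Y \<omega>\<bar>}) \<longlonglongrightarrow> 0"
  proof (rule tendsto_sandwich[OF _ _ tendsto_const])
    show "(\<lambda>N. expectation (\<lambda>\<omega>. \<bar>X N \<omega> - Y \<omega>\<bar>) / e) \<longlonglongrightarrow> 0"
      using tendsto_divide[OF l tendsto_const[of e]] e by simp
    have "prob {\<omega> \<in> space M. e < \<bar>X N \<omega> - Y \<omega>\<bar>} \<le> expectation (\<lambda>\<omega>. \<bar>X N \<omega> - Y \<omega>\<bar>) / e" for N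
    proof -
      have [measurable]: "(\<lambda>\<omega>. X N \<omega> - Y \<omega>) \<in> borel_measurable M"
        using i[of N] by (rule borel_measurable_integrable)
      have "prob {\<omega> \<in> space M. e < \<bar>X N \<omega> - Y \<omega>\<bar>} \<le> prob {\<omega> \<in> space M. e \<le> \<bar>X N \<omega> - Y \<omega>\<bar>}"
        by (rule finite_measure_mono) auto
      also have "\<dots> \<le> expectation (\<lambda>\<omega>. \<bar>X N \<omega> - Y \<omega>\<bar>) / e"
        using i[of N] e by (intro integral_Markov_inequality_measure[where A="{}"]) auto
      finally show ?thesis .
    qed
    then show "\<forall>\<^sub>F N in sequentially. prob {\<omega> \<in> space M. e < \<bar>X N \<omega> - Y \<omega>\<bar>} \<le> expectation (\<lambda>\<omega>. \<bar>X N \<omega> - Y \<omega>\<bar>) / e"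
      by simp
  qed simp
qed

lemma conv_in_prob_L2:
  assumes X: "\<And>N. sqint M (X N)" and Y: "sqint M Y"
    and l: "(\<lambda>N. msq M (\<lambda>\<omega>. X N \<omega> - Y \<omega>)) \<longlonglongrightarrow> 0"
  shows "conv_in_prob M X Y"
proof (rule conv_in_prob_L1)
  have L: "sqint M (\<lambda>\<omega>. X N \<omega> - Y \<omega>)" for N by (intro sqint_diff X Y)
  then show "integrable M (\<lambda>\<omega>. X N \<omega> - Y \<omega>)" for N by (rule sqint_integrable)
  have le: "expectation (\<lambda>\<omega>. \<bar>X N \<omega> - Y \<omega>\<bar>) \<le> sqrt (msq M (\<lambda>\<omega>. X N \<omega> - Y \<omega>))" for N
  proof (rule real_le_rsqrt)
    have "sqint M (\<lambda>\<omega>. \<bar>X N \<omega> - Y \<omega>\<bar>)" using L[of N] by (auto simp: sqint_def)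
    from expectation_sq_le_msq[OF this]
    show "(expectation (\<lambda>\<omega>. \<bar>X N \<omega> - Y \<omega>\<bar>))\<^sup>2 \<le> msq M (\<lambda>\<omega>. X N \<omega> - Y \<omega>)" by (simp add: msq_def)
  qed
  have lim: "(\<lambda>N. sqrt (msq M (\<lambda>\<omega>. X N \<omega> - Y \<omega>))) \<longlonglongrightarrow> 0"
    using tendsto_real_sqrt[OF l] by simp
  show "(\<lambda>N. expectation (\<lambda>\<omega>. \<bar>X N \<omega> - Y \<omega>\<bar>)) \<longlonglongrightarrow> 0"
    by (rule tendsto_sandwich[OF _ _ tendsto_const lim]) (simp_all add: le)
qed

lemma conv_in_prob_add:
  assumes [measurable]: "\<And>N. X N \<in> borel_measurable M" "\<And>N. X' N \<in> borel_measurable M"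
    "Y \<in> borel_measurable M" "Y' \<in> borel_measurable M"
    and c: "conv_in_prob M X Y" "conv_in_prob M X' Y'"
  shows "conv_in_prob M (\<lambda>N \<omega>. X N \<omega> + X' N \<omega>) (\<lambda>\<omega>. Y \<omega> + Y' \<omega>)"
  unfolding conv_in_prob_def
proof (intro allI impI)
  fix e :: real assume e: "0 < e"
  let ?A = "\<lambda>N. {\<omega> \<in> space M. e / 2 < \<bar>X N \<omega> - Y \<omega>\<bar>}" and ?B = "\<lambda>N. {\<omega> \<in> space M. e / 2 < \<bar>X' N \<omega> - Y' \<omega>\<bar>}"
  show "(\<lambda>N. prob {\<omega> \<in> space M. e < \<bar>X N \<omega> + X' N \<omega> - (Y \<omega> + Y' \<omega>)\<bar>}) \<longlonglongrightarrow> 0"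
  proof (rule tendsto_sandwich[OF _ _ tendsto_const])
    have "(\<lambda>N. prob (?A N)) \<longlonglongrightarrow> 0" "(\<lambda>N. prob (?B N)) \<longlonglongrightarrow> 0"
      using c e half_gt_zero[OF e] unfolding conv_in_prob_def by blast+
    from tendsto_add[OF this] show "(\<lambda>N. prob (?A N) + prob (?B N)) \<longlonglongrightarrow> 0" by simp
    have "prob {\<omega> \<in> space M. e < \<bar>X N \<omega> + X' N \<omega> - (Y \<omega> + Y' \<omega>)\<bar>} \<le> prob (?A N) + prob (?B N)" for N
    proof -
      have "prob {\<omega> \<in> space M. e < \<bar>X N \<omega> + X' N \<omega> - (Y \<omega> + Y' \<omega>)\<bar>} \<le> prob (?A N \<union> ?B N)"
        by (rule finite_measure_mono) (auto, smt (verit))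
      also have "\<dots> \<le> prob (?A N) + prob (?B N)"
        by (rule measure_Un_le) auto
      finally show ?thesis .
    qed
    then show "\<forall>\<^sub>F N in sequentially. prob {\<omega> \<in> space M. e < \<bar>X N \<omega> + X' N \<omega> - (Y \<omega> + Y' \<omega>)\<bar>} \<le> prob (?A N) + prob (?B N)"
      by simp
  qed simp
qed

lemma conv_in_prob_cmult:
  assumes c: "conv_in_prob M X Y"
  shows "conv_in_prob M (\<lambda>N \<omega>. a * X N \<omega>) (\<lambda>\<omega>. a * Y \<omega>)"
  unfolding conv_in_prob_def
proof (intro allI impI)
  fix e :: real assume e: "0 < e"
  show "(\<lambda>N. prob {\<omega> \<in> space M. e < \<bar>a * X N \<omega> - a * Y \<omega>\<bar>}) \<longlonglongrightarrow> 0"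
  proof (cases "a = 0")
    case True
    then show ?thesis using e by simp
  next
    case False
    then have "e < \<bar>a * x - a * y\<bar> \<longleftrightarrow> e / \<bar>a\<bar> < \<bar>x - y\<bar>" for x y
      by (simp add: divide_less_eq abs_mult[symmetric] algebra_simps)
    moreover have "0 < e / \<bar>a\<bar>" using e False by simp
    ultimately show ?thesis using c unfolding conv_in_prob_def by simp
  qed
qed

text \<open>The exceptional null set may depend on \<open>N\<close>, since each \<open>N\<close>
  contributes one probability of its own.\<close>

lemma conv_in_prob_cong_AE:
  assumes [measurable]: "\<And>N. X N \<in> borel_measurable M" "\<And>N. X' N \<in> borel_measurable M"
    "Y \<in> borel_measurable M"
    and ae: "\<And>N. AE \<omega> in M. X N \<omega> = X' N \<omega>"
  shows "conv_in_prob M X Y \<longleftrightarrow> conv_in_prob M X' Y"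
proof -
  have "prob {\<omega> \<in> space M. e < \<bar>X N \<omega> - Y \<omega>\<bar>} = prob {\<omega> \<in> space M. e < \<bar>X' N \<omega> - Y \<omega>\<bar>}" for e N
    using ae[of N] by (intro finite_measure_eq_AE) auto
  then show ?thesis by (simp add: conv_in_prob_def)
qed

text \<open>A gap above \<open>e\<close> between two limits forces one of them to be more than
  \<open>e / 2\<close> away from \<open>X N\<close>, so the gap has probability zero for each
  \<open>e\<close>; the countably many values 1 / (n + 1) give equality almost everywhere.\<close>

lemma conv_in_prob_unique:
  assumes [measurable]: "\<And>N. X N \<in> borel_measurable M" "Y \<in> borel_measurable M" "Z \<in> borel_measurable M"
    and c: "conv_in_prob M X Y" "conv_in_prob M X Z"
  shows "AE \<omega> in M. Y \<omega> = Z \<omega>"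
proof -
  have z: "prob {\<omega> \<in> space M. e < \<bar>Y \<omega> - Z \<omega>\<bar>} = 0" if e: "0 < e" for e :: real
  proof -
    let ?A = "\<lambda>N. {\<omega> \<in> space M. e / 2 < \<bar>X N \<omega> - Y \<omega>\<bar>}" and ?B = "\<lambda>N. {\<omega> \<in> space M. e / 2 < \<bar>X N \<omega> - Z \<omega>\<bar>}"
    have "(\<lambda>N. prob (?A N)) \<longlonglongrightarrow> 0" "(\<lambda>N. prob (?B N)) \<longlonglongrightarrow> 0"
      using c half_gt_zero[OF e] unfolding conv_in_prob_def by blast+
    from tendsto_add[OF this] have l: "(\<lambda>N. prob (?A N) + prob (?B N)) \<longlonglongrightarrow> 0" by simp
    have "prob {\<omega> \<in> space M. e < \<bar>Y \<omega> - Z \<omega>\<bar>} \<le> prob (?A N) + prob (?B N)" for N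
    proof -
      have "prob {\<omega> \<in> space M. e < \<bar>Y \<omega> - Z \<omega>\<bar>} \<le> prob (?A N \<union> ?B N)"
        by (rule finite_measure_mono) (auto, smt (verit))
      also have "\<dots> \<le> prob (?A N) + prob (?B N)"
        by (rule measure_Un_le) auto
      finally show ?thesis .
    qed
    then have "prob {\<omega> \<in> space M. e < \<bar>Y \<omega> - Z \<omega>\<bar>} \<le> 0"
      by (intro LIMSEQ_le_const[OF l]) auto
    then show ?thesis by (simp add: measure_le_0_iff)
  qed
  have "AE \<omega> in M. \<forall>n::nat. \<not> 1 / real (Suc n) < \<bar>Y \<omega> - Z \<omega>\<bar>"
    unfolding AE_all_countable
  proof
    fix n :: nat
    have "{\<omega> \<in> space M. 1 / real (Suc n) < \<bar>Y \<omega> - Z \<omega>\<bar>} \<in> null_sets M"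
      using z[of "1 / real (Suc n)"] by (intro null_setsI) (auto simp: emeasure_eq_measure)
    from AE_not_in[OF this] show "AE \<omega> in M. \<not> 1 / real (Suc n) < \<bar>Y \<omega> - Z \<omega>\<bar>"
      by (rule AE_mp) (auto intro!: AE_I2)
  qed
  then show ?thesis
  proof eventually_elim
    case (elim \<omega>)
    show ?case
    proof (rule ccontr)
      assume "Y \<omega> \<noteq> Z \<omega>"
      then obtain n where "inverse (real (Suc n)) < \<bar>Y \<omega> - Z \<omega>\<bar>"
        using reals_Archimedean[of "\<bar>Y \<omega> - Z \<omega>\<bar>"] by auto
      then show False using elim by (simp add: inverse_eq_divide)
    qed
  qed
qed

text \<open>Nothing is known about a \<open>SOME\<close> value until a witness exists. Once some
  limit \<open>Z\<close> is exhibited, uniqueness forces the chosen one to agree with it almost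
  everywhere; this is the only access to the iterated integrals.\<close>

lemma conv_in_prob_SOME:
  assumes X: "\<And>N. X N \<in> borel_measurable M" and Z: "Z \<in> borel_measurable M" and c: "conv_in_prob M X Z"
  shows "(SOME Y. Y \<in> borel_measurable M \<and> conv_in_prob M X Y) \<in> borel_measurable M"
    and "AE \<omega> in M. (SOME Y. Y \<in> borel_measurable M \<and> conv_in_prob M X Y) \<omega> = Z \<omega>"
proof -
  let ?Y = "SOME Y. Y \<in> borel_measurable M \<and> conv_in_prob M X Y"
  have Y: "?Y \<in> borel_measurable M \<and> conv_in_prob M X ?Y"
    by (rule someI[of _ Z]) (use Z c in simp)
  then show "?Y \<in> borel_measurable M" by simp
  show "AE \<omega> in M. ?Y \<omega> = Z \<omega>"
    using Y Z c X by (intro conv_in_prob_unique[of X]) auto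
qed

end

section \<open>Independence of the past and future increments\<close>

text \<open>Independence of increments is postulated along strictly increasing sequences. The
  observation times of a past event are therefore lined up with \<open>0\<close>, \<open>a\<close>
  and \<open>b\<close> so that exactly the last step is the future increment.\<close>

lemma finite_set_enumeration:
  fixes T :: "real set"
  assumes T: "finite T" "0 \<in> T" "a \<in> T" "T \<subseteq> {0..a}" and ab: "a < b"
  obtains s p where "s 0 = 0" "s p = a" "s (Suc p) = b" "\<And>k. k < Suc p \<Longrightarrow> s k < s (Suc k)"
    "T \<subseteq> s ` {..p}"
proof -
  define xs where "xs = sorted_list_of_set T"
  define p where "p = card T - 1"
  \<comment> \<open>Indices beyond the list take the value \<open>b\<close>; since \<open>a\<close>
    is the last entry, at position \<open>p\<close>, the next index gives the future time.\<close>
  define s where "s k = (if k < card T then xs ! k else b)" for k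
  have len: "length xs = card T" and set: "set xs = T" and srt: "sorted_wrt (<) xs"
    using T(1) by (auto simp: xs_def)
  have pos: "0 < card T" using T by (auto simp: card_gt_0_iff)
  then have Sp: "Suc p = card T" by (simp add: p_def)
  have lt: "xs ! k < xs ! l" if "k < l" "l < card T" for k l
    using sorted_wrt_nth_less[OF srt that(1)] that len by simp
  have memT: "xs ! k \<in> T" if "k < card T" for k using that len set nth_mem by metis
  have "s 0 = 0"
  proof -
    obtain k where k: "k < card T" "xs ! k = 0" using T(2) set len by (metis in_set_conv_nth)
    have "k = 0"
    proof (rule ccontr)
      assume "k \<noteq> 0"
      then have "xs ! 0 < 0" using lt[of 0 k] k by simp
      moreover have "0 \<le> xs ! 0" using memT[OF pos] T(4) by auto
      ultimately show False by simp
    qed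
    then show ?thesis using k pos by (simp add: s_def)
  qed
  moreover have sp: "s p = a"
  proof -
    obtain k where k: "k < card T" "xs ! k = a" using T(3) set len by (metis in_set_conv_nth)
    have "k = p"
    proof (rule ccontr)
      assume "k \<noteq> p"
      then have "a < xs ! p" using lt[of k p] k Sp by simp
      moreover have "xs ! p \<le> a" using memT[of p] Sp T(4) by auto
      ultimately show False by simp
    qed
    then show ?thesis using k by (simp add: s_def)
  qed
  moreover have "s (Suc p) = b" by (simp add: s_def Sp)
  moreover have "s k < s (Suc k)" if "k < Suc p" for k
  proof (cases "k = p")
    case True
    then show ?thesis using sp \<open>s (Suc p) = b\<close> ab by simp
  next
    case False
    then show ?thesis using that lt[of k "Suc k"] Sp by (simp add: s_def)
  qed
  moreover have "T \<subseteq> s ` {..p}"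
  proof
    fix x assume "x \<in> T"
    then obtain k where "k < card T" "xs ! k = x" using set len by (metis in_set_conv_nth)
    then show "x \<in> s ` {..p}" using Sp by (intro image_eqI[of _ _ k]) (auto simp: s_def)
  qed
  ultimately show ?thesis using that by blast
qed

section \<open>The drivers and the natural filtration of the noise\<close>

locale wiener = prob_space M for M :: "'a measure" +
  fixes n :: nat and W :: "nat \<Rightarrow> real \<Rightarrow> 'a \<Rightarrow> real"
  assumes wiener_W: "wiener_setup M n W"
begin

lemma W_time: "W 0 t \<omega> = t"
  using wiener_W by (simp add: wiener_setup_def)

lemma W_measurable [measurable]: "j < n \<Longrightarrow> W j t \<in> borel_measurable M"
proof (cases "j = 0")
  case True
  then have "W j t = (\<lambda>_. t)" by (auto simp: W_time)
  then show ?thesis by simp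
next
  case False
  moreover assume "j < n"
  ultimately show ?thesis using wiener_W by (simp add: wiener_setup_def)
qed

lemma W_start: "j \<in> {1..<n} \<Longrightarrow> \<omega> \<in> space M \<Longrightarrow> W j 0 \<omega> = 0"
  using wiener_W by (simp add: wiener_setup_def)

lemma W_increments_indep:
  assumes "0 \<le> s 0" "\<And>k. k < m \<Longrightarrow> s k < s (Suc k)"
  shows "indep_vars (\<lambda>_. borel) (\<lambda>(j,k) \<omega>. W j (s (Suc k)) \<omega> - W j (s k) \<omega>) ({1..<n} \<times> {..<m})"
  using wiener_W assms by (auto simp: wiener_setup_def)

lemma W_increment_distributed:
  assumes "j \<in> {1..<n}" "0 \<le> a" "a < b"
  shows "distributed M lborel (\<lambda>\<omega>. W j b \<omega> - W j a \<omega>) (normal_density 0 (sqrt (b - a)))"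
proof -
  define s where "s k = a + real k * (b - a)" for k
  have *: "0 \<le> s 0 \<and> (\<forall>k<1. s k < s (Suc k))"
    using assms by (simp add: s_def)
  have "distributed M lborel (\<lambda>\<omega>. W j (s (Suc 0)) \<omega> - W j (s 0) \<omega>) (normal_density 0 (sqrt (s (Suc 0) - s 0)))"
    using wiener_W assms(1) * unfolding wiener_setup_def by blast
  then show ?thesis by (simp add: s_def)
qed

text \<open>Events about finitely many values of the noise up to time \<open>a\<close>. They form a
  generating system closed under intersection, as the extension of independence to the whole past
  requires. The time driver is left out because it is deterministic.\<close>

definition cylinders :: "real \<Rightarrow> 'a set set" where
  "cylinders a = {{\<omega> \<in> space M. \<forall>x\<in>I. W (fst x) (snd x) \<omega> \<in> A x} | I A.
     finite I \<and> I \<subseteq> {1..<n} \<times> {0..a} \<and> (\<forall>x. A x \<in> sets borel)}"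

definition past :: "real \<Rightarrow> 'a measure" where
  "past a = sigma (space M) (cylinders a)"

lemma cylinders_Pow: "cylinders a \<subseteq> Pow (space M)"
  by (auto simp: cylinders_def)

lemma cylinders_events: "cylinders a \<subseteq> events"
proof
  fix E assume "E \<in> cylinders a"
  then obtain I A where E: "E = {\<omega> \<in> space M. \<forall>x\<in>I. W (fst x) (snd x) \<omega> \<in> A x}"
    and I: "finite I" "I \<subseteq> {1..<n} \<times> {0..a}" and A: "\<forall>x. A x \<in> sets borel"
    unfolding cylinders_def by blast
  have "{\<omega> \<in> space M. W (fst x) (snd x) \<omega> \<in> A x} \<in> events" if "x \<in> I" for x
  proof -
    have "fst x < n" using that I by auto
    then have [measurable]: "W (fst x) (snd x) \<in> borel_measurable M" by simp
    have [measurable]: "A x \<in> sets borel" using A by blast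
    show ?thesis by measurable
  qed
  then show "E \<in> events" unfolding E using I(1) by (intro sets.sets_Collect_finite_All)
qed

lemma space_past [simp]: "space (past a) = space M"
  by (simp add: past_def cylinders_Pow)

lemma sets_past: "sets (past a) = sigma_sets (space M) (cylinders a)"
  by (simp add: past_def cylinders_Pow)

lemma subalgebra_past: "subalgebra M (past a)"
  unfolding subalgebra_def sets_past using cylinders_events[of a] sets.sigma_sets_subset by auto

lemma past_mono:
  assumes "a \<le> b" shows "subalgebra (past b) (past a)"
proof -
  have "cylinders a \<subseteq> cylinders b"
  proof
    fix E assume "E \<in> cylinders a"
    then obtain I A where *: "E = {\<omega> \<in> space M. \<forall>x\<in>I. W (fst x) (snd x) \<omega> \<in> A x}"
      "finite I" "I \<subseteq> {1..<n} \<times> {0..a}" "\<forall>x. A x \<in> sets borel"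
      unfolding cylinders_def by blast
    have "I \<subseteq> {1..<n} \<times> {0..b}" using *(3) assms by auto
    then show "E \<in> cylinders b" using * unfolding cylinders_def by blast
  qed
  then show ?thesis
    unfolding subalgebra_def sets_past by (simp add: sigma_sets_mono')
qed

lemma past_measurable_mono:
  "a \<le> b \<Longrightarrow> X \<in> borel_measurable (past a) \<Longrightarrow> X \<in> borel_measurable (past b)"
  using past_mono by (rule measurable_from_subalg)

lemma past_measurable: "X \<in> borel_measurable (past a) \<Longrightarrow> X \<in> borel_measurable M"
  using subalgebra_past by (rule measurable_from_subalg)

lemma W_past_measurable:
  assumes "j < n" "0 \<le> s" "s \<le> a"
  shows "W j s \<in> borel_measurable (past a)"
proof (cases "j = 0")
  case True
  then have "W j s = (\<lambda>_. s)" by (auto simp: W_time)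
  then show ?thesis by simp
next
  case False
  show ?thesis
  proof (rule measurableI)
    fix A :: "real set" assume A: "A \<in> sets borel"
    have "W j s -` A \<inter> space M = {\<omega> \<in> space M. \<forall>x\<in>{(j, s)}. W (fst x) (snd x) \<omega> \<in> (\<lambda>_. A) x}"
      by auto
    also have "\<dots> \<in> cylinders a"
      unfolding cylinders_def mem_Collect_eq
      by (intro exI[of _ "{(j, s)}"] exI[of _ "\<lambda>_. A"] conjI refl) (use assms False A in auto)
    finally show "W j s -` A \<inter> space (past a) \<in> sets (past a)"
      by (auto simp: sets_past)
  qed simp
qed

lemma Int_stable_cylinders: "Int_stable (cylinders a)"
proof (rule Int_stableI)
  fix E F assume "E \<in> cylinders a" "F \<in> cylinders a"
  then obtain I A J B where E: "E = {\<omega> \<in> space M. \<forall>x\<in>I. W (fst x) (snd x) \<omega> \<in> A x}"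
    "finite I" "I \<subseteq> {1..<n} \<times> {0..a}" "\<forall>x. A x \<in> sets borel"
    and F: "F = {\<omega> \<in> space M. \<forall>x\<in>J. W (fst x) (snd x) \<omega> \<in> B x}"
    "finite J" "J \<subseteq> {1..<n} \<times> {0..a}" "\<forall>x. B x \<in> sets borel"
    unfolding cylinders_def by blast
  define C where "C x = (if x \<in> I then A x else UNIV) \<inter> (if x \<in> J then B x else UNIV)" for x
  have "E \<inter> F = {\<omega> \<in> space M. \<forall>x\<in>I \<union> J. W (fst x) (snd x) \<omega> \<in> C x}"
    unfolding E(1) F(1) C_def by auto
  moreover have "finite (I \<union> J)" "I \<union> J \<subseteq> {1..<n} \<times> {0..a}" "\<forall>x. C x \<in> sets borel"
    using E F by (auto simp: C_def)
  ultimately show "E \<inter> F \<in> cylinders a" unfolding cylinders_def by blast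
qed

text \<open>All noise increments are kept as one random vector: covariations involve two drivers at
  once, so they have to be jointly independent of the past.\<close>

definition increment :: "real \<Rightarrow> real \<Rightarrow> 'a \<Rightarrow> nat \<Rightarrow> real" where
  "increment a b \<omega> = (\<lambda>j\<in>{1..<n}. W j b \<omega> - W j a \<omega>)"

lemma increment_measurable [measurable]:
  "increment a b \<in> measurable M (PiM {1..<n} (\<lambda>_. borel))"
  unfolding increment_def by (rule measurable_restrict) auto

text \<open>Since the noise starts at 0, its value at a grid time is the sum of the increments
  before it. Hence \<open>E\<close> is an event about the increments with index below
  \<open>p\<close>, while the increment over [\<open>a\<close>, \<open>b\<close>] has index
  \<open>p\<close>; disjoint blocks of an independent family are independent.\<close>

lemma indep_cylinder_increment:
  assumes ab: "0 \<le> a" "a < b" and E: "E \<in> cylinders a" and B: "B \<in> sets (PiM {1..<n} (\<lambda>_. borel))"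
  shows "prob (E \<inter> (increment a b -` B \<inter> space M)) = prob E * prob (increment a b -` B \<inter> space M)"
proof -
  obtain I A where E_eq: "E = {\<omega> \<in> space M. \<forall>x\<in>I. W (fst x) (snd x) \<omega> \<in> A x}"
    and I: "finite I" "I \<subseteq> {1..<n} \<times> {0..a}" and A: "\<forall>x. A x \<in> sets borel"
    using E unfolding cylinders_def by blast
  define T where "T = insert 0 (insert a (snd ` I))"
  have T: "finite T" "0 \<in> T" "a \<in> T" "T \<subseteq> {0..a}"
    using I ab by (auto simp: T_def)
  obtain s p where s: "s 0 = 0" "s p = a" "s (Suc p) = b" "\<And>k. k < Suc p \<Longrightarrow> s k < s (Suc k)"
    "T \<subseteq> s ` {..p}"
    using finite_set_enumeration[OF T ab(2)] by blast
  have "\<exists>k\<le>p. s k = snd x" if "x \<in> I" for x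
  proof -
    have "snd x \<in> T" using that by (auto simp: T_def)
    then show ?thesis using s(5) by force
  qed
  then obtain \<kappa> where \<kappa>: "\<And>x. x \<in> I \<Longrightarrow> \<kappa> x \<le> p \<and> s (\<kappa> x) = snd x" by metis
  define X where "X = (\<lambda>(j,k) \<omega>. W j (s (Suc k)) \<omega> - W j (s k) \<omega>)"
  define P where "P = {1..<n} \<times> {..<p}"
  define Q where "Q = {1..<n} \<times> {p}"
  have "indep_vars (\<lambda>_. borel) X ({1..<n} \<times> {..<Suc p})"
    unfolding X_def using s by (intro W_increments_indep) auto
  then have ind: "indep_var (PiM P (\<lambda>_. borel)) (\<lambda>\<omega>. restrict (\<lambda>i. X i \<omega>) P)
      (PiM Q (\<lambda>_. borel)) (\<lambda>\<omega>. restrict (\<lambda>i. X i \<omega>) Q)"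
    by (rule indep_var_restrict) (auto simp: P_def Q_def)
  \<comment> \<open>\<open>E\<close> in the coordinates \<open>u\<close> of the grid increments,
    with partial sums in place of values.\<close>
  define EU where "EU = {u \<in> space (PiM P (\<lambda>_. borel :: real measure)). \<forall>x\<in>I. (\<Sum>l<\<kappa> x. u (fst x, l)) \<in> A x}"
  have EU: "EU \<in> sets (PiM P (\<lambda>_. borel))"
    unfolding EU_def
  proof (intro sets.sets_Collect_finite_All I)
    fix x assume x: "x \<in> I"
    have [measurable]: "A x \<in> sets borel" using A by blast
    have [measurable]: "(\<lambda>u. u (fst x, l)) \<in> borel_measurable (PiM P (\<lambda>_. borel))" if "l < \<kappa> x" for l
      using x that \<kappa>[OF x] I by (intro measurable_component_singleton) (auto simp: P_def)
    have "(\<lambda>u. \<Sum>l<\<kappa> x. u (fst x, l)) \<in> borel_measurable (PiM P (\<lambda>_. borel :: real measure))"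
      by (intro borel_measurable_sum) simp
    then show "{u \<in> space (PiM P (\<lambda>_. borel)). (\<Sum>l<\<kappa> x. u (fst x, l)) \<in> A x} \<in> sets (PiM P (\<lambda>_. borel))"
      by measurable
  qed
  define \<phi> :: "(nat \<times> nat \<Rightarrow> real) \<Rightarrow> nat \<Rightarrow> real" where "\<phi> v = (\<lambda>j\<in>{1..<n}. v (j, p))" for v
  have \<phi>: "\<phi> \<in> measurable (PiM Q (\<lambda>_. borel)) (PiM {1..<n} (\<lambda>_. borel))"
    unfolding \<phi>_def
    by (intro measurable_restrict measurable_component_singleton) (auto simp: Q_def)
  define EV where "EV = \<phi> -` B \<inter> space (PiM Q (\<lambda>_. borel))"
  have EV: "EV \<in> sets (PiM Q (\<lambda>_. borel))"
    unfolding EV_def using \<phi> B by (rule measurable_sets)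
  have Wsum: "(\<Sum>l<k. X (j, l) \<omega>) = W j (s k) \<omega>" if "j \<in> {1..<n}" "\<omega> \<in> space M" for j k \<omega>
    using sum_lessThan_telescope[of "\<lambda>l. W j (s l) \<omega>" k] W_start[OF that] s(1) by (simp add: X_def)
  have U: "(\<lambda>\<omega>. restrict (\<lambda>i. X i \<omega>) P) -` EU \<inter> space M = E"
  proof -
    have "(\<Sum>l<\<kappa> x. restrict (\<lambda>i. X i \<omega>) P (fst x, l)) = W (fst x) (snd x) \<omega>"
      if "x \<in> I" "\<omega> \<in> space M" for x \<omega>
    proof -
      have "(\<Sum>l<\<kappa> x. restrict (\<lambda>i. X i \<omega>) P (fst x, l)) = (\<Sum>l<\<kappa> x. X (fst x, l) \<omega>)"
        using \<kappa>[OF that(1)] that I by (intro sum.cong) (auto simp: P_def)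
      also have "\<dots> = W (fst x) (s (\<kappa> x)) \<omega>"
        using that I by (intro Wsum) auto
      finally show ?thesis using \<kappa>[OF that(1)] by simp
    qed
    then show ?thesis by (auto simp: EU_def E_eq space_PiM)
  qed
  have V: "(\<lambda>\<omega>. restrict (\<lambda>i. X i \<omega>) Q) -` EV \<inter> space M = increment a b -` B \<inter> space M"
  proof -
    have "\<phi> (restrict (\<lambda>i. X i \<omega>) Q) = increment a b \<omega>" for \<omega>
      by (auto simp: \<phi>_def Q_def X_def increment_def fun_eq_iff s)
    then show ?thesis by (auto simp: EV_def space_PiM)
  qed
  have "(\<lambda>\<omega>. (restrict (\<lambda>i. X i \<omega>) P, restrict (\<lambda>i. X i \<omega>) Q)) -` (EU \<times> EV) \<inter> space M
      = E \<inter> (increment a b -` B \<inter> space M)"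
    unfolding U[symmetric] V[symmetric] by auto
  then show ?thesis using indep_varD[OF ind EU EV] unfolding U V by simp
qed

text \<open>Both generating systems are closed under intersection, so independence passes to the
  generated sigma-algebras, and these contain the ones of \<open>X\<close> and of \<open>g\<close>
  applied to the increments.\<close>

lemma indep_past_increment:
  fixes X :: "'a \<Rightarrow> real" and g :: "(nat \<Rightarrow> real) \<Rightarrow> real"
  assumes ab: "0 \<le> a" "a < b" and X: "X \<in> borel_measurable (past a)"
    and g: "g \<in> borel_measurable (PiM {1..<n} (\<lambda>_. borel))"
  shows "indep_var borel X borel (\<lambda>\<omega>. g (increment a b \<omega>))"
proof -
  let ?V = "{increment a b -` B \<inter> space M | B. B \<in> sets (PiM {1..<n} (\<lambda>_. borel))}"
  have "indep_set (cylinders a) ?V"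
    using cylinders_events indep_cylinder_increment[OF ab]
    by (intro indep_setI) (auto intro: measurable_sets[OF increment_measurable])
  moreover have "Int_stable ?V"
  proof (rule Int_stableI)
    fix C D assume "C \<in> ?V" "D \<in> ?V"
    then obtain B B' where *: "C = increment a b -` B \<inter> space M" "D = increment a b -` B' \<inter> space M"
      "B \<in> sets (PiM {1..<n} (\<lambda>_. borel))" "B' \<in> sets (PiM {1..<n} (\<lambda>_. borel))" by blast
    then have "C \<inter> D = increment a b -` (B \<inter> B') \<inter> space M" "B \<inter> B' \<in> sets (PiM {1..<n} (\<lambda>_. borel))"
      by auto
    then show "C \<inter> D \<in> ?V" by blast
  qed
  ultimately have ind: "indep_set (sigma_sets (space M) (cylinders a)) (sigma_sets (space M) ?V)"
    by (intro indep_set_sigma_sets Int_stable_cylinders)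
  let ?Y = "\<lambda>\<omega>. g (increment a b \<omega>)"
  have "indep_set (sigma_sets (space M) {X -` A \<inter> space M | A. A \<in> sets borel})
      (sigma_sets (space M) {?Y -` A \<inter> space M | A. A \<in> sets borel})"
    using ind unfolding indep_set_def
  proof (rule indep_sets_mono_sets)
    have 1: "sigma_sets (space M) {X -` A \<inter> space M | A. A \<in> sets borel} \<subseteq> sigma_sets (space M) (cylinders a)"
      using measurable_sets[OF X] by (intro sigma_sets_mono) (auto simp: sets_past)
    have 2: "sigma_sets (space M) {?Y -` A \<inter> space M | A. A \<in> sets borel} \<subseteq> sigma_sets (space M) ?V"
    proof (intro sigma_sets_mono subsetI)
      fix C assume "C \<in> {?Y -` A \<inter> space M | A. A \<in> sets borel}"
      then obtain A where A: "C = ?Y -` A \<inter> space M" "A \<in> sets borel" by blast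
      have "C = increment a b -` (g -` A \<inter> space (PiM {1..<n} (\<lambda>_. borel))) \<inter> space M"
        using measurable_space[OF increment_measurable] by (auto simp: A)
      moreover have "g -` A \<inter> space (PiM {1..<n} (\<lambda>_. borel)) \<in> sets (PiM {1..<n} (\<lambda>_. borel))"
        using g A by (auto intro: measurable_sets)
      ultimately show "C \<in> sigma_sets (space M) ?V" by blast
    qed
    fix i :: bool
    show "case_bool (sigma_sets (space M) {X -` A \<inter> space M | A. A \<in> sets borel})
        (sigma_sets (space M) {?Y -` A \<inter> space M | A. A \<in> sets borel}) i
      \<subseteq> case_bool (sigma_sets (space M) (cylinders a)) (sigma_sets (space M) ?V) i"
      using 1 2 by (cases i) simp_all
  qed
  moreover have "?Y \<in> borel_measurable M"
    using measurable_compose[OF increment_measurable g] .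
  ultimately show ?thesis
    using past_measurable[OF X] by (simp add: indep_var_eq)
qed

text \<open>One statement with a general \<open>G\<close> of two increments serves for increments,
  their squares, centred products and the squares of these. The degenerate interval is separate
  because independence is only given for strictly increasing times.\<close>

lemma expectation_past_times_increment:
  fixes X :: "'a \<Rightarrow> real" and G :: "real \<Rightarrow> real \<Rightarrow> real"
  assumes ab: "0 \<le> a" "a \<le> b" and X: "X \<in> borel_measurable (past a)" "integrable M X"
    and ij: "i \<in> {1..<n}" "j \<in> {1..<n}"
    and G: "case_prod G \<in> borel_measurable (borel \<Otimes>\<^sub>M borel)"
    and Y: "integrable M (\<lambda>\<omega>. G (W i b \<omega> - W i a \<omega>) (W j b \<omega> - W j a \<omega>))"
  shows "integrable M (\<lambda>\<omega>. X \<omega> * G (W i b \<omega> - W i a \<omega>) (W j b \<omega> - W j a \<omega>))"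
    and "expectation (\<lambda>\<omega>. X \<omega> * G (W i b \<omega> - W i a \<omega>) (W j b \<omega> - W j a \<omega>))
       = expectation X * expectation (\<lambda>\<omega>. G (W i b \<omega> - W i a \<omega>) (W j b \<omega> - W j a \<omega>))"
proof -
  let ?Y = "\<lambda>\<omega>. G (W i b \<omega> - W i a \<omega>) (W j b \<omega> - W j a \<omega>)"
  have "integrable M (\<lambda>\<omega>. X \<omega> * ?Y \<omega>) \<and> expectation (\<lambda>\<omega>. X \<omega> * ?Y \<omega>) = expectation X * expectation ?Y"
  proof (cases "a = b")
    case True
    then show ?thesis using X by (simp add: prob_space)
  next
    case False
    then have ab': "a < b" using ab by simp
    define g :: "(nat \<Rightarrow> real) \<Rightarrow> real" where "g v = G (v i) (v j)" for v
    have "(\<lambda>v. (v i, v j)) \<in> measurable (PiM {1..<n} (\<lambda>_. borel)) (borel \<Otimes>\<^sub>M borel)"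
      using ij by (intro measurable_Pair measurable_component_singleton) auto
    from measurable_compose[OF this G]
    have "g \<in> borel_measurable (PiM {1..<n} (\<lambda>_. borel))"
      by (simp add: g_def[abs_def])
    from indep_past_increment[OF ab(1) ab' X(1) this]
    have "indep_var borel X borel ?Y"
      using ij by (simp add: g_def increment_def)
    then show ?thesis using X(2) Y
      by (auto intro: indep_var_integrable indep_var_lebesgue_integral)
  qed
  then show "integrable M (\<lambda>\<omega>. X \<omega> * ?Y \<omega>)" "expectation (\<lambda>\<omega>. X \<omega> * ?Y \<omega>) = expectation X * expectation ?Y"
    by auto
qed

lemma increment_moments:
  assumes j: "j \<in> {1..<n}" and ab: "0 \<le> a" "a \<le> b"
  shows "integrable M (\<lambda>\<omega>. W j b \<omega> - W j a \<omega>)" "expectation (\<lambda>\<omega>. W j b \<omega> - W j a \<omega>) = 0"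
    "integrable M (\<lambda>\<omega>. (W j b \<omega> - W j a \<omega>)\<^sup>2)" "expectation (\<lambda>\<omega>. (W j b \<omega> - W j a \<omega>)\<^sup>2) = b - a"
    "integrable M (\<lambda>\<omega>. (W j b \<omega> - W j a \<omega>) ^ 4)" "expectation (\<lambda>\<omega>. (W j b \<omega> - W j a \<omega>) ^ 4) = 3 * (b - a)\<^sup>2"
proof -
  let ?D = "\<lambda>\<omega>. W j b \<omega> - W j a \<omega>"
  have "(integrable M ?D \<and> expectation ?D = 0) \<and> (integrable M (\<lambda>\<omega>. (?D \<omega>)\<^sup>2) \<and> expectation (\<lambda>\<omega>. (?D \<omega>)\<^sup>2) = b - a)
    \<and> (integrable M (\<lambda>\<omega>. (?D \<omega>) ^ 4) \<and> expectation (\<lambda>\<omega>. (?D \<omega>) ^ 4) = 3 * (b - a)\<^sup>2)"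
  proof (cases "a = b")
    case True
    then show ?thesis by simp
  next
    case False
    then have lt: "a < b" using ab by simp
    define \<sigma> where "\<sigma> = sqrt (b - a)"
    have \<sigma>: "0 < \<sigma>" "\<sigma>\<^sup>2 = b - a" using lt by (auto simp: \<sigma>_def)
    have D: "distributed M lborel ?D (normal_density 0 \<sigma>)"
      unfolding \<sigma>_def using W_increment_distributed[OF j ab(1) lt] .
    have tr: "integrable M (\<lambda>\<omega>. g (?D \<omega>)) \<and> expectation (\<lambda>\<omega>. g (?D \<omega>)) = c"
      if "has_bochner_integral lborel (\<lambda>x. normal_density 0 \<sigma> x * g x) c" "g \<in> borel_measurable borel"
      for g :: "real \<Rightarrow> real" and c
      using that distributed_integrable[OF D, of g] distributed_integral[OF D, of g]
      by (auto simp: has_bochner_integral_iff)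
    have m1: "has_bochner_integral lborel (\<lambda>x. normal_density 0 \<sigma> x * x) 0"
      using normal_moment_odd[OF \<sigma>(1), of 0 0] by simp
    have m2: "has_bochner_integral lborel (\<lambda>x. normal_density 0 \<sigma> x * x\<^sup>2) (b - a)"
    proof -
      have "fact (2 * 1) / ((2 / \<sigma>\<^sup>2) ^ 1 * fact 1) = b - a"
        unfolding \<sigma>(2) by (simp add: fact_numeral)
      from normal_moment_even[OF \<sigma>(1), of 0 1, unfolded this] show ?thesis by simp
    qed
    have m4: "has_bochner_integral lborel (\<lambda>x. normal_density 0 \<sigma> x * x ^ 4) (3 * (b - a)\<^sup>2)"
    proof -
      have "fact (2 * 2) / ((2 / \<sigma>\<^sup>2) ^ 2 * fact 2) = 3 * (b - a)\<^sup>2"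
        using lt unfolding \<sigma>(2) by (simp add: fact_numeral power_divide field_simps)
      from normal_moment_even[OF \<sigma>(1), of 0 2, unfolded this] show ?thesis by simp
    qed
    show ?thesis using tr[OF m1] tr[OF m2] tr[OF m4] by simp
  qed
  then show "integrable M ?D" "expectation ?D = 0" "integrable M (\<lambda>\<omega>. (?D \<omega>)\<^sup>2)" "expectation (\<lambda>\<omega>. (?D \<omega>)\<^sup>2) = b - a"
    "integrable M (\<lambda>\<omega>. (?D \<omega>) ^ 4)" "expectation (\<lambda>\<omega>. (?D \<omega>) ^ 4) = 3 * (b - a)\<^sup>2"
    by auto
qed

lemma increment_cross_moment:
  assumes ij: "i \<in> {1..<n}" "j \<in> {1..<n}" "i \<noteq> j" and ab: "0 \<le> a" "a \<le> b"
  shows "expectation (\<lambda>\<omega>. (W i b \<omega> - W i a \<omega>) * (W j b \<omega> - W j a \<omega>)) = 0"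
proof (cases "a = b")
  case True
  then show ?thesis by simp
next
  case False
  define s where "s k = a + real k * (b - a)" for k
  let ?X = "\<lambda>(j,k) \<omega>. W j (s (Suc k)) \<omega> - W j (s k) \<omega>"
  have "indep_vars (\<lambda>_. borel) ?X ({1..<n} \<times> {..<1})"
    using ab False by (intro W_increments_indep) (auto simp: s_def)
  then have "indep_vars (\<lambda>_. borel) ?X (insert (i, 0) {(j, 0)})"
    by (rule indep_vars_subset) (use ij in auto)
  \<comment> \<open>A sum over a single index turns independence of the family into independence of
    the pair.\<close>
  from indep_vars_sum[OF _ _ this]
  have "indep_var borel (\<lambda>\<omega>. W i b \<omega> - W i a \<omega>) borel (\<lambda>\<omega>. W j b \<omega> - W j a \<omega>)"
    using ij by (simp add: s_def)
  then show ?thesis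
    using increment_moments[OF ij(1) ab] increment_moments[OF ij(2) ab]
    by (subst indep_var_lebesgue_integral) auto
qed

end

section \<open>Riemann sums over two partitions\<close>

text \<open>The length of the intersection of [\<open>x\<close>, \<open>x'\<close>] and
  [\<open>y\<close>, \<open>y'\<close>]. Sums over two partitions are compared with these
  weights.\<close>

definition overlap :: "real \<Rightarrow> real \<Rightarrow> real \<Rightarrow> real \<Rightarrow> real" where
  "overlap x x' y y' = max 0 (min x' y' - max x y)"

lemma overlap_nonneg: "0 \<le> overlap x x' y y'"
  by (simp add: overlap_def)

lemma overlap_commute: "overlap x x' y y' = overlap y y' x x'"
  by (simp add: overlap_def min.commute max.commute)

text \<open>Steps may vanish and \<open>h\<close> is only a bound for the mesh. Thus degenerate
  intervals are no exception, and a fine partition also counts as one of larger mesh, which lets two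
  partitions share one \<open>h\<close>.\<close>

definition is_partition :: "real \<Rightarrow> real \<Rightarrow> real \<Rightarrow> (nat \<Rightarrow> real) \<Rightarrow> nat \<Rightarrow> bool" where
  "is_partition a b h s m \<longleftrightarrow> s 0 = a \<and> s m = b \<and> (\<forall>k<m. s k \<le> s (Suc k) \<and> s (Suc k) - s k \<le> h)"

lemma partition_mono:
  assumes "is_partition a b h s m" "k \<le> l" "l \<le> m" shows "s k \<le> s l"
  using assms(2,3)
proof (induction l rule: dec_induct)
  case (step l)
  then have "s l \<le> s (Suc l)" using assms(1) by (simp add: is_partition_def)
  then show ?case using step by simp
qed simp

lemma partition_bounds:
  assumes "is_partition a b h s m" "k \<le> m" shows "a \<le> s k" "s k \<le> b"
  using partition_mono[OF assms(1), of 0 k] partition_mono[OF assms(1), of k m] assms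
  by (auto simp: is_partition_def)

lemma partition_step:
  assumes "is_partition a b h s m" "k < m" shows "s k \<le> s (Suc k)" "s (Suc k) - s k \<le> h"
  using assms by (auto simp: is_partition_def)

lemma partition_weaken: "is_partition a b h s m \<Longrightarrow> h \<le> h' \<Longrightarrow> is_partition a b h' s m"
  by (force simp: is_partition_def)

lemma partition_length:
  assumes "is_partition a b h s m" shows "(\<Sum>k<m. s (Suc k) - s k) = b - a"
  using assms by (simp only: sum_lessThan_telescope) (simp add: is_partition_def)

lemma partition_trivial: "a \<le> b \<Longrightarrow> is_partition a b (b - a) (\<lambda>k. if k = 0 then a else b) 1"
  by (simp add: is_partition_def)

lemma partition_grid:
  assumes "0 \<le> t" shows "is_partition 0 t (t / real (Suc N)) (grid t N) (Suc N)"
  unfolding is_partition_def grid_def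
proof (intro conjI allI impI)
  fix k
  have "real (Suc k) * t / real (Suc N) = real k * t / real (Suc N) + t / real (Suc N)"
    by (simp add: add_divide_distrib[symmetric] algebra_simps)
  then show "real k * t / real (Suc N) \<le> real (Suc k) * t / real (Suc N)"
    "real (Suc k) * t / real (Suc N) - real k * t / real (Suc N) \<le> t / real (Suc N)"
    using assms by auto
qed auto

lemma partition_shift:
  assumes "is_partition 0 (b - a) h s m" shows "is_partition a b h (\<lambda>k. a + s k) m"
  using assms by (auto simp: is_partition_def)

lemma partition_exists:
  assumes "a \<le> b" "0 < h" obtains s m where "is_partition a b h s m"
proof -
  obtain N where N: "(b - a) / h < real N" using reals_Archimedean2 by blast
  have "(b - a) / real (Suc N) \<le> h"
  proof -
    have "b - a < real N * h" using N assms by (simp add: divide_less_eq)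
    also have "\<dots> \<le> real (Suc N) * h" using assms by simp
    finally show ?thesis by (simp add: divide_le_eq mult.commute del: of_nat_Suc)
  qed
  then have "is_partition 0 (b - a) h (grid (b - a) N) (Suc N)"
    using partition_grid[of "b - a" N] assms by (auto intro: partition_weaken)
  then show ?thesis using that partition_shift by blast
qed

lemma partition_append:
  assumes s: "is_partition a b h s m" and r: "is_partition b c h r m'"
  shows "is_partition a c h (\<lambda>k. if k \<le> m then s k else r (k - m)) (m + m')"
  unfolding is_partition_def
proof (intro conjI allI impI)
  have e: "s m = r 0" using s r by (simp add: is_partition_def)
  show "(if 0 \<le> m then s 0 else r (0 - m)) = a" using s by (simp add: is_partition_def)
  show "(if m + m' \<le> m then s (m + m') else r (m + m' - m)) = c"
    using s r by (auto simp: is_partition_def)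
  fix k assume k: "k < m + m'"
  have "(if k \<le> m then s k else r (k - m)) \<le> (if Suc k \<le> m then s (Suc k) else r (Suc k - m)) \<and>
    (if Suc k \<le> m then s (Suc k) else r (Suc k - m)) - (if k \<le> m then s k else r (k - m)) \<le> h"
  proof (cases "k < m")
    case True
    then show ?thesis using s by (simp add: is_partition_def)
  next
    case False
    then have "Suc k - m = Suc (k - m)" "k - m < m'" using k by auto
    moreover have "(if k \<le> m then s k else r (k - m)) = r (k - m)" using False e by auto
    ultimately show ?thesis using r False by (simp add: is_partition_def)
  qed
  then show "(if k \<le> m then s k else r (k - m)) \<le> (if Suc k \<le> m then s (Suc k) else r (Suc k - m))"
    "(if Suc k \<le> m then s (Suc k) else r (Suc k - m)) - (if k \<le> m then s k else r (k - m)) \<le> h"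
    by auto
qed

text \<open>Each overlap is the increment of the function that clamps to
  [\<open>x\<close>, \<open>x'\<close>], so the sum telescopes.\<close>

lemma sum_overlap:
  assumes r: "is_partition a b h r m" and x: "a \<le> x" "x \<le> x'" "x' \<le> b"
  shows "(\<Sum>l<m. overlap x x' (r l) (r (Suc l))) = x' - x"
proof -
  define cl where "cl u = max x (min x' u)" for u
  have "(\<Sum>l<m. overlap x x' (r l) (r (Suc l))) = (\<Sum>l<m. cl (r (Suc l)) - cl (r l))"
    using r x by (intro sum.cong) (auto simp: is_partition_def overlap_def cl_def)
  also have "\<dots> = cl (r m) - cl (r 0)" by (rule sum_lessThan_telescope)
  also have "\<dots> = x' - x" using r x by (auto simp: is_partition_def cl_def)
  finally show ?thesis .
qed

lemma sum_sum_overlap: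
  assumes s: "is_partition a b h s m" and r: "is_partition a b h' r m'"
  shows "(\<Sum>k<m. \<Sum>l<m'. overlap (s k) (s (Suc k)) (r l) (r (Suc l)) * f k) = (\<Sum>k<m. (s (Suc k) - s k) * f k)"
proof (rule sum.cong[OF refl])
  fix k assume "k \<in> {..<m}"
  then show "(\<Sum>l<m'. overlap (s k) (s (Suc k)) (r l) (r (Suc l)) * f k) = (s (Suc k) - s k) * f k"
    using sum_overlap[OF r, of "s k" "s (Suc k)"] partition_bounds[OF s, of k] partition_bounds[OF s, of "Suc k"]
      partition_step[OF s, of k] by (simp flip: sum_distrib_right)
qed

lemma sum_sum_overlap_self:
  assumes s: "is_partition a b h s m"
  shows "(\<Sum>k<m. \<Sum>l<m. overlap (s k) (s (Suc k)) (s l) (s (Suc l)) * f k l) = (\<Sum>k<m. (s (Suc k) - s k) * f k k)"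
proof (rule sum.cong[OF refl])
  fix k assume k: "k \<in> {..<m}"
  have "overlap (s k) (s (Suc k)) (s l) (s (Suc l)) * f k l = (if l = k then (s (Suc k) - s k) * f k k else 0)"
    if "l < m" for l
  proof -
    consider "l = k" | "Suc l \<le> k" | "Suc k \<le> l" by linarith
    then show ?thesis
    proof cases
      case 1
      then show ?thesis using partition_step[OF s that] by (simp add: overlap_def)
    next
      case 2
      then show ?thesis using partition_mono[OF s, of "Suc l" k] k by (auto simp: overlap_def)
    next
      case 3
      then show ?thesis using partition_mono[OF s, of "Suc k" l] that by (auto simp: overlap_def)
    qed
  qed
  then have "(\<Sum>l<m. overlap (s k) (s (Suc k)) (s l) (s (Suc l)) * f k l)
      = (\<Sum>l<m. if l = k then (s (Suc k) - s k) * f k k else 0)"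
    by (intro sum.cong) auto
  then show "(\<Sum>l<m. overlap (s k) (s (Suc k)) (s l) (s (Suc l)) * f k l) = (s (Suc k) - s k) * f k k"
    using k by simp
qed

section \<open>Regular processes, their left-point sums and the Ito isometry\<close>

context wiener
begin

text \<open>Mean-square increments of order \<open>b - a\<close> are the rate of the noise itself,
  hence the rate that integration against noise reproduces. The constant depends on the horizon
  \<open>T\<close>, since second moments of iterated integrals grow with time.\<close>

definition regular :: "(real \<Rightarrow> 'a \<Rightarrow> real) \<Rightarrow> bool" where
  "regular X \<longleftrightarrow> (\<forall>t\<ge>0. X t \<in> borel_measurable (past t)) \<and> (\<forall>t\<ge>0. sqint M (X t)) \<and>
     (\<forall>T. \<exists>L\<ge>0. \<forall>a b. 0 \<le> a \<longrightarrow> a \<le> b \<longrightarrow> b \<le> T \<longrightarrow> msq M (\<lambda>\<omega>. X b \<omega> - X a \<omega>) \<le> L * (b - a))"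

definition rsum :: "nat \<Rightarrow> (real \<Rightarrow> 'a \<Rightarrow> real) \<Rightarrow> (nat \<Rightarrow> real) \<Rightarrow> nat \<Rightarrow> 'a \<Rightarrow> real" where
  "rsum j X s m \<omega> = (\<Sum>k<m. X (s k) \<omega> * (W j (s (Suc k)) \<omega> - W j (s k) \<omega>))"

lemma regular_past: "regular X \<Longrightarrow> 0 \<le> t \<Longrightarrow> X t \<in> borel_measurable (past t)"
  by (simp add: regular_def)

lemma regular_sqint: "regular X \<Longrightarrow> 0 \<le> t \<Longrightarrow> sqint M (X t)"
  by (simp add: regular_def)

lemma regular_Lipschitz:
  assumes "regular X"
  obtains L where "0 \<le> L" "\<And>a b. 0 \<le> a \<Longrightarrow> a \<le> b \<Longrightarrow> b \<le> T \<Longrightarrow> msq M (\<lambda>\<omega>. X b \<omega> - X a \<omega>) \<le> L * (b - a)"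
  using assms unfolding regular_def by blast

lemma regular_bounded:
  assumes X: "regular X"
  obtains C where "0 \<le> C" "\<And>t. 0 \<le> t \<Longrightarrow> t \<le> T \<Longrightarrow> msq M (X t) \<le> C"
proof -
  obtain L where L: "0 \<le> L" "\<And>a b. 0 \<le> a \<Longrightarrow> a \<le> b \<Longrightarrow> b \<le> T \<Longrightarrow> msq M (\<lambda>\<omega>. X b \<omega> - X a \<omega>) \<le> L * (b - a)"
    using regular_Lipschitz[OF X] by blast
  show thesis
  proof (rule that[of "2 * (L * \<bar>T\<bar>) + 2 * msq M (X 0)"])
    show "0 \<le> 2 * (L * \<bar>T\<bar>) + 2 * msq M (X 0)" using L msq_nonneg[of M "X 0"] by simp
    fix t assume t: "0 \<le> t" "t \<le> T"
    have "msq M (\<lambda>\<omega>. (X t \<omega> - X 0 \<omega>) + X 0 \<omega>) \<le> 2 * msq M (\<lambda>\<omega>. X t \<omega> - X 0 \<omega>) + 2 * msq M (X 0)"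
      using X t by (intro msq_add_le sqint_diff regular_sqint) auto
    also have "msq M (\<lambda>\<omega>. X t \<omega> - X 0 \<omega>) \<le> L * (t - 0)" using L t by blast
    also have "L * (t - 0) \<le> L * \<bar>T\<bar>" using L t by (intro mult_left_mono) auto
    finally show "msq M (X t) \<le> 2 * (L * \<bar>T\<bar>) + 2 * msq M (X 0)" by simp
  qed
qed

lemma past_times_noise:
  assumes j: "j \<in> {1..<n}" and ab: "0 \<le> a" "a \<le> b" and X: "X \<in> borel_measurable (past a)" "integrable M X"
  shows "integrable M (\<lambda>\<omega>. X \<omega> * (W j b \<omega> - W j a \<omega>))" "expectation (\<lambda>\<omega>. X \<omega> * (W j b \<omega> - W j a \<omega>)) = 0"
    "integrable M (\<lambda>\<omega>. X \<omega> * (W j b \<omega> - W j a \<omega>)\<^sup>2)"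
    "expectation (\<lambda>\<omega>. X \<omega> * (W j b \<omega> - W j a \<omega>)\<^sup>2) = expectation X * (b - a)"
proof -
  have 1: "case_prod (\<lambda>(u::real) (v::real). u) \<in> borel_measurable (borel \<Otimes>\<^sub>M borel)"
    and 2: "case_prod (\<lambda>(u::real) (v::real). u\<^sup>2) \<in> borel_measurable (borel \<Otimes>\<^sub>M borel)"
    by measurable
  note mom = increment_moments[OF j ab]
  show "integrable M (\<lambda>\<omega>. X \<omega> * (W j b \<omega> - W j a \<omega>))" "expectation (\<lambda>\<omega>. X \<omega> * (W j b \<omega> - W j a \<omega>)) = 0"
    using expectation_past_times_increment[OF ab X j j 1] mom by auto
  show "integrable M (\<lambda>\<omega>. X \<omega> * (W j b \<omega> - W j a \<omega>)\<^sup>2)"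
    "expectation (\<lambda>\<omega>. X \<omega> * (W j b \<omega> - W j a \<omega>)\<^sup>2) = expectation X * (b - a)"
    using expectation_past_times_increment[OF ab X j j 2] mom by auto
qed

lemma sqint_past_times_increment:
  assumes j: "j < n" and ab: "0 \<le> a" "a \<le> b" and X: "X \<in> borel_measurable (past a)" "sqint M X"
  shows "sqint M (\<lambda>\<omega>. X \<omega> * (W j b \<omega> - W j a \<omega>))"
    and "msq M (\<lambda>\<omega>. X \<omega> * (W j b \<omega> - W j a \<omega>)) = msq M X * (if j = 0 then (b - a)\<^sup>2 else b - a)"
proof -
  have "sqint M (\<lambda>\<omega>. X \<omega> * (W j b \<omega> - W j a \<omega>)) \<and>
    msq M (\<lambda>\<omega>. X \<omega> * (W j b \<omega> - W j a \<omega>)) = msq M X * (if j = 0 then (b - a)\<^sup>2 else b - a)"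
  proof (cases "j = 0")
    case True
    then show ?thesis using sqint_cmult[OF X(2), of "b - a"] msq_cmult[of M "b - a" X]
      by (simp add: W_time mult.commute)
  next
    case False
    then have j': "j \<in> {1..<n}" using j by auto
    have 1: "(\<lambda>\<omega>. (X \<omega>)\<^sup>2) \<in> borel_measurable (past a)" "integrable M (\<lambda>\<omega>. (X \<omega>)\<^sup>2)"
      using X by (auto simp: sqint_def)
    have [measurable]: "X \<in> borel_measurable M" using X by (simp add: sqint_def)
    show ?thesis using past_times_noise(3,4)[OF j' ab 1] False j
      by (auto simp: sqint_def msq_def power_mult_distrib)
  qed
  then show "sqint M (\<lambda>\<omega>. X \<omega> * (W j b \<omega> - W j a \<omega>))"
    "msq M (\<lambda>\<omega>. X \<omega> * (W j b \<omega> - W j a \<omega>)) = msq M X * (if j = 0 then (b - a)\<^sup>2 else b - a)"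
    by auto
qed

text \<open>If the first interval ends before the second begins, the last increment is centred and
  independent of all other factors. Otherwise the product is cut at \<open>y\<close> and at
  \<open>m\<close>, the end of the overlap: of the three pieces only the one with the squared common
  increment can have a nonzero mean.\<close>

lemma Ito_inner_product_le:
  assumes j: "j \<in> {1..<n}" and xy: "0 \<le> x" "x \<le> x'" "x \<le> y" "y \<le> y'"
    and X: "X \<in> borel_measurable (past x)" "sqint M X" and Y: "Y \<in> borel_measurable (past y)" "sqint M Y"
  shows "expectation (\<lambda>\<omega>. (X \<omega> * (W j x' \<omega> - W j x \<omega>)) * (Y \<omega> * (W j y' \<omega> - W j y \<omega>)))
    = expectation (\<lambda>\<omega>. X \<omega> * Y \<omega>) * overlap x x' y y'"
proof (cases "x' \<le> y")
  case True
  have jn: "j < n" using j by simp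
  have "X \<in> borel_measurable (past y)" using past_measurable_mono[OF xy(3)] X by blast
  then have P: "(\<lambda>\<omega>. X \<omega> * (W j x' \<omega> - W j x \<omega>) * Y \<omega>) \<in> borel_measurable (past y)"
    using W_past_measurable[of j x' y] W_past_measurable[of j x y] jn xy True Y by auto
  have I: "integrable M (\<lambda>\<omega>. X \<omega> * (W j x' \<omega> - W j x \<omega>) * Y \<omega>)"
    using sqint_integrable_mult[OF sqint_past_times_increment(1)[OF jn xy(1,2) X] Y(2)] .
  have "expectation (\<lambda>\<omega>. (X \<omega> * (W j x' \<omega> - W j x \<omega>)) * (Y \<omega> * (W j y' \<omega> - W j y \<omega>))) = 0"
    using past_times_noise(2)[OF j _ xy(4) P I] xy by (simp add: mult.assoc)
  moreover have "overlap x x' y y' = 0" using True by (simp add: overlap_def)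
  ultimately show ?thesis by simp
next
  case False
  define m where "m = min x' y'"
  define m' where "m' = max x' y'"
  have m: "0 \<le> y" "0 \<le> m" "y \<le> m" "m \<le> m'" using xy False by (auto simp: m_def m'_def)
  have jn: "j < n" using j by simp
  have Xy: "X \<in> borel_measurable (past y)" using past_measurable_mono[OF xy(3)] X by blast
  have XY: "(\<lambda>\<omega>. X \<omega> * Y \<omega>) \<in> borel_measurable (past y)" using Xy Y by simp
  have A: "(\<lambda>\<omega>. X \<omega> * (W j y \<omega> - W j x \<omega>) * Y \<omega>) \<in> borel_measurable (past y)"
    using Xy Y W_past_measurable[of j x y] W_past_measurable[of j y y] jn xy by auto
  have AI: "integrable M (\<lambda>\<omega>. X \<omega> * (W j y \<omega> - W j x \<omega>) * Y \<omega>)"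
    using sqint_integrable_mult[OF sqint_past_times_increment(1)[OF jn xy(1,3) X] Y(2)] .
  have XYI: "integrable M (\<lambda>\<omega>. X \<omega> * Y \<omega>)" using X Y by (intro sqint_integrable_mult)
  have C: "(\<lambda>\<omega>. X \<omega> * Y \<omega> * (W j m \<omega> - W j y \<omega>)) \<in> borel_measurable (past m)"
    using past_measurable_mono[OF m(3) XY] W_past_measurable[of j y m] W_past_measurable[of j m m] jn m by auto
  note CI = past_times_noise(1)[OF j m(1,3) XY XYI]
  note n1 = past_times_noise(1,2)[OF j m(1) xy(4) A AI]
  note n2 = past_times_noise(3,4)[OF j m(1,3) XY XYI]
  note n3 = past_times_noise(1,2)[OF j m(2,4) C CI]
  have "(X \<omega> * (W j x' \<omega> - W j x \<omega>)) * (Y \<omega> * (W j y' \<omega> - W j y \<omega>))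
    = X \<omega> * (W j y \<omega> - W j x \<omega>) * Y \<omega> * (W j y' \<omega> - W j y \<omega>) + X \<omega> * Y \<omega> * (W j m \<omega> - W j y \<omega>)\<^sup>2
      + X \<omega> * Y \<omega> * (W j m \<omega> - W j y \<omega>) * (W j m' \<omega> - W j m \<omega>)" for \<omega>
    by (cases "x' \<le> y'") (simp_all add: m_def m'_def power2_eq_square algebra_simps)
  then have "expectation (\<lambda>\<omega>. (X \<omega> * (W j x' \<omega> - W j x \<omega>)) * (Y \<omega> * (W j y' \<omega> - W j y \<omega>)))
    = expectation (\<lambda>\<omega>. X \<omega> * Y \<omega>) * (m - y)"
    using n1 n2 n3 by simp
  moreover have "overlap x x' y y' = m - y"
    using xy False by (simp add: overlap_def m_def)
  ultimately show ?thesis by simp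
qed

lemma Ito_inner_product:
  assumes j: "j \<in> {1..<n}" and x: "0 \<le> x" "x \<le> x'" and y: "0 \<le> y" "y \<le> y'"
    and X: "X \<in> borel_measurable (past x)" "sqint M X" and Y: "Y \<in> borel_measurable (past y)" "sqint M Y"
  shows "expectation (\<lambda>\<omega>. (X \<omega> * (W j x' \<omega> - W j x \<omega>)) * (Y \<omega> * (W j y' \<omega> - W j y \<omega>)))
    = overlap x x' y y' * expectation (\<lambda>\<omega>. X \<omega> * Y \<omega>)"
proof (cases "x \<le> y")
  case True
  then show ?thesis using Ito_inner_product_le[OF j x True y(2) X Y] by simp
next
  case False
  then have "y \<le> x" by simp
  from Ito_inner_product_le[OF j y this x(2) Y X] show ?thesis
    by (simp add: overlap_commute mult.commute)
qed

context
  fixes X :: "real \<Rightarrow> 'a \<Rightarrow> real" and a b h h' :: real and s r :: "nat \<Rightarrow> real" and m m' :: nat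
  assumes X: "regular X" and a: "0 \<le> a"
    and s: "is_partition a b h s m" and r: "is_partition a b h' r m'"
begin

lemma partition_point:
  "k \<le> m \<Longrightarrow> 0 \<le> s k" "l \<le> m' \<Longrightarrow> 0 \<le> r l"
  using partition_bounds(1)[OF s] partition_bounds(1)[OF r] a by force+

lemma rsum_sqint: assumes "j < n" shows "sqint M (rsum j X s m)"
  unfolding rsum_def[abs_def]
  using partition_point X assms partition_step[OF s]
  by (intro sqint_sum sqint_past_times_increment regular_past regular_sqint) auto

lemma rsum_past: assumes "j < n" shows "rsum j X s m \<in> borel_measurable (past b)"
  unfolding rsum_def[abs_def]
proof (intro borel_measurable_sum borel_measurable_times borel_measurable_diff)
  fix k assume k: "k \<in> {..<m}"
  show "X (s k) \<in> borel_measurable (past b)"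
    using k partition_point(1)[of k] partition_bounds(2)[OF s, of k] X
    by (intro past_measurable_mono[OF _ regular_past]) auto
  show "W j (s k) \<in> borel_measurable (past b)" "W j (s (Suc k)) \<in> borel_measurable (past b)"
    using k partition_point(1) partition_bounds(2)[OF s] assms by (auto intro!: W_past_measurable)
qed

lemma Ito_rsum_inner_product:
  assumes j: "j \<in> {1..<n}"
  shows "expectation (\<lambda>\<omega>. rsum j X s m \<omega> * rsum j X r m' \<omega>)
    = (\<Sum>k<m. \<Sum>l<m'. overlap (s k) (s (Suc k)) (r l) (r (Suc l)) * expectation (\<lambda>\<omega>. X (s k) \<omega> * X (r l) \<omega>))"
proof -
  let ?p = "\<lambda>k \<omega>. X (s k) \<omega> * (W j (s (Suc k)) \<omega> - W j (s k) \<omega>)"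
  let ?q = "\<lambda>l \<omega>. X (r l) \<omega> * (W j (r (Suc l)) \<omega> - W j (r l) \<omega>)"
  have jn: "j < n" using j by simp
  have p: "sqint M (?p k)" if "k < m" for k
    using that partition_point(1)[of k] partition_step[OF s] X jn
    by (intro sqint_past_times_increment regular_past regular_sqint) auto
  have q: "sqint M (?q l)" if "l < m'" for l
    using that partition_point(2)[of l] partition_step[OF r] X jn
    by (intro sqint_past_times_increment regular_past regular_sqint) auto
  have "expectation (\<lambda>\<omega>. rsum j X s m \<omega> * rsum j X r m' \<omega>) = expectation (\<lambda>\<omega>. \<Sum>k<m. \<Sum>l<m'. ?p k \<omega> * ?q l \<omega>)"
    unfolding rsum_def sum_product ..
  also have "\<dots> = (\<Sum>k<m. expectation (\<lambda>\<omega>. \<Sum>l<m'. ?p k \<omega> * ?q l \<omega>))"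
    by (intro Bochner_Integration.integral_sum Bochner_Integration.integrable_sum sqint_integrable_mult p q) auto
  also have "\<dots> = (\<Sum>k<m. \<Sum>l<m'. expectation (\<lambda>\<omega>. ?p k \<omega> * ?q l \<omega>))"
    by (intro sum.cong refl Bochner_Integration.integral_sum sqint_integrable_mult p q) auto
  also have "\<dots> = (\<Sum>k<m. \<Sum>l<m'. overlap (s k) (s (Suc k)) (r l) (r (Suc l)) * expectation (\<lambda>\<omega>. X (s k) \<omega> * X (r l) \<omega>))"
    using partition_point partition_step[OF s] partition_step[OF r] X
    by (intro sum.cong refl Ito_inner_product j regular_past regular_sqint) auto
  finally show ?thesis .
qed

end

lemma Ito_rsum_msq:
  assumes j: "j \<in> {1..<n}" and X: "regular X" and a: "0 \<le> a" and s: "is_partition a b h s m"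
  shows "expectation (\<lambda>\<omega>. rsum j X s m \<omega> * rsum j X s m \<omega>) = (\<Sum>k<m. (s (Suc k) - s k) * msq M (X (s k)))"
  unfolding Ito_rsum_inner_product[OF X a s s j] sum_sum_overlap_self[OF s]
  by (simp add: msq_def power2_eq_square)

text \<open>Weighting by the overlaps of the intervals avoids passing to a common refinement.\<close>

lemma Ito_isometry_two_partitions:
  assumes j: "j \<in> {1..<n}" and X: "regular X" and a: "0 \<le> a"
    and s: "is_partition a b h s m" and r: "is_partition a b h' r m'"
  shows "msq M (\<lambda>\<omega>. rsum j X s m \<omega> - rsum j X r m' \<omega>)
    = (\<Sum>k<m. \<Sum>l<m'. overlap (s k) (s (Suc k)) (r l) (r (Suc l)) * msq M (\<lambda>\<omega>. X (s k) \<omega> - X (r l) \<omega>))"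
proof -
  let ?S = "rsum j X s m" and ?R = "rsum j X r m'"
  let ?o = "\<lambda>k l. overlap (s k) (s (Suc k)) (r l) (r (Suc l))"
  have jn: "j < n" using j by simp
  have S: "sqint M ?S" using rsum_sqint[OF X a s s jn] .
  have R: "sqint M ?R" using rsum_sqint[OF X a r r jn] .
  have sq: "msq M (\<lambda>\<omega>. U \<omega> - V \<omega>) = expectation (\<lambda>\<omega>. U \<omega> * U \<omega>) - 2 * expectation (\<lambda>\<omega>. U \<omega> * V \<omega>) + expectation (\<lambda>\<omega>. V \<omega> * V \<omega>)"
    if "sqint M U" "sqint M V" for U V
  proof -
    have "msq M (\<lambda>\<omega>. U \<omega> - V \<omega>) = expectation (\<lambda>\<omega>. U \<omega> * U \<omega> - 2 * (U \<omega> * V \<omega>) + V \<omega> * V \<omega>)"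
      unfolding msq_def by (intro Bochner_Integration.integral_cong) (auto simp: power2_eq_square algebra_simps)
    then show ?thesis using sqint_integrable_mult[of M] that by simp
  qed
  have p: "msq M (\<lambda>\<omega>. X (s k) \<omega> - X (r l) \<omega>)
     = msq M (X (s k)) - 2 * expectation (\<lambda>\<omega>. X (s k) \<omega> * X (r l) \<omega>) + msq M (X (r l))" if "k < m" "l < m'" for k l
    using sq[OF regular_sqint[OF X] regular_sqint[OF X], of "s k" "r l"] that
      partition_point[OF X a s r] by (simp add: msq_def power2_eq_square)
  \<comment> \<open>The weights sum over either index to the interval lengths. So the two pure
    squares give the isometry for each partition alone, and the mixed term is the inner product of
    the two sums.\<close>
  have "(\<Sum>k<m. \<Sum>l<m'. ?o k l * msq M (\<lambda>\<omega>. X (s k) \<omega> - X (r l) \<omega>))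
    = (\<Sum>k<m. \<Sum>l<m'. ?o k l * msq M (X (s k)) - 2 * (?o k l * expectation (\<lambda>\<omega>. X (s k) \<omega> * X (r l) \<omega>)) + ?o k l * msq M (X (r l)))"
    by (intro sum.cong refl) (simp add: p algebra_simps)
  also have "\<dots> = (\<Sum>k<m. \<Sum>l<m'. ?o k l * msq M (X (s k)))
      - 2 * (\<Sum>k<m. \<Sum>l<m'. ?o k l * expectation (\<lambda>\<omega>. X (s k) \<omega> * X (r l) \<omega>))
      + (\<Sum>k<m. \<Sum>l<m'. ?o k l * msq M (X (r l)))"
    by (simp add: sum.distrib sum_subtractf sum_distrib_left)
  also have "(\<Sum>k<m. \<Sum>l<m'. ?o k l * msq M (X (s k))) = expectation (\<lambda>\<omega>. ?S \<omega> * ?S \<omega>)"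
    using sum_sum_overlap[OF s r, of "\<lambda>k. msq M (X (s k))"] Ito_rsum_msq[OF j X a s] by simp
  also have "(\<Sum>k<m. \<Sum>l<m'. ?o k l * msq M (X (r l))) = expectation (\<lambda>\<omega>. ?R \<omega> * ?R \<omega>)"
    using sum_sum_overlap[OF r s, of "\<lambda>k. msq M (X (r k))"] Ito_rsum_msq[OF j X a r]
    by (subst sum.swap) (simp add: overlap_commute)
  also have "(\<Sum>k<m. \<Sum>l<m'. ?o k l * expectation (\<lambda>\<omega>. X (s k) \<omega> * X (r l) \<omega>)) = expectation (\<lambda>\<omega>. ?S \<omega> * ?R \<omega>)"
    using Ito_rsum_inner_product[OF X a s r j] by simp
  finally show ?thesis using sq[OF S R] by simp
qed

text \<open>Time increments are not orthogonal, so the isometry is replaced by Cauchy-Schwarz with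
  the overlaps as weights; their total mass \<open>b - a\<close> is the extra factor.\<close>

lemma time_rsum_two_partitions:
  assumes X: "regular X" and a: "0 \<le> a"
    and s: "is_partition a b h s m" and r: "is_partition a b h' r m'"
  shows "msq M (\<lambda>\<omega>. rsum 0 X s m \<omega> - rsum 0 X r m' \<omega>)
    \<le> (b - a) * (\<Sum>k<m. \<Sum>l<m'. overlap (s k) (s (Suc k)) (r l) (r (Suc l)) * msq M (\<lambda>\<omega>. X (s k) \<omega> - X (r l) \<omega>))"
proof -
  let ?o = "\<lambda>k l. overlap (s k) (s (Suc k)) (r l) (r (Suc l))"
  let ?I = "{..<m} \<times> {..<m'}"
  have "rsum 0 X s m \<omega> - rsum 0 X r m' \<omega> = (\<Sum>z\<in>?I. (case z of (k, l) \<Rightarrow> ?o k l) * (case z of (k, l) \<Rightarrow> \<lambda>\<omega>. X (s k) \<omega> - X (r l) \<omega>) \<omega>)" for \<omega>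
  proof -
    have "rsum 0 X s m \<omega> = (\<Sum>k<m. \<Sum>l<m'. ?o k l * X (s k) \<omega>)"
      using sum_sum_overlap[OF s r, of "\<lambda>k. X (s k) \<omega>"] by (simp add: rsum_def W_time mult.commute)
    moreover have "rsum 0 X r m' \<omega> = (\<Sum>k<m. \<Sum>l<m'. ?o k l * X (r l) \<omega>)"
      using sum_sum_overlap[OF r s, of "\<lambda>k. X (r k) \<omega>"]
      by (subst sum.swap) (simp add: rsum_def W_time mult.commute overlap_commute)
    ultimately show ?thesis
      by (simp add: sum.cartesian_product[symmetric] sum_subtractf right_diff_distrib)
         (simp add: sum.cartesian_product case_prod_beta' sum_subtractf right_diff_distrib)
  qed
  then have "msq M (\<lambda>\<omega>. rsum 0 X s m \<omega> - rsum 0 X r m' \<omega>)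
    \<le> (\<Sum>z\<in>?I. case z of (k, l) \<Rightarrow> ?o k l) * (\<Sum>z\<in>?I. (case z of (k, l) \<Rightarrow> ?o k l) * msq M (case z of (k, l) \<Rightarrow> \<lambda>\<omega>. X (s k) \<omega> - X (r l) \<omega>))"
    using partition_point[OF X a s r]
    by (simp only:) (intro msq_weighted_sum_le, auto intro!: overlap_nonneg sqint_diff regular_sqint[OF X])
  also have "(\<Sum>z\<in>?I. case z of (k, l) \<Rightarrow> ?o k l) = b - a"
    using sum_sum_overlap[OF s r, of "\<lambda>_. 1"] partition_length[OF s] by (simp add: sum.cartesian_product)
  also have "(\<Sum>z\<in>?I. (case z of (k, l) \<Rightarrow> ?o k l) * msq M (case z of (k, l) \<Rightarrow> \<lambda>\<omega>. X (s k) \<omega> - X (r l) \<omega>))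
    = (\<Sum>k<m. \<Sum>l<m'. ?o k l * msq M (\<lambda>\<omega>. X (s k) \<omega> - X (r l) \<omega>))"
    by (simp add: sum.cartesian_product case_prod_beta')
  finally show ?thesis .
qed

text \<open>Intervals that overlap in positive length have left endpoints at distance at most
  \<open>h\<close>, so the Lipschitz bound applies wherever the weight is nonzero, and the weights
  add up to \<open>b - a\<close>. \<open>K\<close> depends neither on the interval nor on the
  partitions.\<close>

lemma rsum_two_partitions:
  assumes j: "j < n" and X: "regular X"
  obtains K where "0 \<le> K" "\<And>a b h s m r m'. 0 \<le> a \<Longrightarrow> a \<le> b \<Longrightarrow> b \<le> T \<Longrightarrow> 0 \<le> h \<Longrightarrow>
      is_partition a b h s m \<Longrightarrow> is_partition a b h r m' \<Longrightarrow>
      msq M (\<lambda>\<omega>. rsum j X s m \<omega> - rsum j X r m' \<omega>) \<le> K * (b - a) * h"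
proof -
  obtain L where L: "0 \<le> L" "\<And>a b. 0 \<le> a \<Longrightarrow> a \<le> b \<Longrightarrow> b \<le> T \<Longrightarrow> msq M (\<lambda>\<omega>. X b \<omega> - X a \<omega>) \<le> L * (b - a)"
    using regular_Lipschitz[OF X] by blast
  show thesis
  \<comment> \<open>The summand \<open>1\<close> serves the noise drivers;
    \<open>\<bar>T\<bar>\<close> bounds the extra factor \<open>b - a\<close> of the time
    driver.\<close>
  proof (rule that[of "L * (1 + \<bar>T\<bar>)"])
    show "0 \<le> L * (1 + \<bar>T\<bar>)" using L by simp
    fix a b h s m r m'
    assume ab: "0 \<le> a" "a \<le> b" "b \<le> T" and h: "0 \<le> h"
      and s: "is_partition a b h s m" and r: "is_partition a b h r m'"
    let ?o = "\<lambda>k l. overlap (s k) (s (Suc k)) (r l) (r (Suc l))"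
    let ?Q = "\<Sum>k<m. \<Sum>l<m'. ?o k l * msq M (\<lambda>\<omega>. X (s k) \<omega> - X (r l) \<omega>)"
    have swap: "msq M (\<lambda>\<omega>. X u \<omega> - X v \<omega>) = msq M (\<lambda>\<omega>. X v \<omega> - X u \<omega>)" for u v
      by (simp add: msq_def power2_commute)
    have Lip: "msq M (\<lambda>\<omega>. X u \<omega> - X v \<omega>) \<le> L * \<bar>u - v\<bar>" if "0 \<le> u" "0 \<le> v" "u \<le> T" "v \<le> T" for u v
      using L(2)[of v u] L(2)[of u v] that by (cases "u \<le> v") (auto simp: swap[of u v])
    have "?Q \<le> (\<Sum>k<m. \<Sum>l<m'. ?o k l * (L * h))"
    proof (intro sum_mono)
      fix k l assume kl: "k \<in> {..<m}" "l \<in> {..<m'}"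
      show "?o k l * msq M (\<lambda>\<omega>. X (s k) \<omega> - X (r l) \<omega>) \<le> ?o k l * (L * h)"
      proof (cases "?o k l = 0")
        case False
        then have "s k < r (Suc l)" "r l < s (Suc k)"
          by (auto simp: overlap_def max_def min_def split: if_splits)
        then have d: "\<bar>s k - r l\<bar> \<le> h"
          using partition_step[OF s, of k] partition_step[OF r, of l] kl by (auto simp: abs_le_iff)
        have "msq M (\<lambda>\<omega>. X (s k) \<omega> - X (r l) \<omega>) \<le> L * \<bar>s k - r l\<bar>"
          using partition_bounds[OF s, of k] partition_bounds[OF r, of l] kl ab by (intro Lip) auto
        also have "\<dots> \<le> L * h" using d L by (intro mult_left_mono)
        finally show ?thesis by (intro mult_left_mono overlap_nonneg)
      qed simp
    qed
    also have "\<dots> = (b - a) * (L * h)"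
      unfolding sum_sum_overlap[OF s r, of "\<lambda>_. L * h"] using partition_length[OF s]
      by (simp flip: sum_distrib_right)
    finally have Q: "?Q \<le> (b - a) * (L * h)" .
    have nn: "0 \<le> (b - a) * (L * h)" using ab L h by simp
    show "msq M (\<lambda>\<omega>. rsum j X s m \<omega> - rsum j X r m' \<omega>) \<le> L * (1 + \<bar>T\<bar>) * (b - a) * h"
    proof (cases "j = 0")
      case True
      then have "msq M (\<lambda>\<omega>. rsum j X s m \<omega> - rsum j X r m' \<omega>) \<le> (b - a) * ?Q"
        using time_rsum_two_partitions[OF X ab(1) s r] by simp
      also have "\<dots> \<le> (b - a) * ((b - a) * (L * h))" using Q ab by (intro mult_left_mono) auto
      also have "\<dots> \<le> (1 + \<bar>T\<bar>) * ((b - a) * (L * h))" using nn ab by (intro mult_right_mono) auto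
      finally show ?thesis by (simp add: algebra_simps)
    next
      case False
      then have "msq M (\<lambda>\<omega>. rsum j X s m \<omega> - rsum j X r m' \<omega>) = ?Q"
        using Ito_isometry_two_partitions[OF _ X ab(1) s r, of j] j by auto
      also have "\<dots> \<le> 1 * ((b - a) * (L * h))" using Q by simp
      also have "\<dots> \<le> (1 + \<bar>T\<bar>) * ((b - a) * (L * h))" using nn by (intro mult_right_mono) auto
      finally show ?thesis by (simp add: algebra_simps)
    qed
  qed
qed

end

section \<open>Stochastic integrals of regular processes\<close>

text \<open>\<open>4 ^ N\<close> cells match the geometric rate asked for by
  \<open>sqint_geometric_Cauchy_limit\<close>. The index is shifted because \<open>grid t N\<close>
  has \<open>Suc N\<close> cells.\<close>

lemma partition_grid_power4:
  assumes "0 \<le> t" shows "is_partition 0 t (t / 4 ^ N) (grid t (4 ^ N - 1)) (4 ^ N)"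
proof -
  have "Suc (4 ^ N - 1) = 4 ^ N" by simp
  from partition_grid[OF assms, of "4 ^ N - 1", unfolded this] show ?thesis by simp
qed

text \<open>The integrand is increasing on the nonnegative axis, so the error on a cell lies between
  0 and the mesh times the rise of the integrand, and the rises telescope. The term
  \<open>0 ^ q\<close> belongs to the initial value and equals 1 when \<open>q = 0\<close>.\<close>

lemma Riemann_sum_monomial:
  assumes s: "is_partition 0 t h s m"
  shows "\<bar>(\<Sum>k<m. s k ^ q / fact q * (s (Suc k) - s k)) - t ^ Suc q / fact (Suc q)\<bar> \<le> h * (t ^ q / fact q - 0 ^ q / fact q)"
proof -
  define f where "f x = x ^ q / fact q" for x :: real
  define F where "F x = x ^ Suc q / fact (Suc q)" for x :: real
  have F': "DERIV F x :> f x" for x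
  proof -
    from DERIV_cdivide[OF DERIV_pow[where n="Suc q" and x=x and s=UNIV], where c="fact (Suc q)"]
    have "DERIV F x :> real (Suc q) * x ^ q / fact (Suc q)"
      by (simp add: F_def[abs_def] del: power_Suc of_nat_Suc fact_Suc)
    moreover have "real (Suc q) * x ^ q / fact (Suc q) = f x"
      by (simp add: f_def del: of_nat_Suc)
    ultimately show ?thesis by simp
  qed
  have mono: "f x \<le> f y" if "0 \<le> x" "x \<le> y" for x y
    unfolding f_def using that by (intro divide_right_mono power_mono) auto
  have step: "0 \<le> F y - F x - f x * (y - x)" "F y - F x - f x * (y - x) \<le> (f y - f x) * (y - x)"
    if xy: "0 \<le> x" "x \<le> y" for x y
  proof -
    have "\<exists>z\<ge>x. z \<le> y \<and> F y - F x = (y - x) * f z"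
    proof (cases "x = y")
      case False
      then have "x < y" using xy by simp
      from MVT2[OF this F'] show ?thesis by (meson less_imp_le)
    qed auto
    then obtain z where z: "x \<le> z" "z \<le> y" "F y - F x = (y - x) * f z" by blast
    have "f x \<le> f z" "f z \<le> f y" using mono z xy by auto
    then have "(y - x) * f x \<le> (y - x) * f z" "(y - x) * f z \<le> (y - x) * f y"
      using xy by (auto intro!: mult_left_mono)
    then show "0 \<le> F y - F x - f x * (y - x)" "F y - F x - f x * (y - x) \<le> (f y - f x) * (y - x)"
      using z(3) by (auto simp: algebra_simps)
  qed
  have s0: "0 \<le> s k" if "k \<le> m" for k using partition_bounds(1)[OF s that] .
  let ?e = "\<lambda>k. F (s (Suc k)) - F (s k) - f (s k) * (s (Suc k) - s k)"
  have "F t - F 0 = (\<Sum>k<m. F (s (Suc k)) - F (s k))"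
    using s by (simp only: sum_lessThan_telescope[of "\<lambda>k. F (s k)"]) (simp add: is_partition_def)
  then have e: "F t - (\<Sum>k<m. f (s k) * (s (Suc k) - s k)) = (\<Sum>k<m. ?e k)"
    by (simp add: sum_subtractf F_def)
  have "0 \<le> (\<Sum>k<m. ?e k)"
    using step(1) s0 partition_step[OF s] by (intro sum_nonneg) auto
  moreover have "(\<Sum>k<m. ?e k) \<le> (\<Sum>k<m. (f (s (Suc k)) - f (s k)) * h)"
  proof (rule sum_mono)
    fix k assume k: "k \<in> {..<m}"
    have "?e k \<le> (f (s (Suc k)) - f (s k)) * (s (Suc k) - s k)"
      using step(2) s0[of k] partition_step[OF s, of k] k by auto
    also have "\<dots> \<le> (f (s (Suc k)) - f (s k)) * h"
      using mono[of "s k" "s (Suc k)"] s0[of k] partition_step[OF s, of k] k by (intro mult_left_mono) auto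
    finally show "?e k \<le> (f (s (Suc k)) - f (s k)) * h" .
  qed
  moreover have "(\<Sum>k<m. (f (s (Suc k)) - f (s k)) * h) = h * (f t - f 0)"
    unfolding sum_distrib_right[symmetric] sum_lessThan_telescope[of "\<lambda>k. f (s k)"]
    using s by (simp add: is_partition_def)
  ultimately show ?thesis using e by (simp add: f_def F_def)
qed

context wiener
begin

lemma rsum_append:
  assumes "s m = r 0"
  shows "rsum j X (\<lambda>k. if k \<le> m then s k else r (k - m)) (m + m') \<omega> = rsum j X s m \<omega> + rsum j X r m' \<omega>"
proof (induction m')
  case 0
  then show ?case by (simp add: rsum_def)
next
  case (Suc m')
  have "(if m + m' \<le> m then s (m + m') else r (m + m' - m)) = r m'" using assms by auto
  then show ?case using Suc by (simp add: rsum_def)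
qed

text \<open>The first clause lets the integral serve as the next integrand, the second turns sums
  along any partition into approximations with a rate, and the third gives the leading term of an
  increment, from which covariations are computed.\<close>

definition is_integral :: "nat \<Rightarrow> (real \<Rightarrow> 'a \<Rightarrow> real) \<Rightarrow> (real \<Rightarrow> 'a \<Rightarrow> real) \<Rightarrow> bool" where
  "is_integral j X Z \<longleftrightarrow> regular Z \<and>
     (\<forall>T. \<exists>K\<ge>0. \<forall>t h s m. 0 \<le> t \<longrightarrow> t \<le> T \<longrightarrow> 0 < h \<longrightarrow> is_partition 0 t h s m \<longrightarrow>
        msq M (\<lambda>\<omega>. Z t \<omega> - rsum j X s m \<omega>) \<le> K * h) \<and>
     (\<forall>T. \<exists>K\<ge>0. \<forall>a b. 0 \<le> a \<longrightarrow> a \<le> b \<longrightarrow> b \<le> T \<longrightarrow>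
        msq M (\<lambda>\<omega>. Z b \<omega> - Z a \<omega> - X a \<omega> * (W j b \<omega> - W j a \<omega>)) \<le> K * (b - a)\<^sup>2)"

lemma is_integral_regular: "is_integral j X Z \<Longrightarrow> regular Z"
  by (simp add: is_integral_def)

lemma is_integral_approx:
  assumes "is_integral j X Z"
  obtains K where "0 \<le> K" "\<And>t h s m. 0 \<le> t \<Longrightarrow> t \<le> T \<Longrightarrow> 0 < h \<Longrightarrow> is_partition 0 t h s m \<Longrightarrow>
        msq M (\<lambda>\<omega>. Z t \<omega> - rsum j X s m \<omega>) \<le> K * h"
  using assms unfolding is_integral_def by blast

lemma grid_limit_exists:
  assumes j: "j < n" and X: "regular X" and t: "0 \<le> t"
  shows "\<exists>Z C. Z \<in> borel_measurable (past t) \<and> sqint M Z \<and>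
     (\<forall>N. msq M (\<lambda>\<omega>. Z \<omega> - rsum j X (grid t (4 ^ N - 1)) (4 ^ N) \<omega>) \<le> C / 4 ^ N)"
proof -
  obtain K where K: "0 \<le> K" "\<And>a b h s m r m'. 0 \<le> a \<Longrightarrow> a \<le> b \<Longrightarrow> b \<le> t \<Longrightarrow> 0 \<le> h \<Longrightarrow>
      is_partition a b h s m \<Longrightarrow> is_partition a b h r m' \<Longrightarrow>
      msq M (\<lambda>\<omega>. rsum j X s m \<omega> - rsum j X r m' \<omega>) \<le> K * (b - a) * h"
    using rsum_two_partitions[OF j X] by blast
  let ?G = "\<lambda>N. rsum j X (grid t (4 ^ N - 1)) (4 ^ N)"
  have part: "is_partition 0 t (t / 4 ^ N) (grid t (4 ^ N - 1)) (4 ^ N)" for N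
    using t by (rule partition_grid_power4)
  \<comment> \<open>The finer grid is also a partition for the coarser mesh, so that the comparison
    applies with one \<open>h\<close>.\<close>
  have part': "is_partition 0 t (t / 4 ^ N) (grid t (4 ^ N' - 1)) (4 ^ N')" if "N \<le> N'" for N N'
    using part by (rule partition_weaken) (use t that in \<open>auto intro!: divide_left_mono power_increasing\<close>)
  have "\<exists>Z. Z \<in> borel_measurable (past t) \<and> sqint M Z \<and> (\<forall>N. msq M (\<lambda>\<omega>. Z \<omega> - ?G N \<omega>) \<le> (K * t * t) / 4 ^ N)"
  proof (rule sqint_geometric_Cauchy_limit[OF subalgebra_past])
    show "?G N \<in> borel_measurable (past t)" "sqint M (?G N)" for N
      using rsum_past[OF X order.refl part part j] rsum_sqint[OF X order.refl part part j] by auto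
    show "msq M (\<lambda>\<omega>. ?G N' \<omega> - ?G N \<omega>) \<le> K * t * t / 4 ^ N" if "N \<le> N'" for N N'
      using K(2)[OF order.refl t order.refl _ part'[OF that] part] t by simp
  qed
  then show ?thesis by blast
qed

text \<open>The limit is taken separately at each \<open>t\<close>, with a constant depending on
  \<open>t\<close>. Uniform constants come afterwards: the comparison of two partitions is uniform,
  and an auxiliary grid that is fine enough absorbs the constant of the time at hand.\<close>

lemma integral_exists:
  assumes j: "j < n" and X: "regular X"
  shows "\<exists>Z. is_integral j X Z"
proof -
  obtain Z where Z: "\<And>t. 0 \<le> t \<Longrightarrow> \<exists>C. Z t \<in> borel_measurable (past t) \<and> sqint M (Z t) \<and>
     (\<forall>N. msq M (\<lambda>\<omega>. Z t \<omega> - rsum j X (grid t (4 ^ N - 1)) (4 ^ N) \<omega>) \<le> C / 4 ^ N)"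
    using grid_limit_exists[OF j X] by metis
  have Zp: "Z t \<in> borel_measurable (past t)" and Zs: "sqint M (Z t)" if "0 \<le> t" for t
    using Z[OF that] by blast+
  have approx: "\<exists>K\<ge>0. \<forall>t h s m. 0 \<le> t \<longrightarrow> t \<le> T \<longrightarrow> 0 < h \<longrightarrow> is_partition 0 t h s m \<longrightarrow>
        msq M (\<lambda>\<omega>. Z t \<omega> - rsum j X s m \<omega>) \<le> K * h" for T
  proof -
    obtain K where K: "0 \<le> K" "\<And>a b h s m r m'. 0 \<le> a \<Longrightarrow> a \<le> b \<Longrightarrow> b \<le> T \<Longrightarrow> 0 \<le> h \<Longrightarrow>
        is_partition a b h s m \<Longrightarrow> is_partition a b h r m' \<Longrightarrow>
        msq M (\<lambda>\<omega>. rsum j X s m \<omega> - rsum j X r m' \<omega>) \<le> K * (b - a) * h"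
      using rsum_two_partitions[OF j X] by blast
    show ?thesis
    proof (intro exI[of _ "2 + 2 * (K * \<bar>T\<bar>)"] conjI allI impI)
      show "0 \<le> 2 + 2 * (K * \<bar>T\<bar>)" using K by simp
      fix t h s m assume t: "0 \<le> t" "t \<le> T" and h: "0 < h" and s: "is_partition 0 t h s m"
      obtain C where C: "\<And>N. msq M (\<lambda>\<omega>. Z t \<omega> - rsum j X (grid t (4 ^ N - 1)) (4 ^ N) \<omega>) \<le> C / 4 ^ N"
        using Z[OF t(1)] by blast
      \<comment> \<open>So fine that both the pointwise error \<open>C / 4 ^ N\<close> and the mesh
        \<open>t / 4 ^ N\<close> fall below \<open>h\<close>; the constant \<open>C\<close> then
        leaves the estimate.\<close>
      obtain N where N: "max C t / h < 4 ^ N" using real_arch_pow[of 4 "max C t / h"] by auto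
      let ?G = "rsum j X (grid t (4 ^ N - 1)) (4 ^ N)"
      have "max C t < h * 4 ^ N" using N h by (simp add: divide_less_eq mult.commute)
      then have CN: "C / 4 ^ N \<le> h" "t / 4 ^ N \<le> h" by (auto simp: divide_le_eq)
      have "is_partition 0 t (t / 4 ^ N) (grid t (4 ^ N - 1)) (4 ^ N)"
        using t(1) by (rule partition_grid_power4)
      then have g: "is_partition 0 t h (grid t (4 ^ N - 1)) (4 ^ N)" using CN(2) by (rule partition_weaken)
      note sq = Zs[OF t(1)] rsum_sqint[OF X order.refl g g j] rsum_sqint[OF X order.refl s s j]
      have "msq M (\<lambda>\<omega>. (Z t \<omega> - ?G \<omega>) + (?G \<omega> - rsum j X s m \<omega>))
        \<le> 2 * msq M (\<lambda>\<omega>. Z t \<omega> - ?G \<omega>) + 2 * msq M (\<lambda>\<omega>. ?G \<omega> - rsum j X s m \<omega>)"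
        using sq by (intro msq_add_le sqint_diff)
      also have "\<dots> \<le> 2 * h + 2 * (K * (t - 0) * h)"
        using order_trans[OF C[of N] CN(1)] K(2)[OF order.refl t(1,2) less_imp_le[OF h] g s] by simp
      also have "\<dots> \<le> 2 * h + 2 * (K * \<bar>T\<bar> * h)"
        using K t h by (intro add_left_mono mult_left_mono mult_right_mono) auto
      finally show "msq M (\<lambda>\<omega>. Z t \<omega> - rsum j X s m \<omega>) \<le> (2 + 2 * (K * \<bar>T\<bar>)) * h"
        by (simp add: algebra_simps)
    qed
  qed
  have expansion: "\<exists>K\<ge>0. \<forall>a b. 0 \<le> a \<longrightarrow> a \<le> b \<longrightarrow> b \<le> T \<longrightarrow>
        msq M (\<lambda>\<omega>. Z b \<omega> - Z a \<omega> - X a \<omega> * (W j b \<omega> - W j a \<omega>)) \<le> K * (b - a)\<^sup>2" for T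
  proof -
    obtain K where K: "0 \<le> K" "\<And>a b h s m r m'. 0 \<le> a \<Longrightarrow> a \<le> b \<Longrightarrow> b \<le> T \<Longrightarrow> 0 \<le> h \<Longrightarrow>
        is_partition a b h s m \<Longrightarrow> is_partition a b h r m' \<Longrightarrow>
        msq M (\<lambda>\<omega>. rsum j X s m \<omega> - rsum j X r m' \<omega>) \<le> K * (b - a) * h"
      using rsum_two_partitions[OF j X] by blast
    obtain K' where K': "0 \<le> K'" "\<And>t h s m. 0 \<le> t \<Longrightarrow> t \<le> T \<Longrightarrow> 0 < h \<Longrightarrow> is_partition 0 t h s m \<Longrightarrow>
        msq M (\<lambda>\<omega>. Z t \<omega> - rsum j X s m \<omega>) \<le> K' * h"
      using approx[of T] by blast
    show ?thesis
    proof (intro exI[of _ "8 * K' + 2 * K"] conjI allI impI)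
      show "0 \<le> 8 * K' + 2 * K" using K K' by simp
      fix a b assume ab: "0 \<le> a" "a \<le> b" "b \<le> T"
      show "msq M (\<lambda>\<omega>. Z b \<omega> - Z a \<omega> - X a \<omega> * (W j b \<omega> - W j a \<omega>)) \<le> (8 * K' + 2 * K) * (b - a)\<^sup>2"
      proof (cases "a = b")
        case True
        then show ?thesis by (simp add: msq_def)
      next
        case False
        then have lt: "a < b" using ab by simp
        \<comment> \<open>The bound by \<open>(b - a)\<^sup>2\<close> makes the approximation errors
          at \<open>a\<close> and at \<open>b\<close> quadratic; the bound by \<open>b - a\<close>
          makes \<open>v\<close> comparable with the partition into a single interval, whose sum is
          the leading term.\<close>
        define h where "h = min ((b - a)\<^sup>2) (b - a)"
        have h: "0 < h" "h \<le> (b - a)\<^sup>2" "h \<le> b - a" using lt by (auto simp: h_def)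
        obtain u m where u: "is_partition 0 a h u m" using partition_exists[OF ab(1) h(1)] .
        obtain v m' where v: "is_partition a b h v m'" using partition_exists[OF ab(2) h(1)] .
        let ?w = "\<lambda>k. if k \<le> m then u k else v (k - m)"
        have w: "is_partition 0 b h ?w (m + m')" using u v by (rule partition_append)
        have uv: "u m = v 0" using u v by (simp add: is_partition_def)
        let ?e = "\<lambda>k::nat. if k = 0 then a else b"
        have e: "is_partition a b (b - a) ?e 1" using ab(2) by (rule partition_trivial)
        have v': "is_partition a b (b - a) v m'" using v h(3) by (rule partition_weaken)
        have re: "rsum j X ?e 1 \<omega> = X a \<omega> * (W j b \<omega> - W j a \<omega>)" for \<omega> by (simp add: rsum_def)
        \<comment> \<open>\<open>Z b\<close> is approximated along the concatenation of
          \<open>u\<close> and \<open>v\<close>, so in the difference the sums up to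
          \<open>a\<close> cancel and the sum along \<open>v\<close> is left.\<close>
        let ?P = "\<lambda>\<omega>. Z b \<omega> - rsum j X ?w (m + m') \<omega>" and ?Q = "\<lambda>\<omega>. Z a \<omega> - rsum j X u m \<omega>"
        let ?R = "\<lambda>\<omega>. rsum j X v m' \<omega> - rsum j X ?e 1 \<omega>"
        have b0: "0 \<le> b" using ab by simp
        have aT: "a \<le> T" using ab by simp
        have sP: "sqint M ?P" using Zs[OF b0] rsum_sqint[OF X order.refl w w j] by (rule sqint_diff)
        have sQ: "sqint M ?Q" using Zs[OF ab(1)] rsum_sqint[OF X order.refl u u j] by (rule sqint_diff)
        have sR: "sqint M ?R" using rsum_sqint[OF X ab(1) v v j] rsum_sqint[OF X ab(1) e e j] by (rule sqint_diff)
        have "msq M (\<lambda>\<omega>. Z b \<omega> - Z a \<omega> - X a \<omega> * (W j b \<omega> - W j a \<omega>)) = msq M (\<lambda>\<omega>. (?P \<omega> - ?Q \<omega>) + ?R \<omega>)"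
          unfolding rsum_append[of u m v, OF uv] re by (simp add: algebra_simps)
        also have "\<dots> \<le> 2 * msq M (\<lambda>\<omega>. ?P \<omega> - ?Q \<omega>) + 2 * msq M ?R"
          by (intro msq_add_le sqint_diff[OF sP sQ] sR)
        also have "\<dots> \<le> 2 * (2 * (K' * h) + 2 * (K' * h)) + 2 * (K * (b - a) * (b - a))"
        proof -
          have gen: "2 * x + 2 * r \<le> 2 * (2 * y + 2 * y) + 2 * z"
            if "x \<le> 2 * p + 2 * q" "p \<le> y" "q \<le> y" "r \<le> z" for x p q r y z :: real
            using that by argo
          have "msq M ?P \<le> K' * h" using K'(2)[OF b0 ab(3) h(1) w] .
          moreover have "msq M ?Q \<le> K' * h" using K'(2)[OF ab(1) aT h(1) u] .
          moreover have "msq M ?R \<le> K * (b - a) * (b - a)"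
            using K(2)[OF ab _ v' e] ab(2) by simp
          ultimately show ?thesis by (rule gen[OF msq_diff_le[OF sP sQ]])
        qed
        also have "\<dots> \<le> 2 * (2 * (K' * (b - a)\<^sup>2) + 2 * (K' * (b - a)\<^sup>2)) + 2 * (K * (b - a) * (b - a))"
          using h(2) K'(1) by (intro add_mono mult_left_mono order.refl) auto
        also have "\<dots> = (8 * K' + 2 * K) * (b - a)\<^sup>2" by (simp add: power2_eq_square algebra_simps)
        finally show ?thesis by simp
      qed
    qed
  qed
  \<comment> \<open>Regularity follows from the expansion: the leading term has mean square of order
    \<open>b - a\<close>, and the factor \<open>1 + \<bar>T\<bar>\<close> covers both time and
    noise.\<close>
  have "\<exists>L\<ge>0. \<forall>a b. 0 \<le> a \<longrightarrow> a \<le> b \<longrightarrow> b \<le> T \<longrightarrow> msq M (\<lambda>\<omega>. Z b \<omega> - Z a \<omega>) \<le> L * (b - a)" for T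
  proof -
    obtain K where K: "0 \<le> K" "\<And>a b. 0 \<le> a \<Longrightarrow> a \<le> b \<Longrightarrow> b \<le> T \<Longrightarrow>
        msq M (\<lambda>\<omega>. Z b \<omega> - Z a \<omega> - X a \<omega> * (W j b \<omega> - W j a \<omega>)) \<le> K * (b - a)\<^sup>2"
      using expansion[of T] by blast
    obtain C where C: "0 \<le> C" "\<And>t. 0 \<le> t \<Longrightarrow> t \<le> T \<Longrightarrow> msq M (X t) \<le> C"
      using regular_bounded[OF X] by blast
    show ?thesis
    proof (intro exI[of _ "2 * (K * \<bar>T\<bar>) + 2 * (C * (1 + \<bar>T\<bar>))"] conjI allI impI)
      show "0 \<le> 2 * (K * \<bar>T\<bar>) + 2 * (C * (1 + \<bar>T\<bar>))" using K C by simp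
      fix a b assume ab: "0 \<le> a" "a \<le> b" "b \<le> T"
      let ?D = "\<lambda>\<omega>. X a \<omega> * (W j b \<omega> - W j a \<omega>)"
      have sD: "sqint M ?D" and mD: "msq M ?D = msq M (X a) * (if j = 0 then (b - a)\<^sup>2 else b - a)"
        using sqint_past_times_increment[OF j ab(1,2) regular_past[OF X ab(1)] regular_sqint[OF X ab(1)]] by auto
      have sq: "(b - a)\<^sup>2 \<le> \<bar>T\<bar> * (b - a)"
        unfolding power2_eq_square using ab by (intro mult_right_mono) auto
      have "msq M ?D \<le> C * ((1 + \<bar>T\<bar>) * (b - a))"
      proof -
        have "(if j = 0 then (b - a)\<^sup>2 else b - a) \<le> (1 + \<bar>T\<bar>) * (b - a)"
        proof -
          have "0 \<le> \<bar>T\<bar> * (b - a)" using ab by simp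
          then show ?thesis using sq ab unfolding distrib_right by auto
        qed
        moreover have "msq M (X a) \<le> C" using C ab by auto
        ultimately show ?thesis unfolding mD using ab C by (intro mult_mono) auto
      qed
      moreover have "K * (b - a)\<^sup>2 \<le> K * (\<bar>T\<bar> * (b - a))" using sq K by (intro mult_left_mono)
      moreover have "msq M (\<lambda>\<omega>. (Z b \<omega> - Z a \<omega> - ?D \<omega>) + ?D \<omega>)
          \<le> 2 * msq M (\<lambda>\<omega>. Z b \<omega> - Z a \<omega> - ?D \<omega>) + 2 * msq M ?D"
        using ab by (intro msq_add_le sqint_diff Zs sD) auto
      ultimately show "msq M (\<lambda>\<omega>. Z b \<omega> - Z a \<omega>) \<le> (2 * (K * \<bar>T\<bar>) + 2 * (C * (1 + \<bar>T\<bar>))) * (b - a)"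
        using K(2)[OF ab] by (simp add: algebra_simps)
    qed
  qed
  then have "regular Z" unfolding regular_def using Zp Zs by blast
  then show ?thesis using approx expansion unfolding is_integral_def by blast
qed

section \<open>Convergence of grid sums and of their means\<close>

lemma is_integral_grid_limit:
  assumes j: "j < n" and X: "regular X" and Z: "is_integral j X Z" and t: "0 \<le> t"
  shows "(\<lambda>N. msq M (\<lambda>\<omega>. rsum j X (grid t N) (Suc N) \<omega> - Z t \<omega>)) \<longlonglongrightarrow> 0"
proof -
  obtain K where K: "0 \<le> K" "\<And>u h s m. 0 \<le> u \<Longrightarrow> u \<le> t \<Longrightarrow> 0 < h \<Longrightarrow> is_partition 0 u h s m \<Longrightarrow>
        msq M (\<lambda>\<omega>. Z u \<omega> - rsum j X s m \<omega>) \<le> K * h"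
    using is_integral_approx[OF Z] by blast
  have le: "msq M (\<lambda>\<omega>. rsum j X (grid t N) (Suc N) \<omega> - Z t \<omega>) \<le> K * (t + 1) * inverse (real (Suc N))" for N
  proof -
    \<comment> \<open>\<open>t + 1\<close> in place of \<open>t\<close> keeps the mesh bound
      positive at \<open>t = 0\<close>.\<close>
    have "is_partition 0 t ((t + 1) / real (Suc N)) (grid t N) (Suc N)"
      using partition_grid[OF t] by (rule partition_weaken) (simp add: divide_right_mono)
    from K(2)[OF t order.refl _ this]
    have "msq M (\<lambda>\<omega>. Z t \<omega> - rsum j X (grid t N) (Suc N) \<omega>) \<le> K * ((t + 1) / real (Suc N))"
      using t by simp
    then show ?thesis by (simp add: msq_def power2_commute divide_inverse mult.assoc)
  qed
  have lim: "(\<lambda>N. K * (t + 1) * inverse (real (Suc N))) \<longlonglongrightarrow> 0"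
    using tendsto_mult[OF tendsto_const LIMSEQ_inverse_real_of_nat, of "K * (t + 1)"] by simp
  show ?thesis
    by (rule tendsto_sandwich[OF _ _ tendsto_const lim]) (use le msq_nonneg in \<open>auto intro!: always_eventually\<close>)
qed

lemma grid_rsum_sqint:
  assumes "j < n" "regular X" "0 \<le> t" shows "sqint M (rsum j X (grid t N) (Suc N))"
  using rsum_sqint[OF assms(2) order.refl partition_grid[OF assms(3)] partition_grid[OF assms(3)] assms(1)] .

text \<open>Mean-square convergence carries means to the limit, which convergence in probability
  alone does not.\<close>

lemma is_integral_expectation_limit:
  assumes j: "j < n" and X: "regular X" and Z: "is_integral j X Z" and t: "0 \<le> t"
  shows "(\<lambda>N. expectation (rsum j X (grid t N) (Suc N))) \<longlonglongrightarrow> expectation (Z t)"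
proof -
  let ?S = "\<lambda>N. rsum j X (grid t N) (Suc N)"
  have S: "sqint M (?S N)" for N using grid_rsum_sqint[OF j X t] .
  have Zt: "sqint M (Z t)" using is_integral_regular[OF Z] t by (rule regular_sqint)
  have le: "norm (expectation (?S N) - expectation (Z t)) \<le> sqrt (msq M (\<lambda>\<omega>. ?S N \<omega> - Z t \<omega>))" for N
  proof -
    have "(expectation (?S N) - expectation (Z t))\<^sup>2 \<le> msq M (\<lambda>\<omega>. ?S N \<omega> - Z t \<omega>)"
      using expectation_sq_le_msq[OF sqint_diff[OF S Zt]] sqint_integrable[OF S] sqint_integrable[OF Zt] by simp
    then show ?thesis by (simp add: real_le_rsqrt)
  qed
  have lim: "(\<lambda>N. sqrt (msq M (\<lambda>\<omega>. ?S N \<omega> - Z t \<omega>))) \<longlonglongrightarrow> 0"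
    using tendsto_real_sqrt[OF is_integral_grid_limit[OF j X Z t]] by simp
  have "(\<lambda>N. expectation (?S N) - expectation (Z t)) \<longlonglongrightarrow> 0"
    by (rule Lim_null_comparison[OF always_eventually lim]) (rule allI, rule le)
  then show ?thesis by (rule LIM_zero_cancel)
qed

lemma is_integral_expectation_noise:
  assumes j: "j \<in> {1..<n}" and X: "regular X" and Z: "is_integral j X Z" and t: "0 \<le> t"
  shows "expectation (Z t) = 0"
proof -
  have g: "0 \<le> grid t N k" "grid t N k \<le> grid t N (Suc k)" for N k
    using t by (auto simp: grid_def divide_right_mono mult_right_mono)
  have "expectation (rsum j X (grid t N) (Suc N)) = 0" for N
  proof -
    have e: "integrable M (\<lambda>\<omega>. X (grid t N k) \<omega> * (W j (grid t N (Suc k)) \<omega> - W j (grid t N k) \<omega>))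
      \<and> expectation (\<lambda>\<omega>. X (grid t N k) \<omega> * (W j (grid t N (Suc k)) \<omega> - W j (grid t N k) \<omega>)) = 0" for k
      using past_times_noise(1,2)[OF j g regular_past[OF X g(1)] sqint_integrable[OF regular_sqint[OF X g(1)]]] by simp
    show ?thesis unfolding rsum_def[abs_def]
      using e by (simp add: Bochner_Integration.integral_sum del: sum.lessThan_Suc)
  qed
  then have "(\<lambda>N. 0) \<longlonglongrightarrow> expectation (Z t)"
    using is_integral_expectation_limit[OF _ X Z t] j by simp
  then show ?thesis using LIMSEQ_unique tendsto_const by blast
qed

text \<open>The mean of a time sum is the Riemann sum of the means, here of a scaled monomial. With
  the factorial normalisation, time integration is a shift of \<open>q\<close> that leaves
  \<open>c\<close> unchanged.\<close>

lemma is_integral_expectation_time: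
  assumes X: "regular X" and Z: "is_integral 0 X Z" and t: "0 \<le> t" and n: "0 < n"
    and EX: "\<And>u. 0 \<le> u \<Longrightarrow> expectation (X u) = c * (u ^ q / fact q)"
  shows "expectation (Z t) = c * (t ^ Suc q / fact (Suc q))"
proof -
  let ?S = "\<lambda>N. \<Sum>k<Suc N. grid t N k ^ q / fact q * (grid t N (Suc k) - grid t N k)"
  have g: "0 \<le> grid t N k" for N k using t by (simp add: grid_def)
  have "expectation (rsum 0 X (grid t N) (Suc N)) = c * ?S N" for N
  proof -
    have "expectation (rsum 0 X (grid t N) (Suc N))
        = (\<Sum>k<Suc N. expectation (\<lambda>\<omega>. X (grid t N k) \<omega> * (grid t N (Suc k) - grid t N k)))"
      unfolding rsum_def[abs_def] W_time
      by (rule Bochner_Integration.integral_sum) (use sqint_integrable[OF regular_sqint[OF X g]] in auto)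
    then show ?thesis by (simp add: EX[OF g] sum_distrib_left mult.assoc del: sum.lessThan_Suc)
  qed
  then have 1: "(\<lambda>N. c * ?S N) \<longlonglongrightarrow> expectation (Z t)"
    using is_integral_expectation_limit[OF n X Z t] by simp
  have le: "norm (?S N - t ^ Suc q / fact (Suc q)) \<le> (t * (t ^ q / fact q - 0 ^ q / fact q)) * inverse (real (Suc N))" for N
    using Riemann_sum_monomial[OF partition_grid[OF t, of N], of q]
    by (simp add: divide_inverse mult_ac)
  have lim: "(\<lambda>N. (t * (t ^ q / fact q - 0 ^ q / fact q)) * inverse (real (Suc N))) \<longlonglongrightarrow> 0"
    using tendsto_mult[OF tendsto_const LIMSEQ_inverse_real_of_nat] by simp
  have "(\<lambda>N. ?S N - t ^ Suc q / fact (Suc q)) \<longlonglongrightarrow> 0"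
    by (rule Lim_null_comparison[OF always_eventually lim]) (rule allI, rule le)
  then have "?S \<longlonglongrightarrow> t ^ Suc q / fact (Suc q)" by (rule LIM_zero_cancel)
  from LIMSEQ_unique[OF 1 tendsto_mult[OF tendsto_const this]] show ?thesis .
qed

lemma is_integral_conv_in_prob:
  assumes j: "j < n" and X: "regular X" and Z: "is_integral j X Z" and t: "0 \<le> t"
  shows "conv_in_prob M (\<lambda>N. rsum j X (grid t N) (Suc N)) (Z t)"
  using is_integral_grid_limit[OF assms] grid_rsum_sqint[OF j X t] regular_sqint[OF is_integral_regular[OF Z] t]
  by (intro conv_in_prob_L2)

end

section \<open>Covariation\<close>

text \<open>The Kronecker delta, as the rate of covariation of two noise drivers. Index 0 has to be
  treated apart: time has no quadratic variation, although \<open>cov 0 0 = 1\<close>.\<close>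

definition cov :: "nat \<Rightarrow> nat \<Rightarrow> real" where
  "cov i j = (if i = j then 1 else 0)"

context wiener
begin

text \<open>Agreement holds at each time outside a null set that may depend on the time; the choice
  of the integrals at each time separately gives no more.\<close>

definition version :: "(real \<Rightarrow> 'a \<Rightarrow> real) \<Rightarrow> (real \<Rightarrow> 'a \<Rightarrow> real) \<Rightarrow> bool" where
  "version P X \<longleftrightarrow> (\<forall>t\<ge>0. P t \<in> borel_measurable M \<and> (AE \<omega> in M. P t \<omega> = X t \<omega>))"

lemma regular_const: "regular (\<lambda>_ _. c)"
  unfolding regular_def by (auto simp: msq_def intro!: exI[of _ 0])

lemma regular_add_cmult:
  assumes X: "regular X" and Y: "regular Y"
  shows "regular (\<lambda>t \<omega>. X t \<omega> + c * Y t \<omega>)"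
  unfolding regular_def
proof (intro conjI allI impI)
  fix t :: real assume t: "0 \<le> t"
  show "(\<lambda>\<omega>. X t \<omega> + c * Y t \<omega>) \<in> borel_measurable (past t)"
    using regular_past[OF X t] regular_past[OF Y t] by simp
  show "sqint M (\<lambda>\<omega>. X t \<omega> + c * Y t \<omega>)"
    using regular_sqint[OF X t] regular_sqint[OF Y t] by (intro sqint_add sqint_cmult)
next
  fix T
  obtain L where L: "0 \<le> L" "\<And>a b. 0 \<le> a \<Longrightarrow> a \<le> b \<Longrightarrow> b \<le> T \<Longrightarrow> msq M (\<lambda>\<omega>. X b \<omega> - X a \<omega>) \<le> L * (b - a)"
    using regular_Lipschitz[OF X] by blast
  obtain L' where L': "0 \<le> L'" "\<And>a b. 0 \<le> a \<Longrightarrow> a \<le> b \<Longrightarrow> b \<le> T \<Longrightarrow> msq M (\<lambda>\<omega>. Y b \<omega> - Y a \<omega>) \<le> L' * (b - a)"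
    using regular_Lipschitz[OF Y] by blast
  show "\<exists>L\<ge>0. \<forall>a b. 0 \<le> a \<longrightarrow> a \<le> b \<longrightarrow> b \<le> T \<longrightarrow>
     msq M (\<lambda>\<omega>. X b \<omega> + c * Y b \<omega> - (X a \<omega> + c * Y a \<omega>)) \<le> L * (b - a)"
  proof (intro exI[of _ "2 * L + 2 * (c\<^sup>2 * L')"] conjI allI impI)
    show "0 \<le> 2 * L + 2 * (c\<^sup>2 * L')" using L L' by simp
    fix a b assume ab: "0 \<le> a" "a \<le> b" "b \<le> T"
    have "msq M (\<lambda>\<omega>. X b \<omega> + c * Y b \<omega> - (X a \<omega> + c * Y a \<omega>))
        = msq M (\<lambda>\<omega>. (X b \<omega> - X a \<omega>) + c * (Y b \<omega> - Y a \<omega>))"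
      by (simp add: algebra_simps)
    also have "\<dots> \<le> 2 * msq M (\<lambda>\<omega>. X b \<omega> - X a \<omega>) + 2 * msq M (\<lambda>\<omega>. c * (Y b \<omega> - Y a \<omega>))"
      using ab by (intro msq_add_le sqint_cmult sqint_diff regular_sqint[OF X] regular_sqint[OF Y]) auto
    also have "\<dots> \<le> 2 * (L * (b - a)) + 2 * (c\<^sup>2 * (L' * (b - a)))"
      unfolding msq_cmult using L(2)[OF ab] L'(2)[OF ab] by (intro add_mono mult_left_mono) auto
    also have "\<dots> = (2 * L + 2 * (c\<^sup>2 * L')) * (b - a)" by (simp add: algebra_simps)
    finally show "msq M (\<lambda>\<omega>. X b \<omega> + c * Y b \<omega> - (X a \<omega> + c * Y a \<omega>)) \<le> (2 * L + 2 * (c\<^sup>2 * L')) * (b - a)" .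
  qed
qed

text \<open>\<open>X\<close> moves like \<open>Y dW\<^sup>i\<close> up to an error of order \<open>dt\<close>; this determines its covariation with every
  driver, and \<open>Y = 0\<close> covers processes of finite variation.\<close>

definition expands :: "(real \<Rightarrow> 'a \<Rightarrow> real) \<Rightarrow> nat \<Rightarrow> (real \<Rightarrow> 'a \<Rightarrow> real) \<Rightarrow> bool" where
  "expands X i Y \<longleftrightarrow> (\<forall>T. \<exists>K\<ge>0. \<forall>a b. 0 \<le> a \<longrightarrow> a \<le> b \<longrightarrow> b \<le> T \<longrightarrow>
        msq M (\<lambda>\<omega>. X b \<omega> - X a \<omega> - Y a \<omega> * (W i b \<omega> - W i a \<omega>)) \<le> K * (b - a)\<^sup>2)"

lemma is_integral_expands: "is_integral j X Z \<Longrightarrow> expands Z j X"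
  by (simp add: is_integral_def expands_def)

lemma expandsE:
  assumes "expands X i Y"
  obtains K where "0 \<le> K" "\<And>a b. 0 \<le> a \<Longrightarrow> a \<le> b \<Longrightarrow> b \<le> T \<Longrightarrow>
        msq M (\<lambda>\<omega>. X b \<omega> - X a \<omega> - Y a \<omega> * (W i b \<omega> - W i a \<omega>)) \<le> K * (b - a)\<^sup>2"
  using assms unfolding expands_def by blast

lemma expands_const: "expands (\<lambda>_ _. c) i (\<lambda>_ _. 0)"
  unfolding expands_def by (auto simp: msq_def)

text \<open>The increment of a time integral has mean square of order
  \<open>(b - a)\<^sup>2\<close>, so it is swallowed by the error term, whatever the driver
  \<open>i\<close>.\<close>

lemma time_integral_expands:
  assumes n: "0 < n" and Y: "regular Y" and V: "is_integral 0 Y V"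
  shows "expands V i (\<lambda>_ _. 0)"
  unfolding expands_def
proof
  fix T
  obtain K where K: "0 \<le> K" "\<And>a b. 0 \<le> a \<Longrightarrow> a \<le> b \<Longrightarrow> b \<le> T \<Longrightarrow>
        msq M (\<lambda>\<omega>. V b \<omega> - V a \<omega> - Y a \<omega> * (W 0 b \<omega> - W 0 a \<omega>)) \<le> K * (b - a)\<^sup>2"
    using expandsE[OF is_integral_expands[OF V]] by blast
  obtain C where C: "0 \<le> C" "\<And>t. 0 \<le> t \<Longrightarrow> t \<le> T \<Longrightarrow> msq M (Y t) \<le> C"
    using regular_bounded[OF Y] by blast
  show "\<exists>K\<ge>0. \<forall>a b. 0 \<le> a \<longrightarrow> a \<le> b \<longrightarrow> b \<le> T \<longrightarrow>
     msq M (\<lambda>\<omega>. V b \<omega> - V a \<omega> - 0 * (W i b \<omega> - W i a \<omega>)) \<le> K * (b - a)\<^sup>2"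
  proof (intro exI[of _ "2 * K + 2 * C"] conjI allI impI)
    show "0 \<le> 2 * K + 2 * C" using K C by simp
    fix a b assume ab: "0 \<le> a" "a \<le> b" "b \<le> T"
    let ?D = "\<lambda>\<omega>. Y a \<omega> * (W 0 b \<omega> - W 0 a \<omega>)"
    have D: "sqint M ?D" "msq M ?D = msq M (Y a) * (b - a)\<^sup>2"
      using sqint_past_times_increment[OF n ab(1,2) regular_past[OF Y ab(1)] regular_sqint[OF Y ab(1)]] by auto
    have "msq M (\<lambda>\<omega>. (V b \<omega> - V a \<omega> - ?D \<omega>) + ?D \<omega>) \<le> 2 * msq M (\<lambda>\<omega>. V b \<omega> - V a \<omega> - ?D \<omega>) + 2 * msq M ?D"
      using ab is_integral_regular[OF V] by (intro msq_add_le sqint_diff D(1) regular_sqint) auto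
    also have "\<dots> \<le> 2 * (K * (b - a)\<^sup>2) + 2 * (C * (b - a)\<^sup>2)"
      using K(2)[OF ab] C(2)[of a] ab unfolding D(2) by (intro add_mono mult_left_mono mult_right_mono) auto
    finally show "msq M (\<lambda>\<omega>. V b \<omega> - V a \<omega> - 0 * (W i b \<omega> - W i a \<omega>)) \<le> (2 * K + 2 * C) * (b - a)\<^sup>2"
      by (simp add: algebra_simps)
  qed
qed

lemma expands_add_cmult:
  assumes i: "i < n" and reg: "regular X" "regular Y" "regular V"
    and X: "expands X i Y" and V: "expands V i (\<lambda>_ _. 0)"
  shows "expands (\<lambda>t \<omega>. X t \<omega> + c * V t \<omega>) i Y"
  unfolding expands_def
proof
  fix T
  obtain K where K: "0 \<le> K" "\<And>a b. 0 \<le> a \<Longrightarrow> a \<le> b \<Longrightarrow> b \<le> T \<Longrightarrow>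
        msq M (\<lambda>\<omega>. X b \<omega> - X a \<omega> - Y a \<omega> * (W i b \<omega> - W i a \<omega>)) \<le> K * (b - a)\<^sup>2"
    using expandsE[OF X] by blast
  obtain C where C: "0 \<le> C" "\<And>a b. 0 \<le> a \<Longrightarrow> a \<le> b \<Longrightarrow> b \<le> T \<Longrightarrow>
        msq M (\<lambda>\<omega>. V b \<omega> - V a \<omega> - 0 * (W i b \<omega> - W i a \<omega>)) \<le> C * (b - a)\<^sup>2"
    using expandsE[OF V] by blast
  show "\<exists>K\<ge>0. \<forall>a b. 0 \<le> a \<longrightarrow> a \<le> b \<longrightarrow> b \<le> T \<longrightarrow>
     msq M (\<lambda>\<omega>. X b \<omega> + c * V b \<omega> - (X a \<omega> + c * V a \<omega>) - Y a \<omega> * (W i b \<omega> - W i a \<omega>)) \<le> K * (b - a)\<^sup>2"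
  proof (intro exI[of _ "2 * K + 2 * (c\<^sup>2 * C)"] conjI allI impI)
    show "0 \<le> 2 * K + 2 * (c\<^sup>2 * C)" using K C by simp
    fix a b assume ab: "0 \<le> a" "a \<le> b" "b \<le> T"
    let ?D = "\<lambda>\<omega>. Y a \<omega> * (W i b \<omega> - W i a \<omega>)"
    have D: "sqint M ?D"
      using sqint_past_times_increment[OF i ab(1,2) regular_past[OF reg(2) ab(1)] regular_sqint[OF reg(2) ab(1)]] by auto
    have "msq M (\<lambda>\<omega>. X b \<omega> + c * V b \<omega> - (X a \<omega> + c * V a \<omega>) - ?D \<omega>)
       = msq M (\<lambda>\<omega>. (X b \<omega> - X a \<omega> - ?D \<omega>) + c * (V b \<omega> - V a \<omega>))"
      by (simp add: algebra_simps)
    also have "\<dots> \<le> 2 * msq M (\<lambda>\<omega>. X b \<omega> - X a \<omega> - ?D \<omega>) + 2 * msq M (\<lambda>\<omega>. c * (V b \<omega> - V a \<omega>))"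
      using ab by (intro msq_add_le sqint_diff sqint_cmult D(1) regular_sqint[OF reg(1)] regular_sqint[OF reg(3)]) auto
    also have "\<dots> \<le> 2 * (K * (b - a)\<^sup>2) + 2 * (c\<^sup>2 * (C * (b - a)\<^sup>2))"
      unfolding msq_cmult using K(2)[OF ab] C(2)[OF ab] by (intro add_mono mult_left_mono) auto
    finally show "msq M (\<lambda>\<omega>. X b \<omega> + c * V b \<omega> - (X a \<omega> + c * V a \<omega>) - ?D \<omega>) \<le> (2 * K + 2 * (c\<^sup>2 * C)) * (b - a)\<^sup>2"
      by (simp add: algebra_simps)
  qed
qed

lemma sqint_increment:
  assumes "j \<in> {1..<n}" "0 \<le> a" "a \<le> b"
  shows "sqint M (\<lambda>\<omega>. W j b \<omega> - W j a \<omega>)" "msq M (\<lambda>\<omega>. W j b \<omega> - W j a \<omega>) = b - a"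
  using increment_moments[OF assms] assms(1) by (auto simp: sqint_def msq_def)

text \<open>The product is square integrable because \<open>(x * y)\<^sup>2\<close> is at most half
  of \<open>x ^ 4 + y ^ 4\<close>, and the fourth moments are \<open>3 * (b - a)\<^sup>2\<close>.
  The constant 8 arises as 2 * 3 + 2 * 1 from \<open>msq_diff_le\<close>.\<close>

lemma quadratic_noise:
  assumes ij: "i \<in> {1..<n}" "j \<in> {1..<n}" and ab: "0 \<le> a" "a \<le> b"
  shows "sqint M (\<lambda>\<omega>. (W i b \<omega> - W i a \<omega>) * (W j b \<omega> - W j a \<omega>) - cov i j * (b - a))"
    and "expectation (\<lambda>\<omega>. (W i b \<omega> - W i a \<omega>) * (W j b \<omega> - W j a \<omega>) - cov i j * (b - a)) = 0"
    and "msq M (\<lambda>\<omega>. (W i b \<omega> - W i a \<omega>) * (W j b \<omega> - W j a \<omega>) - cov i j * (b - a)) \<le> 8 * (b - a)\<^sup>2"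
proof -
  let ?x = "\<lambda>\<omega>. W i b \<omega> - W i a \<omega>" and ?y = "\<lambda>\<omega>. W j b \<omega> - W j a \<omega>"
  note mi = increment_moments[OF ij(1) ab] and mj = increment_moments[OF ij(2) ab]
  have [measurable]: "?x \<in> borel_measurable M" "?y \<in> borel_measurable M" using ij by auto
  have le4: "(x * y)\<^sup>2 \<le> (x ^ 4 + y ^ 4) / 2" for x y :: real
    using sum_squares_bound[of "x\<^sup>2" "y\<^sup>2"] by (simp add: power_mult_distrib)
  have i4: "integrable M (\<lambda>\<omega>. ((?x \<omega>) ^ 4 + (?y \<omega>) ^ 4) / 2)" using mi mj by simp
  have I: "integrable M (\<lambda>\<omega>. (?x \<omega> * ?y \<omega>)\<^sup>2)"
    by (rule Bochner_Integration.integrable_bound[OF i4]) (use le4 in \<open>auto intro!: AE_I2\<close>)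
  then have xy: "sqint M (\<lambda>\<omega>. ?x \<omega> * ?y \<omega>)" by (simp add: sqint_def)
  show s: "sqint M (\<lambda>\<omega>. ?x \<omega> * ?y \<omega> - cov i j * (b - a))" using xy by (intro sqint_diff) auto
  have "expectation (\<lambda>\<omega>. ?x \<omega> * ?y \<omega>) = cov i j * (b - a)"
  proof (cases "i = j")
    case True
    then show ?thesis using mi by (simp add: cov_def power2_eq_square)
  next
    case False
    then show ?thesis using increment_cross_moment[OF ij False ab] by (simp add: cov_def)
  qed
  then show "expectation (\<lambda>\<omega>. ?x \<omega> * ?y \<omega> - cov i j * (b - a)) = 0"
    using sqint_integrable[OF xy] by (simp add: prob_space)
  have "msq M (\<lambda>\<omega>. ?x \<omega> * ?y \<omega>) \<le> 3 * (b - a)\<^sup>2"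
  proof -
    have "msq M (\<lambda>\<omega>. ?x \<omega> * ?y \<omega>) \<le> expectation (\<lambda>\<omega>. ((?x \<omega>) ^ 4 + (?y \<omega>) ^ 4) / 2)"
      unfolding msq_def using I i4 le4 by (rule integral_mono)
    also have "\<dots> = 3 * (b - a)\<^sup>2" using mi mj by simp
    finally show ?thesis .
  qed
  moreover have "msq M (\<lambda>\<omega>. cov i j * (b - a)) \<le> (b - a)\<^sup>2"
    by (simp add: msq_def cov_def prob_space)
  ultimately show "msq M (\<lambda>\<omega>. ?x \<omega> * ?y \<omega> - cov i j * (b - a)) \<le> 8 * (b - a)\<^sup>2"
    using msq_diff_le[OF xy sqint_const, of "cov i j * (b - a)"] by linarith
qed

text \<open>A discrete martingale argument: each new term is a past factor times a centred variable
  independent of the past, hence orthogonal to the sum so far. Measurability for the past is part of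
  the induction because the next step relies on it. With steps of order h, the sum of the squared
  steps is of order h.\<close>

lemma quadratic_noise_sum:
  assumes ij: "i \<in> {1..<n}" "j \<in> {1..<n}" and Y: "regular Y"
    and s: "\<And>k. 0 \<le> s k" "\<And>k. s k \<le> s (Suc k)"
  defines "\<xi> \<equiv> \<lambda>k \<omega>. (W i (s (Suc k)) \<omega> - W i (s k) \<omega>) * (W j (s (Suc k)) \<omega> - W j (s k) \<omega>) - cov i j * (s (Suc k) - s k)"
  shows "(\<lambda>\<omega>. \<Sum>k<m. Y (s k) \<omega> * \<xi> k \<omega>) \<in> borel_measurable (past (s m)) \<and>
    sqint M (\<lambda>\<omega>. \<Sum>k<m. Y (s k) \<omega> * \<xi> k \<omega>) \<and>
    msq M (\<lambda>\<omega>. \<Sum>k<m. Y (s k) \<omega> * \<xi> k \<omega>) \<le> (\<Sum>k<m. msq M (Y (s k)) * (8 * (s (Suc k) - s k)\<^sup>2))"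
proof (induction m)
  case 0
  then show ?case by (simp add: msq_def)
next
  case (Suc m)
  let ?A = "\<lambda>\<omega>. \<Sum>k<m. Y (s k) \<omega> * \<xi> k \<omega>" and ?B = "\<lambda>\<omega>. Y (s m) \<omega> * \<xi> m \<omega>"
  let ?c = "cov i j * (s (Suc m) - s m)"
  have A: "?A \<in> borel_measurable (past (s m))" "sqint M ?A"
    "msq M ?A \<le> (\<Sum>k<m. msq M (Y (s k)) * (8 * (s (Suc k) - s k)\<^sup>2))" using Suc by auto
  note Yp = regular_past[OF Y s(1)[of m]] and Ys = regular_sqint[OF Y s(1)[of m]]
  note q = quadratic_noise[OF ij s(1)[of m] s(2)[of m], folded \<xi>_def]
  have \<xi>m: "\<xi> m = (\<lambda>\<omega>. (W i (s (Suc m)) \<omega> - W i (s m) \<omega>) * (W j (s (Suc m)) \<omega> - W j (s m) \<omega>) - ?c)"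
    by (simp add: \<xi>_def)
  have G1: "case_prod (\<lambda>u v. u * v - ?c) \<in> borel_measurable (borel \<Otimes>\<^sub>M borel)"
    and G2: "case_prod (\<lambda>u v. (u * v - ?c)\<^sup>2) \<in> borel_measurable (borel \<Otimes>\<^sub>M borel)"
    by measurable
  have \<xi>i: "integrable M (\<xi> m)" "integrable M (\<lambda>\<omega>. (\<xi> m \<omega>)\<^sup>2)"
    using q(1) sqint_integrable[OF q(1)] unfolding \<xi>m by (auto simp: sqint_def)
  have Y2: "(\<lambda>\<omega>. (Y (s m) \<omega>)\<^sup>2) \<in> borel_measurable (past (s m))" "integrable M (\<lambda>\<omega>. (Y (s m) \<omega>)\<^sup>2)"
    using Yp Ys by (auto simp: sqint_def)
  have AY: "(\<lambda>\<omega>. ?A \<omega> * Y (s m) \<omega>) \<in> borel_measurable (past (s m))" "integrable M (\<lambda>\<omega>. ?A \<omega> * Y (s m) \<omega>)"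
    using A Yp Ys by (auto intro!: sqint_integrable_mult borel_measurable_times)
  have B2: "integrable M (\<lambda>\<omega>. (Y (s m) \<omega>)\<^sup>2 * (\<xi> m \<omega>)\<^sup>2)"
    "expectation (\<lambda>\<omega>. (Y (s m) \<omega>)\<^sup>2 * (\<xi> m \<omega>)\<^sup>2) = msq M (Y (s m)) * msq M (\<xi> m)"
    using expectation_past_times_increment[OF s(1) s(2) Y2 ij G2] \<xi>i(2) unfolding \<xi>m msq_def by auto
  \<comment> \<open>The partial sum times \<open>Y (s m)\<close> is known at time
    \<open>s m\<close>, while \<open>\<xi> m\<close> is centred and depends on later increments
    only.\<close>
  have cross: "expectation (\<lambda>\<omega>. ?A \<omega> * Y (s m) \<omega> * \<xi> m \<omega>) = 0"
    using expectation_past_times_increment(2)[OF s(1) s(2) AY ij G1] \<xi>i(1) q(2) unfolding \<xi>m by simp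
  have \<xi>past: "\<xi> m \<in> borel_measurable (past (s (Suc m)))"
    unfolding \<xi>m using ij s by (intro borel_measurable_diff borel_measurable_times W_past_measurable) auto
  have "Y (s m) \<in> borel_measurable (past (s (Suc m)))" using past_measurable_mono[OF s(2) Yp] .
  then have 1: "(\<lambda>\<omega>. ?A \<omega> + ?B \<omega>) \<in> borel_measurable (past (s (Suc m)))"
    using past_measurable_mono[OF s(2) A(1)] \<xi>past by simp
  have B: "sqint M ?B"
    using B2(1) Ys \<xi>i(1) by (auto simp: sqint_def power_mult_distrib)
  have "msq M (\<lambda>\<omega>. ?A \<omega> + ?B \<omega>) = expectation (\<lambda>\<omega>. (?A \<omega>)\<^sup>2 + 2 * (?A \<omega> * Y (s m) \<omega> * \<xi> m \<omega>) + (?B \<omega>)\<^sup>2)"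
    unfolding msq_def by (intro Bochner_Integration.integral_cong) (auto simp: power2_sum algebra_simps)
  also have "\<dots> = msq M ?A + 2 * 0 + msq M ?B"
  proof -
    have "integrable M (\<lambda>\<omega>. ?A \<omega> * Y (s m) \<omega> * \<xi> m \<omega>)"
      using sqint_integrable_mult[OF A(2) B] by (simp add: mult.assoc)
    then show ?thesis using A(2) B cross by (simp add: sqint_def msq_def)
  qed
  also have "msq M ?B = msq M (Y (s m)) * msq M (\<xi> m)"
    using B2(2) by (simp add: msq_def power_mult_distrib)
  also have "msq M ?A + 2 * 0 + msq M (Y (s m)) * msq M (\<xi> m)
     \<le> (\<Sum>k<m. msq M (Y (s k)) * (8 * (s (Suc k) - s k)\<^sup>2)) + msq M (Y (s m)) * (8 * (s (Suc m) - s m)\<^sup>2)"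
    using A(3) q(3) unfolding \<xi>m by (intro add_mono mult_left_mono msq_nonneg) auto
  finally show ?case using 1 sqint_add[OF A(2) B] by simp
qed

end

lemma mesh_tendsto_zero: "(\<lambda>N. c / real (Suc N)) \<longlonglongrightarrow> 0"
  using tendsto_mult[OF tendsto_const[of c] LIMSEQ_inverse_real_of_nat] by (simp add: divide_inverse)

lemma grid_nonneg: "0 \<le> t \<Longrightarrow> 0 \<le> grid t N k"
  by (simp add: grid_def)

lemma grid_step: "grid t N (Suc k) - grid t N k = t / real (Suc N)"
  by (simp add: grid_def diff_divide_distrib[symmetric] algebra_simps)

lemma grid_mono: "0 \<le> t \<Longrightarrow> grid t N k \<le> grid t N (Suc k)"
  using grid_step[of t N k] by (smt (verit) divide_nonneg_nonneg of_nat_0_le_iff)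

lemma grid_le: "0 \<le> t \<Longrightarrow> k \<le> Suc N \<Longrightarrow> grid t N k \<le> t"
  using partition_bounds(2)[OF partition_grid, of t k N] by simp

section \<open>Limits of covariation sums and of trapezoidal sums\<close>

context wiener
begin

text \<open>In the L2 norm the remainder has size h and the increment the square root of h. A
  product is therefore of order h to the power 3/2 in L1, and about 1/h cells together give the
  square root of h. The argument stays in L1, since a product of two square-integrable factors is in
  general only integrable.\<close>

lemma remainder_sum_limit:
  assumes ij: "i < n" "j \<in> {1..<n}" and X: "regular X" and Y: "regular Y" and ex: "expands X i Y"
    and t: "0 \<le> t"
  defines "R \<equiv> \<lambda>a b \<omega>. X b \<omega> - X a \<omega> - Y a \<omega> * (W i b \<omega> - W i a \<omega>)"
  shows "conv_in_prob M (\<lambda>N \<omega>. \<Sum>k<Suc N. R (grid t N k) (grid t N (Suc k)) \<omega> * (W j (grid t N (Suc k)) \<omega> - W j (grid t N k) \<omega>)) (\<lambda>_. 0)"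
    and "\<And>N. integrable M (\<lambda>\<omega>. \<Sum>k<Suc N. R (grid t N k) (grid t N (Suc k)) \<omega> * (W j (grid t N (Suc k)) \<omega> - W j (grid t N k) \<omega>))"
proof -
  let ?g = "grid t"
  let ?D = "\<lambda>N k \<omega>. W j (?g N (Suc k)) \<omega> - W j (?g N k) \<omega>"
  let ?R = "\<lambda>N k. R (?g N k) (?g N (Suc k))"
  obtain K where K: "0 \<le> K" "\<And>a b. 0 \<le> a \<Longrightarrow> a \<le> b \<Longrightarrow> b \<le> t \<Longrightarrow> msq M (R a b) \<le> K * (b - a)\<^sup>2"
    unfolding R_def using expandsE[OF ex] by blast
  have g0: "0 \<le> ?g N k" and gm: "?g N k \<le> ?g N (Suc k)" for N k using t by (auto intro: grid_nonneg grid_mono)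
  have sR: "sqint M (?R N k)" for N k
    unfolding R_def
    by (intro sqint_diff regular_sqint[OF X] sqint_past_times_increment(1)[OF ij(1) g0 gm] g0
        regular_past[OF Y] regular_sqint[OF Y])
  note sD = sqint_increment[OF ij(2) g0 gm]
  have int: "integrable M (\<lambda>\<omega>. ?R N k \<omega> * ?D N k \<omega>)" for N k
    using sqint_integrable_mult[OF sR sD(1)] .
  then show I: "integrable M (\<lambda>\<omega>. \<Sum>k<Suc N. ?R N k \<omega> * ?D N k \<omega>)" for N
    by (intro Bochner_Integration.integrable_sum)
  \<comment> \<open>Positive even for \<open>t = 0\<close>, so that division by its square root is
    harmless.\<close>
  define h where "h N = (t + 1) / real (Suc N)" for N
  have h: "0 < h N" "t / real (Suc N) \<le> h N" "0 \<le> t / real (Suc N)" for N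
    using t by (auto simp: h_def divide_right_mono)
  have le: "expectation (\<lambda>\<omega>. \<bar>(\<Sum>k<Suc N. ?R N k \<omega> * ?D N k \<omega>) - 0\<bar>) \<le> (K + 1) * (t + 1) * sqrt (h N)" for N
  proof -
    have bound: "expectation (\<lambda>\<omega>. \<bar>?R N k \<omega> * ?D N k \<omega>\<bar>) \<le> (K + 1) * (h N * sqrt (h N))" if k: "k < Suc N" for k
    proof -
      have e: "0 < sqrt (h N)" using h by simp
      have "msq M (?R N k) \<le> K * (t / real (Suc N))\<^sup>2"
        using K(2)[OF g0 gm grid_le[OF t, of "Suc k" N]] k unfolding grid_step by simp
      also have "\<dots> \<le> K * (h N)\<^sup>2" using K(1) h by (intro mult_left_mono power_mono) auto
      finally have 1: "msq M (?R N k) \<le> K * (h N)\<^sup>2" .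
      have 2: "msq M (?D N k) \<le> h N" unfolding sD(2) grid_step by (rule h)
      \<comment> \<open>The parameter \<open>sqrt (h N)\<close> gives both terms the order
        \<open>h N * sqrt (h N)\<close>.\<close>
      have "expectation (\<lambda>\<omega>. \<bar>?R N k \<omega> * ?D N k \<omega>\<bar>) \<le> msq M (?R N k) / sqrt (h N) + sqrt (h N) * msq M (?D N k)"
        using sR sD(1) e by (rule expectation_abs_mult_le)
      also have "\<dots> \<le> K * (h N)\<^sup>2 / sqrt (h N) + sqrt (h N) * h N"
        using 1 2 e by (intro add_mono divide_right_mono mult_left_mono) auto
      also have "(h N)\<^sup>2 / sqrt (h N) = h N * sqrt (h N)"
        using h[of N] by (simp add: power2_eq_square divide_eq_eq mult.assoc)
      then have "K * (h N)\<^sup>2 / sqrt (h N) = K * (h N * sqrt (h N))" by (metis times_divide_eq_right)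
      finally show ?thesis by (simp add: algebra_simps)
    qed
    have "expectation (\<lambda>\<omega>. \<bar>(\<Sum>k<Suc N. ?R N k \<omega> * ?D N k \<omega>) - 0\<bar>) \<le> expectation (\<lambda>\<omega>. \<Sum>k<Suc N. \<bar>?R N k \<omega> * ?D N k \<omega>\<bar>)"
    proof (rule integral_mono)
      show "integrable M (\<lambda>\<omega>. \<bar>(\<Sum>k<Suc N. ?R N k \<omega> * ?D N k \<omega>) - 0\<bar>)"
        using integrable_abs[OF I[of N]] unfolding diff_zero .
      show "integrable M (\<lambda>\<omega>. \<Sum>k<Suc N. \<bar>?R N k \<omega> * ?D N k \<omega>\<bar>)"
        using int by (intro Bochner_Integration.integrable_sum integrable_abs)
      show "\<bar>(\<Sum>k<Suc N. ?R N k \<omega> * ?D N k \<omega>) - 0\<bar> \<le> (\<Sum>k<Suc N. \<bar>?R N k \<omega> * ?D N k \<omega>\<bar>)" for \<omega>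
        unfolding diff_zero by (rule sum_abs)
    qed
    also have "\<dots> = (\<Sum>k<Suc N. expectation (\<lambda>\<omega>. \<bar>?R N k \<omega> * ?D N k \<omega>\<bar>))"
      using int by (intro Bochner_Integration.integral_sum integrable_abs)
    also have "\<dots> \<le> (\<Sum>k<Suc N. (K + 1) * (h N * sqrt (h N)))"
      using bound by (intro sum_mono) auto
    also have "\<dots> = (K + 1) * ((real (Suc N) * h N) * sqrt (h N))"
      by (simp add: algebra_simps)
    also have "real (Suc N) * h N = t + 1" by (simp add: h_def)
    finally show ?thesis by (simp add: mult.assoc)
  qed
  have lim: "(\<lambda>N. (K + 1) * (t + 1) * sqrt (h N)) \<longlonglongrightarrow> 0"
    using tendsto_mult[OF tendsto_const tendsto_real_sqrt[OF mesh_tendsto_zero]] unfolding h_def by fastforce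
  show "conv_in_prob M (\<lambda>N \<omega>. \<Sum>k<Suc N. ?R N k \<omega> * ?D N k \<omega>) (\<lambda>_. 0)"
  proof (rule conv_in_prob_L1)
    show "integrable M (\<lambda>\<omega>. (\<Sum>k<Suc N. ?R N k \<omega> * ?D N k \<omega>) - 0)" for N
      using I[of N] unfolding diff_zero .
    show "(\<lambda>N. expectation (\<lambda>\<omega>. \<bar>(\<Sum>k<Suc N. ?R N k \<omega> * ?D N k \<omega>) - 0\<bar>)) \<longlonglongrightarrow> 0"
      by (rule tendsto_sandwich[OF _ _ tendsto_const lim]; rule always_eventually; rule allI)
         (simp, rule le)
  qed
qed

text \<open>There are \<open>Suc N\<close> orthogonal terms, each with a mean square of order 1 / (N
  + 1) squared.\<close>

lemma quadratic_noise_limit: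
  assumes ij: "i \<in> {1..<n}" "j \<in> {1..<n}" and Y: "regular Y" and t: "0 \<le> t"
  defines "\<xi> \<equiv> \<lambda>a b \<omega>. (W i b \<omega> - W i a \<omega>) * (W j b \<omega> - W j a \<omega>) - cov i j * (b - a)"
  shows "conv_in_prob M (\<lambda>N \<omega>. \<Sum>k<Suc N. Y (grid t N k) \<omega> * \<xi> (grid t N k) (grid t N (Suc k)) \<omega>) (\<lambda>_. 0)"
    and "\<And>N. sqint M (\<lambda>\<omega>. \<Sum>k<Suc N. Y (grid t N k) \<omega> * \<xi> (grid t N k) (grid t N (Suc k)) \<omega>)"
proof -
  let ?S = "\<lambda>N \<omega>. \<Sum>k<Suc N. Y (grid t N k) \<omega> * \<xi> (grid t N k) (grid t N (Suc k)) \<omega>"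
  obtain C where C: "0 \<le> C" "\<And>u. 0 \<le> u \<Longrightarrow> u \<le> t \<Longrightarrow> msq M (Y u) \<le> C"
    using regular_bounded[OF Y] by blast
  have q: "sqint M (?S N)" "msq M (?S N) \<le> (\<Sum>k<Suc N. msq M (Y (grid t N k)) * (8 * (grid t N (Suc k) - grid t N k)\<^sup>2))" for N
    using quadratic_noise_sum[OF ij Y, of "grid t N" "Suc N"] t unfolding \<xi>_def by (auto intro: grid_nonneg grid_mono)
  show "sqint M (?S N)" for N by (rule q)
  have le: "msq M (\<lambda>\<omega>. ?S N \<omega> - 0) \<le> (8 * C * t\<^sup>2) / real (Suc N)" for N
  proof -
    have "msq M (?S N) \<le> (\<Sum>k<Suc N. msq M (Y (grid t N k)) * (8 * (t / real (Suc N))\<^sup>2))"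
      using q(2)[of N] unfolding grid_step .
    also have "\<dots> \<le> (\<Sum>k<Suc N. C * (8 * (t / real (Suc N))\<^sup>2))"
      using C(2) t grid_nonneg[OF t] grid_le[OF t] by (intro sum_mono mult_right_mono) auto
    also have "\<dots> = real (Suc N) * (C * (8 * (t / real (Suc N))\<^sup>2))" by (simp only: sum_constant card_lessThan)
    also have "\<dots> = (8 * C * t\<^sup>2) / real (Suc N)"
      by (simp add: power_divide power2_eq_square field_simps del: of_nat_Suc)
    finally show ?thesis by simp
  qed
  show "conv_in_prob M ?S (\<lambda>_. 0)"
  proof (rule conv_in_prob_L2)
    show "(\<lambda>N. msq M (\<lambda>\<omega>. ?S N \<omega> - 0)) \<longlonglongrightarrow> 0"
      by (rule tendsto_sandwich[OF _ _ tendsto_const mesh_tendsto_zero]; rule always_eventually; rule allI)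
         (rule msq_nonneg, rule le)
  qed (use q(1) in auto)
qed

text \<open>Inserting the expansion of \<open>X\<close> splits the sum in three: the remainder
  against the increments of \<open>W j\<close>, the coefficient \<open>Y\<close> against centred
  products, and a left-point time sum of \<open>Y\<close> scaled by \<open>cov i j\<close>. The
  first two vanish in the limit.\<close>

lemma covariation_limit:
  assumes ij: "i \<in> {1..<n}" "j \<in> {1..<n}" and X: "regular X" and Y: "regular Y"
    and ex: "expands X i Y" and V: "is_integral 0 Y V" and t: "0 \<le> t"
  shows "conv_in_prob M (\<lambda>N \<omega>. \<Sum>k<Suc N. (X (grid t N (Suc k)) \<omega> - X (grid t N k) \<omega>) *
      (W j (grid t N (Suc k)) \<omega> - W j (grid t N k) \<omega>)) (\<lambda>\<omega>. cov i j * V t \<omega>)"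
proof -
  have n: "0 < n" "i < n" using ij by auto
  let ?a = "\<lambda>N k. grid t N k" and ?b = "\<lambda>N k. grid t N (Suc k)"
  let ?P = "\<lambda>N \<omega>. \<Sum>k<Suc N. (X (?b N k) \<omega> - X (?a N k) \<omega> - Y (?a N k) \<omega> * (W i (?b N k) \<omega> - W i (?a N k) \<omega>))
     * (W j (?b N k) \<omega> - W j (?a N k) \<omega>)"
  let ?Q = "\<lambda>N \<omega>. \<Sum>k<Suc N. Y (?a N k) \<omega> * ((W i (?b N k) \<omega> - W i (?a N k) \<omega>) * (W j (?b N k) \<omega> - W j (?a N k) \<omega>)
     - cov i j * (?b N k - ?a N k))"
  let ?S = "\<lambda>N \<omega>. cov i j * rsum 0 Y (grid t N) (Suc N) \<omega>"
  note P = remainder_sum_limit[OF n(2) ij(2) X Y ex t]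
  note Q = quadratic_noise_limit[OF ij Y t]
  have S: "conv_in_prob M ?S (\<lambda>\<omega>. cov i j * V t \<omega>)"
    using is_integral_conv_in_prob[OF n(1) Y V t] by (rule conv_in_prob_cmult)
  have mP: "?P N \<in> borel_measurable M" for N using P(2)[of N] by (rule borel_measurable_integrable)
  have mQ: "?Q N \<in> borel_measurable M" for N using Q(2)[of N] by (rule sqint_measurable)
  have mS: "?S N \<in> borel_measurable M" for N
    using sqint_measurable[OF grid_rsum_sqint[OF n(1) Y t]] by simp
  have mV: "(\<lambda>\<omega>. cov i j * V t \<omega>) \<in> borel_measurable M"
    using sqint_measurable[OF regular_sqint[OF is_integral_regular[OF V] t]] by simp
  have "conv_in_prob M (\<lambda>N \<omega>. ?P N \<omega> + (?Q N \<omega> + ?S N \<omega>)) (\<lambda>\<omega>. 0 + (0 + cov i j * V t \<omega>))"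
    using mP mQ mS mV P(1) Q(1) S by (intro conv_in_prob_add borel_measurable_add) auto
  moreover have "?P N \<omega> + (?Q N \<omega> + ?S N \<omega>) = (\<Sum>k<Suc N. (X (?b N k) \<omega> - X (?a N k) \<omega>) * (W j (?b N k) \<omega> - W j (?a N k) \<omega>))" for N \<omega>
    unfolding rsum_def W_time sum_distrib_left sum.distrib[symmetric]
    by (intro sum.cong refl) (simp add: algebra_simps)
  ultimately show ?thesis by (simp only: add_0)
qed

text \<open>Time increments are equal weights of total mass \<open>t\<close>, so weighted
  Cauchy-Schwarz reduces the claim to increments of \<open>X\<close> over one cell, whose mean
  square vanishes with the mesh.\<close>

lemma time_covariation_limit:
  assumes X: "regular X" and t: "0 \<le> t"
  shows "conv_in_prob M (\<lambda>N \<omega>. \<Sum>k<Suc N. (X (grid t N (Suc k)) \<omega> - X (grid t N k) \<omega>) *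
      (W 0 (grid t N (Suc k)) \<omega> - W 0 (grid t N k) \<omega>)) (\<lambda>_. 0)"
proof -
  let ?D = "\<lambda>N k \<omega>. X (grid t N (Suc k)) \<omega> - X (grid t N k) \<omega>"
  let ?S = "\<lambda>N \<omega>. \<Sum>k<Suc N. (t / real (Suc N)) * ?D N k \<omega>"
  obtain L where L: "0 \<le> L" "\<And>a b. 0 \<le> a \<Longrightarrow> a \<le> b \<Longrightarrow> b \<le> t \<Longrightarrow> msq M (\<lambda>\<omega>. X b \<omega> - X a \<omega>) \<le> L * (b - a)"
    using regular_Lipschitz[OF X] by blast
  have sD: "sqint M (?D N k)" for N k using t by (intro sqint_diff regular_sqint[OF X] grid_nonneg)
  have w: "0 \<le> t / real (Suc N)" for N using t by simp
  have tot: "(\<Sum>k<Suc N. t / real (Suc N)) = t" for N by (simp only: sum_constant card_lessThan) simp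
  have le: "msq M (\<lambda>\<omega>. ?S N \<omega> - 0) \<le> (t * t * L * t) / real (Suc N)" for N
  proof -
    have "msq M (?S N) \<le> (\<Sum>k<Suc N. t / real (Suc N)) * (\<Sum>k<Suc N. t / real (Suc N) * msq M (?D N k))"
      using w sD by (intro msq_weighted_sum_le) auto
    also have "\<dots> \<le> t * (\<Sum>k<Suc N. t / real (Suc N) * (L * (t / real (Suc N))))"
      unfolding tot
    proof (intro mult_left_mono sum_mono t w)
      fix k assume "k \<in> {..<Suc N}"
      then show "msq M (?D N k) \<le> L * (t / real (Suc N))"
        using L(2)[OF grid_nonneg[OF t, of N k] grid_mono[OF t, of N k] grid_le[OF t, of "Suc k" N]] unfolding grid_step by auto
    qed
    also have "\<dots> = t * (t * (L * (t / real (Suc N))))"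
      unfolding sum_distrib_right[symmetric] tot ..
    finally show ?thesis by (simp add: mult.assoc)
  qed
  have "conv_in_prob M ?S (\<lambda>_. 0)"
  proof (rule conv_in_prob_L2)
    show "sqint M (?S N)" for N using sD by (intro sqint_sum sqint_cmult)
    show "(\<lambda>N. msq M (\<lambda>\<omega>. ?S N \<omega> - 0)) \<longlonglongrightarrow> 0"
      by (rule tendsto_sandwich[OF _ _ tendsto_const mesh_tendsto_zero]; rule always_eventually; rule allI)
         (rule msq_nonneg, rule le)
  qed simp
  then show ?thesis unfolding W_time grid_step by (simp only: mult.commute)
qed

text \<open>The average of the endpoint values is the left value plus half the increment, so a
  trapezoidal sum is a left-point sum plus half a covariation sum.\<close>

lemma trapezoidal_limit:
  assumes n: "i \<in> {1..<n}" "j < n" and X: "regular X" and Y: "regular Y"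
    and ex: "expands X i Y" and Z: "is_integral j X Z" and V: "is_integral 0 Y V" and t: "0 \<le> t"
  shows "conv_in_prob M (\<lambda>N \<omega>. \<Sum>k<Suc N. (X (grid t N k) \<omega> + X (grid t N (Suc k)) \<omega>) / 2 *
      (W j (grid t N (Suc k)) \<omega> - W j (grid t N k) \<omega>))
    (\<lambda>\<omega>. Z t \<omega> + (if j = 0 then 0 else cov i j / 2) * V t \<omega>)"
proof -
  let ?C = "\<lambda>N \<omega>. \<Sum>k<Suc N. (X (grid t N (Suc k)) \<omega> - X (grid t N k) \<omega>) *
      (W j (grid t N (Suc k)) \<omega> - W j (grid t N k) \<omega>)"
  let ?c = "if j = 0 then 0 else cov i j"
  have C: "conv_in_prob M ?C (\<lambda>\<omega>. ?c * V t \<omega>)"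
  proof (cases "j = 0")
    case True
    then show ?thesis using time_covariation_limit[OF X t] by simp
  next
    case False
    then show ?thesis using covariation_limit[OF n(1) _ X Y ex V t, of j] n by auto
  qed
  have [measurable]: "X (grid t N k) \<in> borel_measurable M" for N k
    using t by (intro sqint_measurable[OF regular_sqint[OF X]] grid_nonneg)
  have [measurable]: "V t \<in> borel_measurable M" "Z t \<in> borel_measurable M"
    using is_integral_regular[OF V] is_integral_regular[OF Z] t by (auto intro!: sqint_measurable regular_sqint)
  have [measurable]: "W j u \<in> borel_measurable M" for u using n by simp
  have "conv_in_prob M (\<lambda>N \<omega>. rsum j X (grid t N) (Suc N) \<omega> + (1 / 2) * ?C N \<omega>) (\<lambda>\<omega>. Z t \<omega> + (1 / 2) * (?c * V t \<omega>))"
  proof (rule conv_in_prob_add)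
    show "rsum j X (grid t N) (Suc N) \<in> borel_measurable M" for N
      using sqint_measurable[OF grid_rsum_sqint[OF n(2) X t]] .
    show "conv_in_prob M (\<lambda>N \<omega>. (1 / 2) * ?C N \<omega>) (\<lambda>\<omega>. (1 / 2) * (?c * V t \<omega>))"
      using C by (rule conv_in_prob_cmult)
    show "conv_in_prob M (\<lambda>N. rsum j X (grid t N) (Suc N)) (Z t)"
      using is_integral_conv_in_prob[OF n(2) X Z t] .
  qed measurable
  moreover have "rsum j X (grid t N) (Suc N) \<omega> + (1 / 2) * ?C N \<omega>
     = (\<Sum>k<Suc N. (X (grid t N k) \<omega> + X (grid t N (Suc k)) \<omega>) / 2 * (W j (grid t N (Suc k)) \<omega> - W j (grid t N k) \<omega>))" for N \<omega>
    unfolding rsum_def sum_distrib_left sum.distrib[symmetric]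
    by (intro sum.cong refl) (simp add: field_simps)
  moreover have "(1 / 2) * (?c * V t \<omega>) = (if j = 0 then 0 else cov i j / 2) * V t \<omega>" for \<omega> by simp
  ultimately show ?thesis by (simp only:)
qed

end

section \<open>Iterated integrals\<close>

text \<open>\<open>strat_mean \<alpha> = ((c, q), i, c', q')\<close> records that the Stratonovich integral \<open>X\<close> of the reversed
  word \<open>\<alpha>\<close> has mean \<open>c t\<^sup>q / q!\<close> and that \<open>dX = Y dW\<^sup>i + O(dt)\<close> where the mean of \<open>Y\<close> is given by
  \<open>c'\<close> and \<open>q'\<close> in the same way.\<close>

primrec strat_mean :: "nat list \<Rightarrow> (real \<times> nat) \<times> nat \<times> real \<times> nat" where
  "strat_mean [] = ((1, 0), 1, 0, 0)"
| "strat_mean (j # \<alpha>) = (case strat_mean \<alpha> of ((c, q), i, c', q') \<Rightarrow>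
     if j = 0 then ((c, Suc q), 1, 0, 0) else ((cov i j / 2 * c', Suc q'), j, c, q))"

text \<open>The two claims go together by parity: in \<open>c\<close> all noise letters are paired,
  in \<open>c'\<close> one is still waiting for its partner. A second equal letter closes the pair,
  at the cost of a factor 1/2 and with one more power of time; a zero breaks the adjacency, so that
  \<open>c'\<close> becomes 0.\<close>

lemma strat_mean_nonzero:
  assumes "strat_mean \<alpha> = ((c, q), i, c', q')"
  shows "(c \<noteq> 0 \<longrightarrow> (\<exists>k. c = 1 / 2 ^ k \<and> length (filter (\<lambda>i. i \<noteq> 0) \<alpha>) = 2 * k \<and> q = k + length (filter (\<lambda>i. i = 0) \<alpha>))) \<and>
    (c' \<noteq> 0 \<longrightarrow> (\<exists>k. c' = 1 / 2 ^ k \<and> length (filter (\<lambda>i. i \<noteq> 0) \<alpha>) = 2 * k + 1 \<and> q' = k + length (filter (\<lambda>i. i = 0) \<alpha>)))"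
  using assms
proof (induction \<alpha> arbitrary: c q i c' q')
  case Nil
  then show ?case by auto
next
  case (Cons j \<alpha>)
  obtain d p i0 d' p' where s: "strat_mean \<alpha> = ((d, p), i0, d', p')" by (metis prod.collapse)
  note IH = Cons.IH[OF s]
  show ?case
  proof (cases "j = 0")
    case True
    then show ?thesis using Cons.prems s IH by auto
  next
    case False
    then have eq: "c = cov i0 j / 2 * d'" "q = Suc p'" "c' = d" "q' = p" using Cons.prems s by auto
    have "\<exists>k. c = 1 / 2 ^ k \<and> length (filter (\<lambda>i. i \<noteq> 0) (j # \<alpha>)) = 2 * k \<and> q = k + length (filter (\<lambda>i. i = 0) (j # \<alpha>))"
      if "c \<noteq> 0"
    proof -
      \<comment> \<open>A nonzero product forces the waiting letter \<open>i0\<close> to equal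
        \<open>j\<close>, and the odd count of the waiting state becomes even.\<close>
      have "d' \<noteq> 0" and cov: "cov i0 j = 1" using that eq by (auto simp: cov_def split: if_splits)
      then obtain k where k: "d' = 1 / 2 ^ k" "length (filter (\<lambda>i. i \<noteq> 0) \<alpha>) = 2 * k + 1" "p' = k + length (filter (\<lambda>i. i = 0) \<alpha>)"
        using IH by blast
      then show ?thesis using eq False cov by (intro exI[of _ "Suc k"]) auto
    qed
    moreover have "\<exists>k. c' = 1 / 2 ^ k \<and> length (filter (\<lambda>i. i \<noteq> 0) (j # \<alpha>)) = 2 * k + 1 \<and> q' = k + length (filter (\<lambda>i. i = 0) (j # \<alpha>))"
      if nz: "c' \<noteq> 0"
    proof -
      obtain k where k: "d = 1 / 2 ^ k" "length (filter (\<lambda>i. i \<noteq> 0) \<alpha>) = 2 * k" "p = k + length (filter (\<lambda>i. i = 0) \<alpha>)"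
        using IH nz eq by blast
      then show ?thesis using eq False by (intro exI[of _ k]) auto
    qed
    ultimately show ?thesis by blast
  qed
qed

section \<open>Induction over words\<close>

context wiener
begin

text \<open>A grid sum involves finitely many times, so almost surely all chosen values may be
  replaced by those of \<open>X\<close>. The sums of \<open>X\<close> have a known limit, and the
  chosen integral must agree with it.\<close>

lemma version_ito_step:
  assumes j: "j < n" and X: "regular X" and v: "version (ito_rev M W \<beta>) X" and Z: "is_integral j X Z"
  shows "version (ito_rev M W (j # \<beta>)) Z"
  unfolding version_def
proof (intro allI impI)
  fix t :: real assume t: "0 \<le> t"
  let ?S = "\<lambda>N \<omega>. \<Sum>k<Suc N. ito_rev M W \<beta> (grid t N k) \<omega> * (W j (grid t N (Suc k)) \<omega> - W j (grid t N k) \<omega>)"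
  have g: "0 \<le> grid t N k" for N k using t by (rule grid_nonneg)
  have [measurable]: "ito_rev M W \<beta> (grid t N k) \<in> borel_measurable M" for N k using v g by (simp add: version_def)
  have [measurable]: "W j u \<in> borel_measurable M" for u using j by simp
  have S: "?S N \<in> borel_measurable M" for N by measurable
  have R: "rsum j X (grid t N) (Suc N) \<in> borel_measurable M" for N
    using sqint_measurable[OF grid_rsum_sqint[OF j X t]] .
  have mZ: "Z t \<in> borel_measurable M"
    using sqint_measurable[OF regular_sqint[OF is_integral_regular[OF Z] t]] .
  have ev: "AE \<omega> in M. \<forall>k\<in>{..<Suc N}. ito_rev M W \<beta> (grid t N k) \<omega> = X (grid t N k) \<omega>" for N
    by (rule AE_finite_allI) (use v g in \<open>auto simp: version_def\<close>)
  have ae: "AE \<omega> in M. ?S N \<omega> = rsum j X (grid t N) (Suc N) \<omega>" for N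
    using ev[of N] by eventually_elim (auto intro!: sum.cong simp: rsum_def simp del: sum.lessThan_Suc)
  have "conv_in_prob M ?S (Z t)"
    using conv_in_prob_cong_AE[of ?S "\<lambda>N. rsum j X (grid t N) (Suc N)", OF S R mZ ae]
      is_integral_conv_in_prob[OF j X Z t] by blast
  from conv_in_prob_SOME[OF S mZ this]
  show "ito_rev M W (j # \<beta>) t \<in> borel_measurable M \<and> (AE \<omega> in M. ito_rev M W (j # \<beta>) t \<omega> = Z t \<omega>)"
    by simp
qed

lemma version_strat_step:
  assumes ij: "i \<in> {1..<n}" "j < n" and X: "regular X" and Y: "regular Y" and ex: "expands X i Y"
    and v: "version (strat_rev M W \<beta>) X" and Z: "is_integral j X Z" and V: "is_integral 0 Y V"
  shows "version (strat_rev M W (j # \<beta>)) (\<lambda>t \<omega>. Z t \<omega> + (if j = 0 then 0 else cov i j / 2) * V t \<omega>)"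
  unfolding version_def
proof (intro allI impI)
  fix t :: real assume t: "0 \<le> t"
  let ?L = "\<lambda>\<omega>. Z t \<omega> + (if j = 0 then 0 else cov i j / 2) * V t \<omega>"
  let ?T = "\<lambda>P N \<omega>. \<Sum>k<Suc N. (P (grid t N k) \<omega> + P (grid t N (Suc k)) \<omega>) / 2 * (W j (grid t N (Suc k)) \<omega> - W j (grid t N k) \<omega>)"
  let ?P = "strat_rev M W \<beta>"
  have g: "0 \<le> grid t N k" for N k using t by (rule grid_nonneg)
  have [measurable]: "?P (grid t N k) \<in> borel_measurable M" for N k using v g by (simp add: version_def)
  have [measurable]: "X (grid t N k) \<in> borel_measurable M" for N k
    using g by (intro sqint_measurable[OF regular_sqint[OF X]])
  have [measurable]: "W j u \<in> borel_measurable M" for u using ij by simp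
  have S: "?T ?P N \<in> borel_measurable M" for N by measurable
  have R: "?T X N \<in> borel_measurable M" for N by measurable
  have [measurable]: "V t \<in> borel_measurable M" "Z t \<in> borel_measurable M"
    using is_integral_regular[OF V] is_integral_regular[OF Z] t by (auto intro!: sqint_measurable regular_sqint)
  have mL: "?L \<in> borel_measurable M" by measurable
  \<comment> \<open>Unlike for left-point sums, the last grid point belongs to the index set, as
    right endpoints enter.\<close>
  have ev: "AE \<omega> in M. \<forall>k\<in>{..Suc N}. ?P (grid t N k) \<omega> = X (grid t N k) \<omega>" for N
    by (rule AE_finite_allI) (use v g in \<open>auto simp: version_def\<close>)
  have ae: "AE \<omega> in M. ?T ?P N \<omega> = ?T X N \<omega>" for N
    using ev[of N] by eventually_elim (auto intro!: sum.cong simp del: sum.lessThan_Suc)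
  have "conv_in_prob M (?T ?P) ?L"
    using conv_in_prob_cong_AE[of "?T ?P" "?T X", OF S R mL ae]
      trapezoidal_limit[OF ij X Y ex Z V t] by blast
  from conv_in_prob_SOME[OF S mL this]
  show "strat_rev M W (j # \<beta>) t \<in> borel_measurable M \<and> (AE \<omega> in M. strat_rev M W (j # \<beta>) t \<omega> = ?L \<omega>)"
    by simp
qed

text \<open>The outermost letter decides: a noise letter gives mean 0, while a zero integrates the
  previous mean in time, so a mean that has become 0 stays 0 under later zeros.\<close>

lemma ito_rev_regular_version:
  assumes "set \<beta> \<subseteq> {..<n}" "0 < n"
  shows "\<exists>X. regular X \<and> version (ito_rev M W \<beta>) X \<and>
    (\<forall>t\<ge>0. expectation (X t) = (if \<forall>i\<in>set \<beta>. i = 0 then t ^ length \<beta> / fact (length \<beta>) else 0))"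
  using assms(1)
proof (induction \<beta>)
  case Nil
  show ?case
    by (intro exI[of _ "\<lambda>_ _. 1"]) (auto simp: regular_const version_def prob_space)
next
  case (Cons j \<beta>)
  then obtain X where X: "regular X" "version (ito_rev M W \<beta>) X"
    and EX: "\<And>t. 0 \<le> t \<Longrightarrow> expectation (X t) = (if \<forall>i\<in>set \<beta>. i = 0 then t ^ length \<beta> / fact (length \<beta>) else 0)"
    by auto
  have j: "j < n" using Cons.prems by simp
  obtain Z where Z: "is_integral j X Z" using integral_exists[OF j X(1)] by blast
  have "expectation (Z t) = (if \<forall>i\<in>set (j # \<beta>). i = 0 then t ^ length (j # \<beta>) / fact (length (j # \<beta>)) else 0)"
    if t: "0 \<le> t" for t
  proof (cases "j = 0")
    case True
    define c :: real where "c = (if \<forall>i\<in>set \<beta>. i = 0 then 1 else 0)"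
    have "expectation (Z t) = c * (t ^ Suc (length \<beta>) / fact (Suc (length \<beta>)))"
    proof (rule is_integral_expectation_time[OF X(1) _ t assms(2)])
      show "is_integral 0 X Z" using Z True by simp
      show "expectation (X u) = c * (u ^ length \<beta> / fact (length \<beta>))" if "0 \<le> u" for u
        using EX[OF that] by (cases "\<forall>i\<in>set \<beta>. i = 0") (auto simp: c_def)
    qed
    then show ?thesis using True by (cases "\<forall>i\<in>set \<beta>. i = 0") (auto simp: c_def)
  next
    case False
    then show ?thesis using is_integral_expectation_noise[OF _ X(1) Z t] j by simp
  qed
  then show ?case
    using is_integral_regular[OF Z] version_ito_step[OF j X Z] by blast
qed

text \<open>The induction carries \<open>Y\<close> besides \<open>X\<close> because a further noise
  letter adds half a covariation, whose mean is governed by that of \<open>Y\<close>. After a noise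
  letter the previous \<open>X\<close> becomes the new coefficient, and the previous
  \<open>Y\<close> is used up in the correction \<open>V\<close>.\<close>

lemma strat_rev_regular_version:
  assumes "set \<alpha> \<subseteq> {..<n}" "2 \<le> n" "strat_mean \<alpha> = ((c, q), i, c', q')"
  shows "\<exists>X Y. i \<in> {1..<n} \<and> regular X \<and> regular Y \<and> expands X i Y \<and> version (strat_rev M W \<alpha>) X \<and>
    (\<forall>t\<ge>0. expectation (X t) = c * (t ^ q / fact q)) \<and> (\<forall>t\<ge>0. expectation (Y t) = c' * (t ^ q' / fact q'))"
  using assms(1,3)
proof (induction \<alpha> arbitrary: c q i c' q')
  case Nil
  then show ?case using assms(2)
    by (intro exI[of _ "\<lambda>_ _. 1"] exI[of _ "\<lambda>_ _. 0"])
       (auto simp: regular_const expands_const version_def prob_space)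
next
  case (Cons j \<alpha>)
  obtain d p i0 d' p' where s: "strat_mean \<alpha> = ((d, p), i0, d', p')" by (metis prod.collapse)
  have "set \<alpha> \<subseteq> {..<n}" and j: "j < n" using Cons.prems by auto
  from Cons.IH[OF this(1) s] obtain X Y where i0: "i0 \<in> {1..<n}" and X: "regular X" and Y: "regular Y"
    and ex: "expands X i0 Y" and v: "version (strat_rev M W \<alpha>) X"
    and EX: "\<And>t. 0 \<le> t \<Longrightarrow> expectation (X t) = d * (t ^ p / fact p)"
    and EY: "\<And>t. 0 \<le> t \<Longrightarrow> expectation (Y t) = d' * (t ^ p' / fact p')" by blast
  have n: "0 < n" using assms(2) by simp
  obtain Z where Z: "is_integral j X Z" using integral_exists[OF j X] by blast
  obtain V where V: "is_integral 0 Y V" using integral_exists[OF n Y] by blast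
  let ?\<kappa> = "if j = 0 then 0 else cov i0 j / 2"
  let ?X = "\<lambda>t \<omega>. Z t \<omega> + ?\<kappa> * V t \<omega>"
  have ver: "version (strat_rev M W (j # \<alpha>)) ?X" using version_strat_step[OF i0 j X Y ex v Z V] .
  have reg: "regular ?X" by (intro regular_add_cmult is_integral_regular[OF Z] is_integral_regular[OF V])
  have EV: "expectation (V t) = d' * (t ^ Suc p' / fact (Suc p'))" if "0 \<le> t" for t
    using is_integral_expectation_time[OF Y V that n EY] .
  show ?case
  proof (cases "j = 0")
    case True
    \<comment> \<open>After a time letter there is no noise part; the letter \<open>1\<close> with
      coefficient 0 is a placeholder, and a genuine driver because \<open>2 \<le> n\<close>.\<close>
    then have eq: "c = d" "q = Suc p" "i = 1" "c' = 0" "q' = 0" using Cons.prems s by auto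
    have Z0: "is_integral 0 X Z" using Z True by simp
    have Xeq: "?X = Z" using True by simp
    have "expectation (Z t) = c * (t ^ q / fact q)" if "0 \<le> t" for t
      using is_integral_expectation_time[OF X Z0 that n EX] eq by simp
    then show ?thesis
      using reg ver time_integral_expands[OF n X Z0, of i] eq assms(2) unfolding Xeq
      by (intro exI[of _ Z] exI[of _ "\<lambda>_ _. 0"]) (auto simp: regular_const)
  next
    case False
    then have eq: "c = cov i0 j / 2 * d'" "q = Suc p'" "i = j" "c' = d" "q' = p" using Cons.prems s by auto
    have j': "j \<in> {1..<n}" using j False by auto
    \<comment> \<open>The Ito part has mean 0; the whole mean comes from the correction.\<close>
    have mX: "expectation (?X t) = c * (t ^ q / fact q)" if t: "0 \<le> t" for t
    proof -
      have "expectation (?X t) = expectation (Z t) + ?\<kappa> * expectation (V t)"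
        using sqint_integrable[OF regular_sqint[OF is_integral_regular[OF Z] t]]
          sqint_integrable[OF regular_sqint[OF is_integral_regular[OF V] t]] by simp
      also have "\<dots> = 0 + cov i0 j / 2 * (d' * (t ^ Suc p' / fact (Suc p')))"
        using is_integral_expectation_noise[OF j' X Z t] EV[OF t] False by (simp only: if_False)
      finally show ?thesis unfolding eq(1,2) by (simp only: mult.assoc add_0)
    qed
    have exX: "expands ?X i X"
      unfolding eq(3)
      by (rule expands_add_cmult[OF j is_integral_regular[OF Z] X is_integral_regular[OF V]
            is_integral_expands[OF Z] time_integral_expands[OF n Y V]])
    show ?thesis
    proof (rule exI[of _ ?X], rule exI[of _ X], intro conjI allI impI)
      show "i \<in> {1..<n}" using j' eq(3) by simp
      show "expectation (X t) = c' * (t ^ q' / fact q')" if "0 \<le> t" for t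
        using EX[OF that] eq(4,5) by simp
    qed (fact reg X exX ver mX)+
  qed
qed

end

section \<open>Comparison of the means of both sides\<close>

theorem lemma4:
  fixes M :: "'a measure" and n :: nat and W :: "nat \<Rightarrow> real \<Rightarrow> 'a \<Rightarrow> real"
    and \<alpha> :: "nat list" and B :: "nat list set" and c :: "nat list \<Rightarrow> real"
    and p :: real and q :: nat
  assumes "n \<ge> 2"
    and "wiener_setup M n W"
    and "set \<alpha> \<subseteq> {..<n}"
    and "finite B"
    and "\<forall>\<beta>\<in>B. set \<beta> \<subseteq> {..<n} \<and> (\<exists>i\<in>set \<beta>. i \<noteq> 0)"
    and "\<forall>t\<ge>0. AE \<omega> in M. strat_int M W \<alpha> t \<omega> =
           (\<Sum>\<beta>\<in>B. c \<beta> * ito_int M W \<beta> t \<omega>) + p * ito_int M W (replicate q 0) t \<omega>"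
    and "p \<noteq> 0"
  shows "p = 1 / 2 powr (real (length (filter (\<lambda>i. i \<noteq> 0) \<alpha>)) / 2)
     \<and> real q = real (length (filter (\<lambda>i. i \<noteq> 0) \<alpha>)) / 2 + real (length (filter (\<lambda>i. i = 0) \<alpha>))"
proof -
  interpret wiener M n W
    using assms(2) by (auto simp: wiener_def wiener_axioms_def wiener_setup_def)
  have n: "0 < n" using assms(1) by simp
  obtain d r i d' r' where s: "strat_mean (rev \<alpha>) = ((d, r), i, d', r')" by (metis prod.collapse)
  obtain X where X: "regular X" "version (strat_rev M W (rev \<alpha>)) X"
    and EX: "\<And>t. 0 \<le> t \<Longrightarrow> expectation (X t) = d * (t ^ r / fact r)"
    using strat_rev_regular_version[OF _ assms(1) s] assms(3) by auto
  have "\<exists>X. regular X \<and> version (ito_rev M W (rev \<beta>)) X \<and> (\<forall>t\<ge>0. expectation (X t) = 0)" if "\<beta> \<in> B" for \<beta>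
  proof -
    have "set (rev \<beta>) \<subseteq> {..<n}" "\<not> (\<forall>i\<in>set (rev \<beta>). i = 0)" using assms(5) that by auto
    then show ?thesis using ito_rev_regular_version[OF _ n, of "rev \<beta>"] by (simp only: if_False)
  qed
  then obtain I where I: "\<And>\<beta>. \<beta> \<in> B \<Longrightarrow> regular (I \<beta>)"
    "\<And>\<beta>. \<beta> \<in> B \<Longrightarrow> version (ito_rev M W (rev \<beta>)) (I \<beta>)"
    "\<And>\<beta> t. \<beta> \<in> B \<Longrightarrow> 0 \<le> t \<Longrightarrow> expectation (I \<beta> t) = 0" by metis
  have sub: "set (replicate q 0) \<subseteq> {..<n}" and zero: "\<forall>i\<in>set (replicate q (0::nat)). i = 0" using n by auto
  from ito_rev_regular_version[OF sub n, unfolded if_P[OF zero] length_replicate]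
  obtain U where U: "regular U" "version (ito_rev M W (replicate q 0)) U"
    and EU: "\<And>t. 0 \<le> t \<Longrightarrow> expectation (U t) = t ^ q / fact q"
    by blast
  \<comment> \<open>At each fixed \<open>t\<close> the chosen integrals are replaced almost surely
    by integrable regular processes, finitely many in number, so means can be taken; all words in
    \<open>B\<close> contribute 0.\<close>
  have mean: "d * (t ^ r / fact r) = p * (t ^ q / fact q)" if t: "0 \<le> t" for t
  proof -
    have iX: "integrable M (X t)" using sqint_integrable[OF regular_sqint[OF X(1) t]] .
    have iI: "integrable M (I \<beta> t)" if "\<beta> \<in> B" for \<beta> using sqint_integrable[OF regular_sqint[OF I(1)[OF that] t]] .
    have iU: "integrable M (U t)" using sqint_integrable[OF regular_sqint[OF U(1) t]] .
    have a0: "AE \<omega> in M. strat_int M W \<alpha> t \<omega> =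
           (\<Sum>\<beta>\<in>B. c \<beta> * ito_int M W \<beta> t \<omega>) + p * ito_int M W (replicate q 0) t \<omega>"
      using assms(6) t by blast
    have a1: "AE \<omega> in M. strat_int M W \<alpha> t \<omega> = X t \<omega>"
      using X(2) t by (simp add: version_def strat_int_def)
    have a2: "AE \<omega> in M. \<forall>\<beta>\<in>B. ito_int M W \<beta> t \<omega> = I \<beta> t \<omega>"
      using I(2) t assms(4) by (intro AE_finite_allI) (auto simp: version_def ito_int_def)
    have a3: "AE \<omega> in M. ito_int M W (replicate q 0) t \<omega> = U t \<omega>"
      using U(2) t by (simp add: version_def ito_int_def)
    have "AE \<omega> in M. X t \<omega> = (\<Sum>\<beta>\<in>B. c \<beta> * I \<beta> t \<omega>) + p * U t \<omega>"
      using a0 a1 a2 a3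
    proof eventually_elim
      case (elim \<omega>)
      then have "(\<Sum>\<beta>\<in>B. c \<beta> * ito_int M W \<beta> t \<omega>) = (\<Sum>\<beta>\<in>B. c \<beta> * I \<beta> t \<omega>)" by (intro sum.cong) auto
      then show ?case using elim by simp
    qed
    then have "expectation (X t) = expectation (\<lambda>\<omega>. (\<Sum>\<beta>\<in>B. c \<beta> * I \<beta> t \<omega>) + p * U t \<omega>)"
    proof (intro integral_cong_AE)
      show "X t \<in> borel_measurable M" using iX by (rule borel_measurable_integrable)
      show "(\<lambda>\<omega>. (\<Sum>\<beta>\<in>B. c \<beta> * I \<beta> t \<omega>) + p * U t \<omega>) \<in> borel_measurable M"
        by (intro borel_measurable_add borel_measurable_sum borel_measurable_times borel_measurable_const
            borel_measurable_integrable[OF iI] borel_measurable_integrable[OF iU])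
    qed
    also have "\<dots> = (\<Sum>\<beta>\<in>B. c \<beta> * expectation (I \<beta> t)) + p * expectation (U t)"
      using iI iU by simp
    finally show ?thesis using EX[OF t] EU[OF t] I(3)[OF _ t] by simp
  qed
  have one: "d / fact r = p / fact q" using mean[of 1] by simp
  then have "d \<noteq> 0" using assms(7) by auto
  \<comment> \<open>The value at 1 already equates \<open>d / fact r\<close> with
    \<open>p / fact q\<close>, so the value at 2 compares the bare powers of 2.\<close>
  moreover have "2 ^ r * (d / fact r) = 2 ^ q * (p / fact q)" using mean[of 2] by (simp add: mult.commute)
  ultimately have "(2::real) ^ r = 2 ^ q" using one assms(7) by simp
  then have rq: "r = q" by simp
  then have dp: "d = p" using one by simp
  obtain k where k: "d = 1 / 2 ^ k" "length (filter (\<lambda>i. i \<noteq> 0) \<alpha>) = 2 * k" "r = k + length (filter (\<lambda>i. i = 0) \<alpha>)"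
    using strat_mean_nonzero[OF s] \<open>d \<noteq> 0\<close> by (auto simp: rev_filter[symmetric])
  \<comment> \<open>The number of nonzero letters is \<open>2 * k\<close>, so the exponent of
    \<open>powr\<close> is the natural number \<open>k\<close>.\<close>
  show ?thesis using k rq dp by (simp add: powr_realpow)
qed

end
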